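(* Let $H\in(1/2,1)$ and let $(B_t^H)_{t\ge 0}$ be a fractional Brownian motion of Hurst index $H$. Then the equation $$dX(t)=X(t)\,\delta B_t^H,\qquad X(0)=1,$$ has a unique solution, the geometric fractional Brownian motion $$X(t)=\exp\left(B_t^H-\frac{t^{2H}}{2}\right).$$
   Context: Fractional Brownian motion of Hurst index $H$ is a zero-mean Gaussian process $(B_t^H)_{t\ge0}$, defined on a complete probability space $(\Omega,\mathcal F,P)$, with covariance $E[B_t^HB_s^H]=\frac12(t^{2H}+s^{2H}-|t-s|^{2H})$. Fix an arbitrary time horizon $T>0$ and consider times $t\in[0,T]$. Put $\alpha_H=H(2H-1)$. Let $\mathcal U$ be the Hilbert space obtained by completing the linear combinations of indicators $1_{(0,t]}$, $t\in[0,T]$, with respect to the inner product $$\langle\varphi,\psi\rangle_{\mathcal U}=\alpha_H\int_0^T\int_0^T\varphi(u)\psi(v)|u-v|^{2H-2}\,du\,dv .$$ The map $1_{(0,t]}\mapsto B_t^H$ extends to a linear isometry $\varphi\mapsto B^H(\varphi)$ from $\mathcal U$ into $L^2(\Omega)$, so $\{B^H(\varphi)\}_{\varphi\in\mathcal U}$ is a zero-mean Gaussian process with covariance $E[B^H(\varphi)B^H(\psi)]=\langle\varphi,\psi\rangle_{\mathcal U}$. Malliavin derivative: for a smooth random variable $F=f(B^H(\varphi_1),\dots,B^H(\varphi_n))$, with $n\ge 1$, $\varphi_i\in\mathcal U$ and $f$ an infinitely differentiable function on $\mathbb R^n$ with bounded partial derivatives, set $$DF=\sum_{i=1}^n\frac{\partial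 f}{\partial x_i}(B^H(\varphi_1),\dots,B^H(\varphi_n))\,\varphi_i .$$ $D$ extends to the completion $\mathbb D^{1,2}$ of the set of smooth random variables with respect to the norm $(E|F|^2)^{1/2}+(E\|DF\|_{\mathcal U}^2)^{1/2}$. The divergence operator $\delta:\mathrm{Dom}\,\delta\subset L^2(\Omega;\mathcal U)\to L^2(\Omega)$ is the adjoint of $D$: $E[F\delta(X)]=E[\langle DF,X\rangle_{\mathcal U}]$ for all $F\in\mathbb D^{1,2}$. The divergence integral of $X$ with respect to $B^H$ is $\int_0^TX(s)\,\delta B^H(s):=\delta(X)$, and $\int_0^tX(s)\,\delta B^H(s):=\delta(X1_{(0,t]})$. A solution of the equation is a process $X$ satisfying $$X(t)=1+\int_0^tX(s)\,\delta B^H(s),$$ provided that the stochastic integral is well-defined, i.e. $X1_{(0,t]}\in\mathrm{Dom}\,\delta$. Uniqueness is understood up to modification: any two solutions $X,Y$ satisfy $P(X(t)=Y(t))=1$ for each $t$. *)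

theory Defs
  imports "HOL-Probability.Probability"
begin

section \<open>Square integrable random variables\<close>

definition L2_rv ::
  "'a measure \<Rightarrow> ('a \<Rightarrow> 'b::{real_normed_vector,second_countable_topology}) \<Rightarrow> bool" where
  "L2_rv M X \<longleftrightarrow> X \<in> borel_measurable M \<and> integrable M (\<lambda>\<omega>. (norm (X \<omega>))\<^sup>2)"

definition L2_tendsto ::
  "'a measure \<Rightarrow> (nat \<Rightarrow> 'a \<Rightarrow> 'b::{real_normed_vector,second_countable_topology}) \<Rightarrow>
    ('a \<Rightarrow> 'b) \<Rightarrow> bool" where
  "L2_tendsto M X Y \<longleftrightarrow> (\<forall>k. L2_rv M (X k)) \<and> L2_rv M Y \<and>
     (\<lambda>k. \<integral>\<omega>. (norm (X k \<omega> - Y \<omega>))\<^sup>2 \<partial>M) \<longlonglongrightarrow> 0"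


section \<open>Fractional Brownian motion\<close>

text \<open>Constants count as (degenerate) Gaussian variables.\<close>

definition gaussian_rv :: "'a measure \<Rightarrow> ('a \<Rightarrow> real) \<Rightarrow> bool" where
  "gaussian_rv M Y \<longleftrightarrow> Y \<in> borel_measurable M \<and>
     ((\<exists>\<mu> \<sigma>. 0 < \<sigma> \<and> distributed M lborel Y (\<lambda>x. ennreal (normal_density \<mu> \<sigma> x))) \<or>
      (\<exists>\<mu>. AE \<omega> in M. Y \<omega> = \<mu>))"

definition gaussian_process :: "'a measure \<Rightarrow> 'i set \<Rightarrow> ('i \<Rightarrow> 'a \<Rightarrow> real) \<Rightarrow> bool" where
  "gaussian_process M I B \<longleftrightarrow>
     (\<forall>S c. finite S \<and> S \<subseteq> I \<longrightarrow> gaussian_rv M (\<lambda>\<omega>. \<Sum>t\<in>S. c t * B t \<omega>))"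

definition fractional_brownian_motion ::
  "'a measure \<Rightarrow> real \<Rightarrow> (real \<Rightarrow> 'a \<Rightarrow> real) \<Rightarrow> bool" where
  "fractional_brownian_motion M H B \<longleftrightarrow>
     gaussian_process M {0..} B \<and>
     (\<forall>t\<ge>0. (\<integral>\<omega>. B t \<omega> \<partial>M) = 0) \<and>
     (\<forall>s\<ge>0. \<forall>t\<ge>0. (\<integral>\<omega>. B t \<omega> * B s \<omega> \<partial>M) =
        (t powr (2 * H) + s powr (2 * H) - \<bar>t - s\<bar> powr (2 * H)) / 2)"


section \<open>The Hilbert space \<open>\<U>\<close>\<close>

definition U_inner :: "real \<Rightarrow> real \<Rightarrow> (real \<Rightarrow> real) \<Rightarrow> (real \<Rightarrow> real) \<Rightarrow> real" where
  "U_inner H T \<phi> \<psi> = H * (2 * H - 1) *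
     (LINT u:{0..T}|lborel. LINT v:{0..T}|lborel. \<phi> u * \<psi> v * \<bar>u - v\<bar> powr (2 * H - 2))"

text \<open>A completion of the step functions is given by a complete inner product space
  \<open>'u\<close> and the images \<open>e t\<close> of the generators \<open>1\<^bsub>(0,t]\<^esub>\<close>. For \<open>t > 0\<close>
  these are linearly independent, so \<open>e\<close> extends linearly to all step functions; the first
  clause says that the extension is isometric, the second that its range is dense. The pair
  \<open>('u, e)\<close> is thereby determined up to a unique isometric isomorphism. Such a space is
  separable (\<open>t \<mapsto> e t\<close> is continuous on \<open>[0,T]\<close>), so the sort constraint
  \<open>second_countable_topology\<close> excludes nothing.\<close>

definition U_completion ::
  "real \<Rightarrow> real \<Rightarrow> (real \<Rightarrow> 'u::{real_inner,banach,second_countable_topology}) \<Rightarrow> bool" where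
  "U_completion H T e \<longleftrightarrow>
     (\<forall>s\<in>{0..T}. \<forall>t\<in>{0..T}. e s \<bullet> e t = U_inner H T (indicator {0<..s}) (indicator {0<..t})) \<and>
     closure (span (e ` {0..T})) = UNIV"

text \<open>\<open>is_wiener_integral M B T e \<phi> Y\<close>: the random variable \<open>Y\<close> is a version of
  \<open>B\<^sup>H(\<phi>)\<close>, the image of \<open>\<phi>\<close> under the extension by continuity of
  \<open>1\<^bsub>(0,t]\<^esub> \<mapsto> B\<^sub>t\<close>.\<close>

definition is_wiener_integral ::
  "'a measure \<Rightarrow> (real \<Rightarrow> 'a \<Rightarrow> real) \<Rightarrow> real \<Rightarrow>
    (real \<Rightarrow> 'u::{real_inner,banach,second_countable_topology}) \<Rightarrow>
    'u \<Rightarrow> ('a \<Rightarrow> real) \<Rightarrow> bool" where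
  "is_wiener_integral M B T e \<phi> Y \<longleftrightarrow>
     (\<exists>S c. (\<forall>k::nat. finite (S k) \<and> S k \<subseteq> {0..T}) \<and>
        (\<lambda>k. \<Sum>t\<in>S k. c k t *\<^sub>R e t) \<longlonglongrightarrow> \<phi> \<and>
        L2_tendsto M (\<lambda>k \<omega>. \<Sum>t\<in>S k. c k t * B t \<omega>) Y)"


section \<open>Malliavin derivative\<close>

text \<open>A function on \<open>\<real>\<^sup>n\<close> is encoded as a function on \<open>nat \<Rightarrow> real\<close> that
  only depends on the coordinates below \<open>n\<close>; for such functions continuity in the product
  topology is continuity on \<open>\<real>\<^sup>n\<close>.\<close>

definition partial_deriv :: "nat \<Rightarrow> ((nat \<Rightarrow> real) \<Rightarrow> real) \<Rightarrow> (nat \<Rightarrow> real) \<Rightarrow> real" where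
  "partial_deriv i f x = deriv (\<lambda>y. f (x(i := y))) (x i)"

fun iter_partial_deriv ::
  "nat list \<Rightarrow> ((nat \<Rightarrow> real) \<Rightarrow> real) \<Rightarrow> (nat \<Rightarrow> real) \<Rightarrow> real" where
  "iter_partial_deriv [] f = f"
| "iter_partial_deriv (i # is) f = partial_deriv i (iter_partial_deriv is f)"

text \<open>All partial derivatives of all orders exist and are continuous, and those of order at
  least one are bounded; \<open>f\<close> itself may be unbounded.\<close>

definition smooth_bounded_partials :: "nat \<Rightarrow> ((nat \<Rightarrow> real) \<Rightarrow> real) \<Rightarrow> bool" where
  "smooth_bounded_partials n f \<longleftrightarrow>
     (\<forall>x y. (\<forall>i<n. x i = y i) \<longrightarrow> f x = f y) \<and>
     (\<forall>is. set is \<subseteq> {..<n} \<longrightarrow>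
        continuous_on UNIV (iter_partial_deriv is f) \<and>
        (\<forall>i<n. \<forall>x. (\<lambda>y. iter_partial_deriv is f (x(i := y))) field_differentiable at (x i)) \<and>
        (is \<noteq> [] \<longrightarrow> bounded (range (iter_partial_deriv is f))))"

text \<open>\<open>smooth_malliavin M B T e F G\<close>: \<open>F\<close> is a smooth random variable and
  \<open>G = DF\<close>.\<close>

definition smooth_malliavin ::
  "'a measure \<Rightarrow> (real \<Rightarrow> 'a \<Rightarrow> real) \<Rightarrow> real \<Rightarrow>
    (real \<Rightarrow> 'u::{real_inner,banach,second_countable_topology}) \<Rightarrow>
    ('a \<Rightarrow> real) \<Rightarrow> ('a \<Rightarrow> 'u) \<Rightarrow> bool" where
  "smooth_malliavin M B T e F G \<longleftrightarrow>
     (\<exists>n\<ge>1. \<exists>f \<phi> Y. smooth_bounded_partials n f \<and>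
        (\<forall>i<n. is_wiener_integral M B T e (\<phi> i) (Y i)) \<and>
        F = (\<lambda>\<omega>. f (\<lambda>i. Y i \<omega>)) \<and>
        G = (\<lambda>\<omega>. \<Sum>i<n. partial_deriv i f (\<lambda>j. Y j \<omega>) *\<^sub>R \<phi> i))"

text \<open>\<open>malliavin M B T e F G\<close>: \<open>F \<in> D\<^sup>1\<^sup>,\<^sup>2\<close> and \<open>G = DF\<close>, i.e. \<open>(F, G)\<close> lies in
  the closure of the graph of \<open>D\<close> on smooth random variables.\<close>

definition malliavin ::
  "'a measure \<Rightarrow> (real \<Rightarrow> 'a \<Rightarrow> real) \<Rightarrow> real \<Rightarrow>
    (real \<Rightarrow> 'u::{real_inner,banach,second_countable_topology}) \<Rightarrow>
    ('a \<Rightarrow> real) \<Rightarrow> ('a \<Rightarrow> 'u) \<Rightarrow> bool" where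
  "malliavin M B T e F G \<longleftrightarrow>
     (\<exists>F' G'. (\<forall>k. smooth_malliavin M B T e (F' k) (G' k)) \<and>
        L2_tendsto M F' F \<and> L2_tendsto M G' G)"


section \<open>Divergence\<close>

text \<open>\<open>has_divergence M B T e h Y\<close>: \<open>h \<in> Dom \<delta>\<close> and \<open>\<delta>(h) = Y\<close>. The
  \<open>\<sigma>\<close>-algebra of \<open>M\<close> may be larger than the one generated by
  \<open>(B\<^sub>t)\<^bsub>t \<in> [0,T]\<^esub>\<close>; then \<open>D\<^sup>1\<^sup>,\<^sup>2\<close> is not dense in
  \<open>L\<^sup>2(\<Omega>)\<close> and duality alone does not determine \<open>Y\<close>. As usual for adjoints, \<open>\<delta>\<close> takes
  values in the \<open>L\<^sup>2\<close>-closure of the domain \<open>D\<^sup>1\<^sup>,\<^sup>2\<close> of \<open>D\<close>. If the domain is dense, that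
  clause is vacuous.\<close>

definition has_divergence ::
  "'a measure \<Rightarrow> (real \<Rightarrow> 'a \<Rightarrow> real) \<Rightarrow> real \<Rightarrow>
    (real \<Rightarrow> 'u::{real_inner,banach,second_countable_topology}) \<Rightarrow>
    ('a \<Rightarrow> 'u) \<Rightarrow> ('a \<Rightarrow> real) \<Rightarrow> bool" where
  "has_divergence M B T e h Y \<longleftrightarrow>
     L2_rv M h \<and> L2_rv M Y \<and>
     (\<exists>F G. (\<forall>k. malliavin M B T e (F k) (G k)) \<and> L2_tendsto M F Y) \<and>
     (\<forall>F G. malliavin M B T e F G \<longrightarrow>
        (\<integral>\<omega>. F \<omega> * Y \<omega> \<partial>M) = (\<integral>\<omega>. G \<omega> \<bullet> h \<omega> \<partial>M))"

text \<open>\<open>restricts_to M H T e X t h\<close>: \<open>h \<in> L\<^sup>2(\<Omega>;\<U>)\<close> is the process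
  \<open>X 1\<^bsub>(0,t]\<^esub>\<close>. Since \<open>\<U>\<close> also contains elements that are not functions, the function
  \<open>\<phi> = X(\<cdot>,\<omega>) 1\<^bsub>(0,t]\<^esub>\<close> is identified with the element \<open>h \<omega>\<close> whose inner
  products with the generators \<open>1\<^bsub>(0,r]\<^esub>\<close> are given by the defining double integral; as the
  generators are total, there is at most one such element. The integrability condition makes
  these integrals absolutely convergent. As \<open>X\<close> is only given up to modification (and
  \<open>B\<close>, hence \<open>X\<close>, need not be jointly measurable), paths are taken from a jointly
  measurable version \<open>X'\<close>; by Fubini, \<open>h\<close> does not depend on its choice up to null
  sets.\<close>

definition restricts_to ::
  "'a measure \<Rightarrow> real \<Rightarrow> real \<Rightarrow>
    (real \<Rightarrow> 'u::{real_inner,banach,second_countable_topology}) \<Rightarrow>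
    (real \<Rightarrow> 'a \<Rightarrow> real) \<Rightarrow> real \<Rightarrow> ('a \<Rightarrow> 'u) \<Rightarrow> bool" where
  "restricts_to M H T e X t h \<longleftrightarrow>
     L2_rv M h \<and>
     (\<exists>X'. (AE u in lborel. u \<in> {0<..t} \<longrightarrow> (AE \<omega> in M. X' u \<omega> = X u \<omega>)) \<and>
        integrable (lborel \<Otimes>\<^sub>M M) (\<lambda>(u, \<omega>). X' u \<omega> * indicator {0<..t} u) \<and>
        (AE \<omega> in M. \<forall>r\<in>{0..T}.
           h \<omega> \<bullet> e r =
             U_inner H T (\<lambda>u. X' u \<omega> * indicator {0<..t} u) (indicator {0<..r})))"

text \<open>\<open>has_divergence_integral M H B T e X t Y\<close>: \<open>X 1\<^bsub>(0,t]\<^esub> \<in> Dom \<delta>\<close> and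
  \<open>Y\<close> is a version of \<open>\<integral>\<^sub>0\<^sup>t X(s) \<delta>B\<^sup>H(s)\<close>.\<close>

definition has_divergence_integral ::
  "'a measure \<Rightarrow> real \<Rightarrow> (real \<Rightarrow> 'a \<Rightarrow> real) \<Rightarrow> real \<Rightarrow>
    (real \<Rightarrow> 'u::{real_inner,banach,second_countable_topology}) \<Rightarrow>
    (real \<Rightarrow> 'a \<Rightarrow> real) \<Rightarrow> real \<Rightarrow> ('a \<Rightarrow> real) \<Rightarrow> bool" where
  "has_divergence_integral M H B T e X t Y \<longleftrightarrow>
     (\<exists>h. restricts_to M H T e X t h \<and> has_divergence M B T e h Y)"

definition is_solution ::
  "'a measure \<Rightarrow> real \<Rightarrow> (real \<Rightarrow> 'a \<Rightarrow> real) \<Rightarrow> real \<Rightarrow>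
    (real \<Rightarrow> 'u::{real_inner,banach,second_countable_topology}) \<Rightarrow>
    (real \<Rightarrow> 'a \<Rightarrow> real) \<Rightarrow> bool" where
  "is_solution M H B T e X \<longleftrightarrow>
     (\<forall>t\<in>{0..T}. X t \<in> borel_measurable M \<and>
        (\<exists>Y. has_divergence_integral M H B T e X t Y \<and> (AE \<omega> in M. X t \<omega> = 1 + Y \<omega>)))"

end

theory Submission
  imports Defs "HOL-Complex_Analysis.Complex_Analysis"
begin

text \<open>
  Let \<open>X\<^sub>s = exp (B\<^sub>s - s\<^bsup>2H\<^esup> / 2)\<close> be the geometric fractional Brownian motion.

  Existence is an infinitesimal Cameron-Martin formula. Weighting the probability with \<open>X\<^sub>s\<close> shifts the
  Gaussian process by its covariance with \<open>B\<^sub>s\<close> (\<open>cameron_martin\<close>): if \<open>F = f(Y)\<close> with Wiener integrals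
  \<open>Y\<^sub>i\<close> of \<open>\<phi>\<^sub>i\<close>, then \<open>E (F X\<^sub>s) = E (f (Y + c(s)))\<close> with \<open>c\<^sub>i(s) = \<langle>\<phi>\<^sub>i, 1\<^bsub>(0,s]\<^esub>\<rangle>\<close>. Differentiating in \<open>s\<close> and
  shifting back gives \<open>\<Sum>\<^sub>i E (\<partial>\<^sub>i f(Y) X\<^sub>s) c\<^sub>i'(s)\<close> (\<open>expectation_shift_derivative\<close>). Integrated over
  \<open>(0, t]\<close>, the left-hand side is \<open>E (F (X\<^sub>t - 1))\<close> and, by Fubini, the right-hand side is
  \<open>E \<langle>DF, X 1\<^bsub>(0,t]\<^esub>\<rangle>\<close>; this is the duality that says \<open>X\<^sub>t - 1 = \<delta> (X 1\<^bsub>(0,t]\<^esub>)\<close>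
  (\<open>malliavin_duality\<close>). Two points remain. The process \<open>X 1\<^bsub>(0,t]\<^esub>\<close> has to be a square integrable
  random element of the completion (\<open>geometric_fbm_restricts_to\<close>): it is the almost sure limit of
  dyadic step processes, and the error is controlled because the increments of the generators are
  positively correlated for \<open>H > 1/2\<close>. And \<open>X\<^sub>t - 1\<close> has to be a limit of smooth random variables
  (\<open>geometric_fbm_in_closure\<close>), which are obtained from a logistic cut-off of the exponential.

  Uniqueness is a conservation law. Let \<open>Z\<close> be the difference of two solutions and \<open>W\<close> the Wiener
  integral of a step function \<open>w\<close> with kernel \<open>k(u) = d/du \<langle>w, 1\<^bsub>(0,u]\<^esub>\<rangle>\<close>. The derivative of
  \<open>cos (W + \<theta>)\<close> is \<open>cos (W + \<theta> + \<pi>/2) w\<close>, so testing the equation with such waves yields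
  \<open>c\<^sub>\<theta>' = c\<^bsub>\<theta>+\<pi>/2\<^esub> k\<close> for the coefficients \<open>c\<^sub>\<theta>(t) = E (cos (W + \<theta>) Z\<^sub>t)\<close>. As \<open>c\<^bsub>\<theta>+\<pi>\<^esub> = - c\<^sub>\<theta>\<close>, the sum
  \<open>c\<^sub>\<theta>\<^sup>2 + c\<^bsub>\<theta>+\<pi>/2\<^esub>\<^sup>2\<close> is constant, and it is \<open>0\<close> at time \<open>0\<close> (\<open>solution_difference_wave\<close>). Hence \<open>Z\<^sub>t\<close> is
  orthogonal to all smooth random variables, while it lies in their closure.

  Both halves need to know that the moments \<open>E (Z cos (l \<bullet> Y + \<theta>))\<close> determine \<open>E (Z f(Y))\<close> for
  Lipschitz functions \<open>f\<close> (\<open>weighted_law_eqI\<close>); this stands in for the joint Gaussian laws, as only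
  the laws of linear combinations of the process are given. The required wave moments of Gaussian
  variables follow from their exponential moments by analytic continuation (\<open>expectation_cos_exp\<close>).
\<close>

section \<open>Square integrable random variables\<close>

lemma L2_rvD:
  assumes "L2_rv M X"
  shows "X \<in> borel_measurable M" "integrable M (\<lambda>\<omega>. (norm (X \<omega>))\<^sup>2)"
  using assms by (auto simp: L2_rv_def)

lemma L2_rv_dominated:
  fixes U :: "'a \<Rightarrow> 'b::{real_normed_vector,second_countable_topology}"
  assumes "U \<in> borel_measurable M" "integrable M g"
    and "AE \<omega> in M. (norm (U \<omega>))\<^sup>2 \<le> g \<omega>"
  shows "L2_rv M U"
  unfolding L2_rv_def
proof
  show "integrable M (\<lambda>\<omega>. (norm (U \<omega>))\<^sup>2)"
    by (rule Bochner_Integration.integrable_bound[OF assms(2)])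
       (use assms(1,3) in \<open>auto elim!: eventually_mono\<close>)
qed (fact assms)

lemma L2_rv_add:
  fixes U V :: "'a \<Rightarrow> 'b::{real_normed_vector,second_countable_topology}"
  assumes "L2_rv M U" "L2_rv M V"
  shows "L2_rv M (\<lambda>\<omega>. U \<omega> + V \<omega>)"
proof (rule L2_rv_dominated)
  show "integrable M (\<lambda>\<omega>. 2 * (norm (U \<omega>))\<^sup>2 + 2 * (norm (V \<omega>))\<^sup>2)"
    using assms by (auto simp: L2_rv_def)
  show "AE \<omega> in M. (norm (U \<omega> + V \<omega>))\<^sup>2 \<le> 2 * (norm (U \<omega>))\<^sup>2 + 2 * (norm (V \<omega>))\<^sup>2"
  proof (rule AE_I2)
    fix \<omega>
    have "(norm (U \<omega> + V \<omega>))\<^sup>2 \<le> (norm (U \<omega>) + norm (V \<omega>))\<^sup>2"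
      by (intro power_mono norm_triangle_ineq) auto
    also have "\<dots> \<le> 2 * (norm (U \<omega>))\<^sup>2 + 2 * (norm (V \<omega>))\<^sup>2"
      using sum_squares_bound[of "norm (U \<omega>)" "norm (V \<omega>)"] by (simp add: power2_sum)
    finally show "(norm (U \<omega> + V \<omega>))\<^sup>2 \<le> 2 * (norm (U \<omega>))\<^sup>2 + 2 * (norm (V \<omega>))\<^sup>2" .
  qed
qed (use assms in \<open>auto simp: L2_rv_def\<close>)

lemma L2_rv_scaleR:
  fixes U :: "'a \<Rightarrow> 'b::{real_normed_vector,second_countable_topology}"
  assumes "L2_rv M U"
  shows "L2_rv M (\<lambda>\<omega>. c *\<^sub>R U \<omega>)"
  using assms by (auto simp: L2_rv_def power_mult_distrib)

lemma L2_rv_cmult: "L2_rv M U \<Longrightarrow> L2_rv M (\<lambda>\<omega>. c * U \<omega>)" for U :: "'a \<Rightarrow> real"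
  using L2_rv_scaleR[of M U c] by simp

lemma L2_rv_diff:
  fixes U V :: "'a \<Rightarrow> 'b::{real_normed_vector,second_countable_topology}"
  assumes "L2_rv M U" "L2_rv M V"
  shows "L2_rv M (\<lambda>\<omega>. U \<omega> - V \<omega>)"
  using L2_rv_add[OF assms(1) L2_rv_scaleR[OF assms(2), of "-1"]] by simp

lemma L2_rv_zero: "L2_rv M (\<lambda>_. 0)"
  by (simp add: L2_rv_def)

lemma L2_rv_sum:
  fixes U :: "'i \<Rightarrow> 'a \<Rightarrow> 'b::{real_normed_vector,second_countable_topology}"
  assumes "\<And>i. i \<in> I \<Longrightarrow> L2_rv M (U i)"
  shows "L2_rv M (\<lambda>\<omega>. \<Sum>i\<in>I. U i \<omega>)"
  using assms by (induction I rule: infinite_finite_induct) (auto intro: L2_rv_add L2_rv_zero)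

lemma L2_rv_const: "finite_measure M \<Longrightarrow> L2_rv M (\<lambda>_. c)"
  by (auto simp: L2_rv_def intro: finite_measure.integrable_const)

lemma L2_rv_bounded:
  fixes U :: "'a \<Rightarrow> 'b::{real_normed_vector,second_countable_topology}"
  assumes "finite_measure M" "U \<in> borel_measurable M" "\<And>\<omega>. norm (U \<omega>) \<le> C"
  shows "L2_rv M U"
  using assms by (intro L2_rv_dominated[of U M "\<lambda>_. C\<^sup>2"])
    (auto intro!: finite_measure.integrable_const power_mono)

lemma L2_rv_bounded_mult:
  fixes \<xi> :: "'a \<Rightarrow> real" and U :: "'a \<Rightarrow> 'b::{real_normed_vector,second_countable_topology}"
  assumes "\<xi> \<in> borel_measurable M" "\<And>\<omega>. \<bar>\<xi> \<omega>\<bar> \<le> C" "L2_rv M U"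
  shows "L2_rv M (\<lambda>\<omega>. \<xi> \<omega> *\<^sub>R U \<omega>)"
proof (rule L2_rv_dominated)
  show "integrable M (\<lambda>\<omega>. C\<^sup>2 * (norm (U \<omega>))\<^sup>2)" using assms(3) by (simp add: L2_rv_def)
  have "\<bar>\<xi> \<omega>\<bar>\<^sup>2 * (norm (U \<omega>))\<^sup>2 \<le> C\<^sup>2 * (norm (U \<omega>))\<^sup>2" for \<omega>
    using assms(2) by (intro mult_right_mono power_mono) auto
  then show "AE \<omega> in M. (norm (\<xi> \<omega> *\<^sub>R U \<omega>))\<^sup>2 \<le> C\<^sup>2 * (norm (U \<omega>))\<^sup>2"
    by (simp add: power_mult_distrib)
qed (use assms in \<open>auto simp: L2_rv_def\<close>)

lemma L2_rv_cong_AE: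
  assumes "L2_rv M U" "V \<in> borel_measurable M" "AE \<omega> in M. U \<omega> = V \<omega>"
  shows "L2_rv M V"
  by (rule L2_rv_dominated[OF assms(2) L2_rvD(2)[OF assms(1)]])
     (use assms(3) in \<open>auto elim!: eventually_mono\<close>)

lemma L2_integrable_norm_mult:
  fixes U :: "'a \<Rightarrow> 'b::{real_normed_vector,second_countable_topology}"
    and V :: "'a \<Rightarrow> 'c::{real_normed_vector,second_countable_topology}"
  assumes "L2_rv M U" "L2_rv M V"
  shows "integrable M (\<lambda>\<omega>. norm (U \<omega>) * norm (V \<omega>))"
proof (rule Bochner_Integration.integrable_bound)
  show "integrable M (\<lambda>\<omega>. (norm (U \<omega>))\<^sup>2 + (norm (V \<omega>))\<^sup>2)"
    using assms by (auto simp: L2_rv_def)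
  have "norm (U \<omega>) * norm (V \<omega>) \<le> (norm (U \<omega>))\<^sup>2 + (norm (V \<omega>))\<^sup>2" for \<omega>
  proof -
    have "0 \<le> norm (U \<omega>) * norm (V \<omega>)" by simp
    then show ?thesis using sum_squares_bound[of "norm (U \<omega>)" "norm (V \<omega>)"] by linarith
  qed
  then show "AE \<omega> in M. norm (norm (U \<omega>) * norm (V \<omega>)) \<le> norm ((norm (U \<omega>))\<^sup>2 + (norm (V \<omega>))\<^sup>2)"
    by simp
qed (use assms in \<open>auto simp: L2_rv_def\<close>)

lemma L2_integrable_inner:
  fixes U V :: "'a \<Rightarrow> 'b::{real_inner,second_countable_topology}"
  assumes "L2_rv M U" "L2_rv M V"
  shows "integrable M (\<lambda>\<omega>. U \<omega> \<bullet> V \<omega>)"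
  by (rule Bochner_Integration.integrable_bound[OF L2_integrable_norm_mult[OF assms]])
     (use assms in \<open>auto simp: L2_rv_def Cauchy_Schwarz_ineq2\<close>)

lemma L2_integrable_mult:
  fixes U V :: "'a \<Rightarrow> real"
  assumes "L2_rv M U" "L2_rv M V"
  shows "integrable M (\<lambda>\<omega>. U \<omega> * V \<omega>)"
  using L2_integrable_inner[OF assms] by simp

lemma L2_Cauchy_Schwarz_norm:
  fixes U :: "'a \<Rightarrow> 'b::{real_normed_vector,second_countable_topology}"
    and V :: "'a \<Rightarrow> 'c::{real_normed_vector,second_countable_topology}"
  assumes "L2_rv M U" "L2_rv M V"
  shows "(\<integral>\<omega>. norm (U \<omega>) * norm (V \<omega>) \<partial>M) \<le>
    sqrt (\<integral>\<omega>. (norm (U \<omega>))\<^sup>2 \<partial>M) * sqrt (\<integral>\<omega>. (norm (V \<omega>))\<^sup>2 \<partial>M)"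
proof -
  define a b c where "a = (\<integral>\<omega>. (norm (U \<omega>))\<^sup>2 \<partial>M)" and "b = (\<integral>\<omega>. (norm (V \<omega>))\<^sup>2 \<partial>M)"
    and "c = (\<integral>\<omega>. norm (U \<omega>) * norm (V \<omega>) \<partial>M)"
  have ab: "a \<ge> 0" "b \<ge> 0" by (auto simp: a_def b_def)
  have c0: "c \<ge> 0" by (auto simp: c_def)
  have quad: "2 * l * c \<le> l\<^sup>2 * a + b" for l
  proof -
    have "0 \<le> (\<integral>\<omega>. (l * norm (U \<omega>) - norm (V \<omega>))\<^sup>2 \<partial>M)" by simp
    also have "\<dots> = (\<integral>\<omega>. l\<^sup>2 * (norm (U \<omega>))\<^sup>2 + (norm (V \<omega>))\<^sup>2 - 2 * l * (norm (U \<omega>) * norm (V \<omega>)) \<partial>M)"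
      by (intro Bochner_Integration.integral_cong) (auto simp: power2_eq_square algebra_simps)
    also have "\<dots> = l\<^sup>2 * a + b - 2 * l * c"
      unfolding a_def b_def c_def
      using assms L2_integrable_norm_mult[OF assms] by (simp add: L2_rv_def)
    finally show ?thesis by simp
  qed
  \<comment> \<open>The bound is strongest for \<open>l = c / a\<close>; if \<open>a = 0\<close>, large \<open>l\<close> forces \<open>c = 0\<close>.\<close>
  have "c\<^sup>2 \<le> a * b"
  proof (cases "a = 0")
    case True
    have "c = 0"
    proof (rule ccontr)
      assume "c \<noteq> 0"
      then have "2 * ((b + 1) / c) * c = 2 * (b + 1)" by simp
      with quad[of "(b + 1) / c"] True ab show False by simp
    qed
    with True show ?thesis by simp
  next
    case False
    then have a: "a > 0" using ab by simp
    have "2 * (c / a) * c \<le> (c / a)\<^sup>2 * a + b" by (rule quad)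
    also have "(c / a)\<^sup>2 * a = c\<^sup>2 / a" using a by (simp add: power2_eq_square)
    finally have "c\<^sup>2 / a \<le> b" by (simp add: power2_eq_square)
    then show ?thesis using a by (simp add: field_simps)
  qed
  then have "sqrt (c\<^sup>2) \<le> sqrt (a * b)" by (rule real_sqrt_le_mono)
  then show ?thesis using c0 by (simp add: real_sqrt_mult a_def b_def c_def)
qed

lemma L2_Cauchy_Schwarz:
  fixes U V :: "'a \<Rightarrow> 'b::{real_inner,second_countable_topology}"
  assumes "L2_rv M U" "L2_rv M V"
  shows "\<bar>\<integral>\<omega>. U \<omega> \<bullet> V \<omega> \<partial>M\<bar> \<le>
    sqrt (\<integral>\<omega>. (norm (U \<omega>))\<^sup>2 \<partial>M) * sqrt (\<integral>\<omega>. (norm (V \<omega>))\<^sup>2 \<partial>M)"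
proof -
  have "\<bar>\<integral>\<omega>. U \<omega> \<bullet> V \<omega> \<partial>M\<bar> \<le> (\<integral>\<omega>. \<bar>U \<omega> \<bullet> V \<omega>\<bar> \<partial>M)"
    by (rule integral_abs_bound)
  also have "\<dots> \<le> (\<integral>\<omega>. norm (U \<omega>) * norm (V \<omega>) \<partial>M)"
    using L2_integrable_inner[OF assms] L2_integrable_norm_mult[OF assms]
    by (intro integral_mono) (auto simp: Cauchy_Schwarz_ineq2)
  also note L2_Cauchy_Schwarz_norm[OF assms]
  finally show ?thesis .
qed

lemma L2_integrable:
  fixes U :: "'a \<Rightarrow> 'b::{banach,second_countable_topology}"
  assumes "finite_measure M" "L2_rv M U"
  shows "integrable M U"
  using L2_integrable_norm_mult[OF assms(2) L2_rv_const[OF assms(1), of "1::real"]] L2_rvD(1)[OF assms(2)]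
  by (auto intro: integrable_norm_cancel)

lemma L1_le_L2:
  fixes U :: "'a \<Rightarrow> 'b::{real_normed_vector,second_countable_topology}"
  assumes "prob_space M" "L2_rv M U"
  shows "(\<integral>\<omega>. norm (U \<omega>) \<partial>M) \<le> sqrt (\<integral>\<omega>. (norm (U \<omega>))\<^sup>2 \<partial>M)"
proof -
  interpret prob_space M by fact
  show ?thesis
    using L2_Cauchy_Schwarz_norm[OF assms(2) L2_rv_const[OF finite_measure_axioms, of "1::real"]]
    by (simp add: prob_space)
qed

lemma L2_tendsto_inner:
  fixes Y Z :: "'a \<Rightarrow> 'b::{real_inner,second_countable_topology}"
  assumes "L2_tendsto M X Y" "L2_rv M Z"
  shows "(\<lambda>k. \<integral>\<omega>. X k \<omega> \<bullet> Z \<omega> \<partial>M) \<longlonglongrightarrow> (\<integral>\<omega>. Y \<omega> \<bullet> Z \<omega> \<partial>M)"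
proof -
  have X: "L2_rv M (X k)" and Y: "L2_rv M Y" for k using assms(1) by (auto simp: L2_tendsto_def)
  have "(\<lambda>k. sqrt (\<integral>\<omega>. (norm (X k \<omega> - Y \<omega>))\<^sup>2 \<partial>M) * sqrt (\<integral>\<omega>. (norm (Z \<omega>))\<^sup>2 \<partial>M))
      \<longlonglongrightarrow> sqrt 0 * sqrt (\<integral>\<omega>. (norm (Z \<omega>))\<^sup>2 \<partial>M)"
    using assms(1) by (intro tendsto_intros) (auto simp: L2_tendsto_def)
  then have lim: "(\<lambda>k. sqrt (\<integral>\<omega>. (norm (X k \<omega> - Y \<omega>))\<^sup>2 \<partial>M) * sqrt (\<integral>\<omega>. (norm (Z \<omega>))\<^sup>2 \<partial>M))
      \<longlonglongrightarrow> 0" by simp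
  have "norm ((\<integral>\<omega>. X k \<omega> \<bullet> Z \<omega> \<partial>M) - (\<integral>\<omega>. Y \<omega> \<bullet> Z \<omega> \<partial>M)) \<le>
      sqrt (\<integral>\<omega>. (norm (X k \<omega> - Y \<omega>))\<^sup>2 \<partial>M) * sqrt (\<integral>\<omega>. (norm (Z \<omega>))\<^sup>2 \<partial>M)" for k
  proof -
    have "(\<integral>\<omega>. X k \<omega> \<bullet> Z \<omega> \<partial>M) - (\<integral>\<omega>. Y \<omega> \<bullet> Z \<omega> \<partial>M) = (\<integral>\<omega>. (X k \<omega> - Y \<omega>) \<bullet> Z \<omega> \<partial>M)"
      using L2_integrable_inner[OF X assms(2), of k] L2_integrable_inner[OF Y assms(2)]
      by (simp add: inner_diff_left)
    then show ?thesis using L2_Cauchy_Schwarz[OF L2_rv_diff[OF X Y] assms(2), of k] by simp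
  qed
  then have "(\<lambda>k. (\<integral>\<omega>. X k \<omega> \<bullet> Z \<omega> \<partial>M) - (\<integral>\<omega>. Y \<omega> \<bullet> Z \<omega> \<partial>M)) \<longlonglongrightarrow> 0"
    by (intro Lim_null_comparison[OF _ lim] always_eventually) auto
  then show ?thesis by (simp add: LIM_zero_iff)
qed

lemma L2_tendsto_mult:
  fixes Y Z :: "'a \<Rightarrow> real"
  assumes "L2_tendsto M X Y" "L2_rv M Z"
  shows "(\<lambda>k. \<integral>\<omega>. X k \<omega> * Z \<omega> \<partial>M) \<longlonglongrightarrow> (\<integral>\<omega>. Y \<omega> * Z \<omega> \<partial>M)"
  using L2_tendsto_inner[OF assms] by simp

text \<open>Convergence in mean that is fast enough to be summable holds almost surely as well: by
  monotone convergence the sum of the norms has a finite expectation.\<close>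

lemma AE_summable_norm:
  fixes D :: "nat \<Rightarrow> 'a \<Rightarrow> 'b::{banach,second_countable_topology}"
  assumes "\<And>n. integrable M (D n)" "summable c" "\<And>n. (\<integral>\<omega>. norm (D n \<omega>) \<partial>M) \<le> c n"
  shows "AE \<omega> in M. summable (\<lambda>n. norm (D n \<omega>))"
proof -
  have [measurable]: "D n \<in> borel_measurable M" for n using assms(1) by auto
  have c0: "c n \<ge> 0" for n
    using order_trans[OF Bochner_Integration.integral_nonneg assms(3)[of n]] by simp
  have "(\<integral>\<^sup>+\<omega>. (\<Sum>n. ennreal (norm (D n \<omega>))) \<partial>M) = (\<Sum>n. \<integral>\<^sup>+\<omega>. ennreal (norm (D n \<omega>)) \<partial>M)"
    by (rule nn_integral_suminf) auto
  also have "\<dots> \<le> (\<Sum>n. ennreal (c n))"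
  proof (rule suminf_le)
    fix n show "(\<integral>\<^sup>+\<omega>. ennreal (norm (D n \<omega>)) \<partial>M) \<le> ennreal (c n)"
      using assms(1,3) by (subst nn_integral_eq_integral) (auto intro: ennreal_leI)
  qed auto
  also have "\<dots> = ennreal (\<Sum>n. c n)" by (rule suminf_ennreal2[OF c0 assms(2)])
  also have "\<dots> < \<infinity>" by simp
  finally have "AE \<omega> in M. (\<Sum>n. ennreal (norm (D n \<omega>))) \<noteq> \<infinity>"
    by (intro nn_integral_noteq_infinite) auto
  then show ?thesis
    by eventually_elim (auto intro!: summable_suminf_not_top)
qed

lemma AE_summable_L2:
  fixes D :: "nat \<Rightarrow> 'a \<Rightarrow> 'b::{banach,second_countable_topology}"
  assumes "prob_space M" "\<And>n. L2_rv M (D n)"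
    and "0 \<le> q" "q < 1" "\<And>n. (\<integral>\<omega>. (norm (D n \<omega>))\<^sup>2 \<partial>M) \<le> C * q ^ n"
  shows "AE \<omega> in M. summable (\<lambda>n. norm (D n \<omega>))"
proof (rule AE_summable_norm)
  show "integrable M (D n)" for n
    using assms(1,2) by (intro L2_integrable) (auto simp: prob_space.finite_measure)
  show "summable (\<lambda>n. sqrt C * sqrt q ^ n)"
    using assms by (intro summable_mult summable_geometric) auto
  show "(\<integral>\<omega>. norm (D n \<omega>) \<partial>M) \<le> sqrt C * sqrt q ^ n" for n
    using order_trans[OF L1_le_L2[OF assms(1,2)] real_sqrt_le_mono[OF assms(5)[of n]]]
    by (simp add: real_sqrt_mult real_sqrt_power)
qed

section \<open>Smooth functions of several variables\<close>

text \<open>Functions of \<open>n\<close> variables are functions of sequences that ignore all later coordinates, which is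
  part of this condition. With the sum of the coordinate distances, moving one coordinate after the
  other loses nothing.\<close>

definition lipschitz_coords :: "nat \<Rightarrow> real \<Rightarrow> ((nat \<Rightarrow> real) \<Rightarrow> real) \<Rightarrow> bool" where
  "lipschitz_coords n C f \<longleftrightarrow> (\<forall>x y. \<bar>f x - f y\<bar> \<le> C * (\<Sum>i<n. \<bar>x i - y i\<bar>))"

lemma lipschitz_coords_cong:
  assumes "lipschitz_coords n C f" "\<And>i. i < n \<Longrightarrow> x i = y i"
  shows "f x = f y"
proof -
  have "\<bar>f x - f y\<bar> \<le> C * (\<Sum>i<n. \<bar>x i - y i\<bar>)" using assms(1) by (simp add: lipschitz_coords_def)
  also have "\<dots> = 0" using assms(2) by simp
  finally show ?thesis by simp
qed

lemma lipschitz_coords_tendsto: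
  assumes "lipschitz_coords n C f" "\<And>i. i < n \<Longrightarrow> ((\<lambda>k. u k i) \<longlongrightarrow> x i) F"
  shows "((\<lambda>k. f (u k)) \<longlongrightarrow> f x) F"
proof -
  have "((\<lambda>k. C * (\<Sum>i<n. \<bar>u k i - x i\<bar>)) \<longlongrightarrow> C * (\<Sum>i<n. \<bar>x i - x i\<bar>)) F"
    using assms(2) by (intro tendsto_intros) auto
  then have lim: "((\<lambda>k. C * (\<Sum>i<n. \<bar>u k i - x i\<bar>)) \<longlongrightarrow> 0) F" by simp
  have "((\<lambda>k. f (u k) - f x) \<longlongrightarrow> 0) F"
    using assms(1) by (intro Lim_null_comparison[OF _ lim] always_eventually) (auto simp: lipschitz_coords_def)
  then show ?thesis by (simp add: LIM_zero_iff)
qed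

lemma lipschitz_coords_continuous:
  assumes "lipschitz_coords n C f"
  shows "continuous_on S f"
proof (unfold continuous_on_def, intro ballI, rule lipschitz_coords_tendsto[OF assms])
  fix x :: "nat \<Rightarrow> real" and i assume "x \<in> S"
  have "continuous_on S (\<lambda>x :: nat \<Rightarrow> real. x i)"
    by (rule continuous_on_subset[OF continuous_on_product_coordinates]) auto
  with \<open>x \<in> S\<close> show "((\<lambda>x. x i) \<longlongrightarrow> x i) (at x within S)" by (auto simp: continuous_on_def)
qed

lemma lipschitz_coords_measurable:
  assumes "lipschitz_coords n C f" "\<And>i. i < n \<Longrightarrow> Y i \<in> borel_measurable M"
  shows "(\<lambda>\<omega>. f (\<lambda>i. Y i \<omega>)) \<in> borel_measurable M"
proof -
  define Y' where "Y' = (\<lambda>\<omega> i. if i < n then Y i \<omega> else 0)"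
  have "(\<lambda>\<omega>. Y' \<omega> i) \<in> borel_measurable M" for i
    using assms(2) by (cases "i < n") (auto simp: Y'_def)
  then have "Y' \<in> borel_measurable M" by (rule measurable_coordinatewise_then_product)
  then have "(\<lambda>\<omega>. f (Y' \<omega>)) \<in> borel_measurable M"
    using borel_measurable_continuous_onI[OF lipschitz_coords_continuous[OF assms(1)]]
    by (rule measurable_compose)
  moreover have "f (Y' \<omega>) = f (\<lambda>i. Y i \<omega>)" for \<omega>
    by (rule lipschitz_coords_cong[OF assms(1)]) (auto simp: Y'_def)
  ultimately show ?thesis by simp
qed

lemma partial_mean_value:
  assumes "\<And>x. ((\<lambda>y. g (x(m := y))) has_real_derivative partial_deriv m g x) (at (x m))"
  obtains s where "\<bar>s - a\<bar> \<le> \<bar>b - a\<bar>"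
    "g (z(m := b)) - g (z(m := a)) = partial_deriv m g (z(m := s)) * (b - a)"
proof -
  have der: "((\<lambda>y. g (z(m := y))) has_real_derivative partial_deriv m g (z(m := t))) (at t)" for t
    using assms[of "z(m := t)"] by simp
  consider "a = b" | "a < b" | "b < a" by linarith
  then show thesis
  proof cases
    case 1
    then show ?thesis using that[of a] by simp
  next
    case 2
    then show ?thesis using MVT2[OF 2, OF der] that by (force simp: mult.commute)
  next
    case 3
    then obtain s where s: "b < s" "s < a"
      "g (z(m := a)) - g (z(m := b)) = (a - b) * partial_deriv m g (z(m := s))"
      using MVT2[OF 3, OF der] by blast
    from s(3) have "g (z(m := b)) - g (z(m := a)) = partial_deriv m g (z(m := s)) * (b - a)"
      by (simp add: algebra_simps)
    moreover have "\<bar>s - a\<bar> \<le> \<bar>b - a\<bar>" using s by simp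
    ultimately show ?thesis using that by blast
  qed
qed

text \<open>Changing one coordinate after the other reduces the mean value theorem to one variable.\<close>

lemma coordinatewise_mean_value:
  assumes "\<And>x y. (\<forall>i<n. x i = y i) \<Longrightarrow> g x = g y"
    and "\<And>m x. m < n \<Longrightarrow> ((\<lambda>y. g (x(m := y))) has_real_derivative partial_deriv m g x) (at (x m))"
  obtains \<xi> where "\<And>m i. m < n \<Longrightarrow> \<bar>\<xi> m i - x i\<bar> \<le> \<bar>y i - x i\<bar>"
    "g y - g x = (\<Sum>m<n. partial_deriv m g (\<xi> m) * (y m - x m))"
proof -
  define z where "z m = (\<lambda>i. if i < m then y i else x i)" for m
  have "\<exists>w. (\<forall>i. \<bar>w i - x i\<bar> \<le> \<bar>y i - x i\<bar>) \<and>
      g (z (Suc m)) - g (z m) = partial_deriv m g w * (y m - x m)" if m: "m < n" for m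
  proof -
    have z: "z (Suc m) = (z m)(m := y m)" "z m = (z m)(m := x m)"
      by (auto simp: z_def fun_eq_iff less_Suc_eq)
    obtain s where s: "\<bar>s - x m\<bar> \<le> \<bar>y m - x m\<bar>"
      "g ((z m)(m := y m)) - g ((z m)(m := x m)) = partial_deriv m g ((z m)(m := s)) * (y m - x m)"
      using partial_mean_value[OF assms(2)[OF m], where z = "z m" and a = "x m" and b = "y m"] by blast
    have "\<bar>((z m)(m := s)) i - x i\<bar> \<le> \<bar>y i - x i\<bar>" for i
      using s(1) by (auto simp: z_def)
    then show ?thesis using s(2) z by metis
  qed
  then obtain \<xi> where \<xi>: "\<And>m i. m < n \<Longrightarrow> \<bar>\<xi> m i - x i\<bar> \<le> \<bar>y i - x i\<bar>"
    "\<And>m. m < n \<Longrightarrow> g (z (Suc m)) - g (z m) = partial_deriv m g (\<xi> m) * (y m - x m)"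
    by metis
  have "g (z n) - g (z 0) = (\<Sum>m<n. g (z (Suc m)) - g (z m))"
    by (rule sum_lessThan_telescope[symmetric])
  also have "\<dots> = (\<Sum>m<n. partial_deriv m g (\<xi> m) * (y m - x m))"
    using \<xi>(2) by (intro sum.cong) auto
  also have "g (z n) = g y" by (rule assms(1)) (auto simp: z_def)
  also have "g (z 0) = g x" by (simp add: z_def)
  finally show thesis using that \<xi>(1) by blast
qed

lemma lipschitz_coords_of_bounded_partials:
  assumes "\<And>x y. (\<forall>i<n. x i = y i) \<Longrightarrow> g x = g y"
    and "\<And>m x. m < n \<Longrightarrow> ((\<lambda>y. g (x(m := y))) has_real_derivative partial_deriv m g x) (at (x m))"
    and "\<And>m x. m < n \<Longrightarrow> \<bar>partial_deriv m g x\<bar> \<le> C"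
  shows "lipschitz_coords n C g"
  unfolding lipschitz_coords_def
proof (intro allI)
  fix x y
  obtain \<xi> where "g x - g y = (\<Sum>m<n. partial_deriv m g (\<xi> m) * (x m - y m))"
    using coordinatewise_mean_value[OF assms(1,2), where x = y and y = x] by blast
  then have "\<bar>g x - g y\<bar> \<le> (\<Sum>m<n. \<bar>partial_deriv m g (\<xi> m) * (x m - y m)\<bar>)" by simp
  also have "\<dots> \<le> (\<Sum>m<n. C * \<bar>x m - y m\<bar>)"
    using assms(3) by (intro sum_mono) (auto simp: abs_mult intro!: mult_right_mono)
  finally show "\<bar>g x - g y\<bar> \<le> C * (\<Sum>i<n. \<bar>x i - y i\<bar>)" by (simp add: sum_distrib_left)
qed

lemma smooth_bounded_partialsD:
  assumes "smooth_bounded_partials n f"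
  obtains C where "C \<ge> 0" "lipschitz_coords n C f"
    "\<And>i. i < n \<Longrightarrow> lipschitz_coords n C (partial_deriv i f)"
    "\<And>i x. i < n \<Longrightarrow> \<bar>partial_deriv i f x\<bar> \<le> C"
    "\<And>x y. \<bar>f y - f x - (\<Sum>i<n. partial_deriv i f x * (y i - x i))\<bar> \<le> C * (\<Sum>i<n. \<bar>y i - x i\<bar>)\<^sup>2"
proof -
  define L where "L = (\<lambda>i. [i]) ` {..<n} \<union> (\<lambda>(j, i). [j, i]) ` ({..<n} \<times> {..<n})"
  \<comment> \<open>First derivatives bound the function and second derivatives bound the gradient, so orders one
     and two give all the constants.\<close>
  have fin: "finite L" by (simp add: L_def)
  have "bounded (\<Union>is\<in>L. range (iter_partial_deriv is f))"
    using assms by (intro bounded_UN fin) (auto simp: L_def smooth_bounded_partials_def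
        simp del: iter_partial_deriv.simps)
  then obtain C where C: "\<And>v. v \<in> (\<Union>is\<in>L. range (iter_partial_deriv is f)) \<Longrightarrow> \<bar>v\<bar> \<le> C"
    by (auto simp: bounded_iff)
  have C': "\<bar>v\<bar> \<le> max C 0" if "v \<in> (\<Union>is\<in>L. range (iter_partial_deriv is f))" for v
    using C[OF that] by simp
  have "iter_partial_deriv [i] f x \<in> (\<Union>is\<in>L. range (iter_partial_deriv is f))" if "i < n" for i x
    using that unfolding L_def by blast
  from C'[OF this] have b1: "i < n \<Longrightarrow> \<bar>partial_deriv i f x\<bar> \<le> max C 0" for i x by simp
  have "iter_partial_deriv [j, i] f x \<in> (\<Union>is\<in>L. range (iter_partial_deriv is f))"
    if "i < n" "j < n" for i j x
    using that unfolding L_def by blast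
  from C'[OF this] have b2: "i < n \<Longrightarrow> j < n \<Longrightarrow> \<bar>partial_deriv j (partial_deriv i f) x\<bar> \<le> max C 0"
    for i j x by simp
  have loc: "f x = f y" if "\<forall>i<n. x i = y i" for x y
    using assms that by (simp add: smooth_bounded_partials_def)
  have loc': "partial_deriv i f x = partial_deriv i f y" if "i < n" "\<forall>i<n. x i = y i" for i x y
  proof -
    have "(\<lambda>t. f (x(i := t))) = (\<lambda>t. f (y(i := t)))"
      using that by (intro ext loc) auto
    then show ?thesis using that by (simp add: partial_deriv_def)
  qed
  have diff: "(\<lambda>y. iter_partial_deriv is f (x(i := y))) field_differentiable at (x i)"
    if "set is \<subseteq> {..<n}" "i < n" for "is" i x
    using assms that by (auto simp: smooth_bounded_partials_def)
  have d1: "((\<lambda>y. f (x(i := y))) has_real_derivative partial_deriv i f x) (at (x i))" if "i < n" for i x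
    using diff[of "[]" i x] that by (simp add: partial_deriv_def field_differentiable_derivI)
  have d2: "((\<lambda>y. partial_deriv j f (x(i := y))) has_real_derivative partial_deriv i (partial_deriv j f) x) (at (x i))"
    if "i < n" "j < n" for i j x
    using field_differentiable_derivI[OF diff[of "[j]" i x]] that
    by (simp add: partial_deriv_def[of i "partial_deriv j f"])
  have lf: "lipschitz_coords n (max C 0) f"
    by (rule lipschitz_coords_of_bounded_partials[OF loc d1 b1])
  have lp: "lipschitz_coords n (max C 0) (partial_deriv i f)" if "i < n" for i
    by (rule lipschitz_coords_of_bounded_partials[OF loc'[OF that] d2[OF _ that] b2[OF that]])
  have taylor: "\<bar>f y - f x - (\<Sum>i<n. partial_deriv i f x * (y i - x i))\<bar> \<le> max C 0 * (\<Sum>i<n. \<bar>y i - x i\<bar>)\<^sup>2" for x y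
  proof -
    obtain \<xi> where \<xi>: "\<And>m i. m < n \<Longrightarrow> \<bar>\<xi> m i - x i\<bar> \<le> \<bar>y i - x i\<bar>"
      "f y - f x = (\<Sum>m<n. partial_deriv m f (\<xi> m) * (y m - x m))"
      using coordinatewise_mean_value[OF loc d1, where x = x and y = y] by blast
    have "\<bar>f y - f x - (\<Sum>i<n. partial_deriv i f x * (y i - x i))\<bar> =
        \<bar>\<Sum>m<n. (partial_deriv m f (\<xi> m) - partial_deriv m f x) * (y m - x m)\<bar>"
      by (simp add: \<xi>(2) left_diff_distrib sum_subtractf)
    also have "\<dots> \<le> (\<Sum>m<n. \<bar>(partial_deriv m f (\<xi> m) - partial_deriv m f x) * (y m - x m)\<bar>)" by simp
    also have "\<dots> \<le> (\<Sum>m<n. (max C 0 * (\<Sum>i<n. \<bar>y i - x i\<bar>)) * \<bar>y m - x m\<bar>)"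
    proof (intro sum_mono)
      fix m assume "m \<in> {..<n}"
      then have m: "m < n" by simp
      have "\<bar>partial_deriv m f (\<xi> m) - partial_deriv m f x\<bar> \<le> max C 0 * (\<Sum>i<n. \<bar>\<xi> m i - x i\<bar>)"
        using lp[OF m] by (simp add: lipschitz_coords_def)
      also have "\<dots> \<le> max C 0 * (\<Sum>i<n. \<bar>y i - x i\<bar>)"
        using \<xi>(1)[OF m] by (intro mult_left_mono sum_mono) auto
      finally show "\<bar>(partial_deriv m f (\<xi> m) - partial_deriv m f x) * (y m - x m)\<bar> \<le>
          (max C 0 * (\<Sum>i<n. \<bar>y i - x i\<bar>)) * \<bar>y m - x m\<bar>"
        unfolding abs_mult by (intro mult_right_mono) auto
    qed
    also have "\<dots> = max C 0 * (\<Sum>i<n. \<bar>y i - x i\<bar>)\<^sup>2"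
      by (simp add: sum_distrib_left[symmetric] power2_eq_square)
    finally show ?thesis .
  qed
  show thesis using that[of "max C 0", OF _ lf lp b1 taylor] by simp
qed

lemma
  assumes "\<And>k x. (G k has_real_derivative G (Suc k) x) (at x)"
    and "\<And>k. bounded (range (G (Suc k)))"
  shows smooth_bounded_partials_single: "smooth_bounded_partials 1 (\<lambda>x. G 0 (x 0))" (is ?smooth)
    and partial_deriv_single: "partial_deriv 0 (\<lambda>x. G 0 (x 0)) = (\<lambda>x. G 1 (x 0))" (is ?partial)
proof -
  have pd: "partial_deriv 0 (\<lambda>x. G k (x 0)) = (\<lambda>x. G (Suc k) (x 0))" for k
    using assms(1) by (auto simp: partial_deriv_def fun_eq_iff intro!: DERIV_imp_deriv)
  have it: "iter_partial_deriv is (\<lambda>x. G 0 (x 0)) = (\<lambda>x. G (length is) (x 0))" if "set is \<subseteq> {..<1}" for "is"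
    using that by (induction "is") (auto simp: pd)
  have cont: "continuous_on UNIV (\<lambda>x :: nat \<Rightarrow> real. G k (x 0))" for k
  proof -
    have "continuous_on UNIV (G k)"
      using assms(1) by (auto intro!: continuous_at_imp_continuous_on DERIV_isCont)
    then show ?thesis
      by (rule continuous_on_compose2[OF _ continuous_on_product_coordinates]) auto
  qed
  have bd: "bounded (range (\<lambda>x :: nat \<Rightarrow> real. G k (x 0)))" if "k \<noteq> 0" for k
    using assms(2)[of "k - 1"] that by (auto intro: bounded_subset)
  show ?smooth
    unfolding smooth_bounded_partials_def
    using assms(1) bd cont by (auto simp: it field_differentiable_def)
  show ?partial using pd[of 0] by simp
qed

section \<open>Trigonometric polynomials determine weighted laws\<close>

text \<open>The free phase \<open>\<theta>\<close> makes sines and products of waves expressible without complex numbers.\<close>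

inductive_set trig_poly :: "nat \<Rightarrow> ((nat \<Rightarrow> real) \<Rightarrow> real) set" for n where
  wave: "(\<lambda>x. cos ((\<Sum>i<n. l i * x i) + \<theta>)) \<in> trig_poly n"
| add: "p \<in> trig_poly n \<Longrightarrow> q \<in> trig_poly n \<Longrightarrow> (\<lambda>x. p x + q x) \<in> trig_poly n"
| scale: "p \<in> trig_poly n \<Longrightarrow> (\<lambda>x. c * p x) \<in> trig_poly n"

lemma trig_poly_mult_wave:
  assumes "p \<in> trig_poly n"
  shows "(\<lambda>x. p x * cos ((\<Sum>i<n. l i * x i) + \<theta>)) \<in> trig_poly n"
  using assms
proof induction
  case (wave k \<eta>)
  have eq: "cos ((\<Sum>i<n. k i * x i) + \<eta>) * cos ((\<Sum>i<n. l i * x i) + \<theta>) =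
      (1/2) * cos ((\<Sum>i<n. (k i - l i) * x i) + (\<eta> - \<theta>)) +
      (1/2) * cos ((\<Sum>i<n. (k i + l i) * x i) + (\<eta> + \<theta>))" for x :: "nat \<Rightarrow> real"
    unfolding cos_times_cos
    by (simp add: left_diff_distrib distrib_right sum_subtractf sum.distrib add_divide_distrib algebra_simps)
  show ?case unfolding eq by (intro trig_poly.intros)
next
  case (add p q)
  then show ?case by (simp add: distrib_right trig_poly.add)
next
  case (scale p c)
  then show ?case by (simp add: mult.assoc trig_poly.scale)
qed

lemma trig_poly_mult:
  assumes "q \<in> trig_poly n" "p \<in> trig_poly n"
  shows "(\<lambda>x. p x * q x) \<in> trig_poly n"
  using assms
proof induction
  case (wave l \<theta>)
  then show ?case by (intro trig_poly_mult_wave)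
next
  case (add q q')
  then show ?case by (simp add: distrib_left trig_poly.add)
next
  case (scale q c)
  then show ?case by (simp add: mult.left_commute trig_poly.scale)
qed

lemma trig_poly_const: "(\<lambda>_. c) \<in> trig_poly n"
  using trig_poly.scale[OF trig_poly.wave[where l = "\<lambda>_. 0" and \<theta> = 0], of c] by simp

lemma trig_poly_sin:
  assumes "i < n"
  shows "(\<lambda>x. R * sin (x i / R)) \<in> trig_poly n"
proof -
  have "(\<lambda>x. R * cos ((\<Sum>j<n. (if j = i then 1 / R else 0) * x j) + - (pi / 2))) \<in> trig_poly n"
    by (intro trig_poly.intros)
  moreover have "(\<Sum>j<n. (if j = i then 1 / R else 0) * x j) = x i / R" for x :: "nat \<Rightarrow> real"
    using assms by (simp add: if_distrib[of "\<lambda>t. t * _"] cong: if_cong)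
  moreover have "cos (t + - (pi / 2)) = sin t" for t :: real
    by (simp add: cos_diff)
  ultimately show ?thesis by simp
qed

text \<open>The map \<open>x \<mapsto> R sin (x / R)\<close>, applied in each coordinate, folds \<open>\<real>\<^sup>n\<close> into the compact
  cube \<open>[-R, R]\<^sup>n\<close>, where the Stone-Weierstrass theorem applies, and it turns polynomials
  into trigonometric polynomials. As \<open>R\<close> grows, it converges to the identity.\<close>

lemma trig_poly_approximates_folded:
  assumes lip: "lipschitz_coords n C f" and "\<epsilon> > 0"
  obtains p where "p \<in> trig_poly n" "\<And>x. \<bar>f (\<lambda>i. R * sin (x i / R)) - p x\<bar> < \<epsilon>"
proof -
  define fold :: "(nat \<Rightarrow> real) \<Rightarrow> nat \<Rightarrow> real"
    where "fold x = (\<lambda>i. if i < n then R * sin (x i / R) else 0)" for x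
  define A where "A = {q :: (nat \<Rightarrow> real) \<Rightarrow> real. continuous_on UNIV q \<and> (\<lambda>x. q (fold x)) \<in> trig_poly n}"
  define S where "S = (\<Pi>\<^sub>E i\<in>UNIV. if i < n then {-\<bar>R\<bar>..\<bar>R\<bar>} else {0})"
  have coord: "(\<lambda>x. x i) \<in> A" for i
    using trig_poly_sin[of i n R] trig_poly_const[of 0 n] by (cases "i < n") (auto simp: A_def fold_def)
  \<comment> \<open>The ring contains the coordinates, hence all polynomials, and these become trigonometric
     polynomials after folding.\<close>
  interpret function_ring_on A S
  proof
    have "compactin (product_topology (\<lambda>_. euclidean) UNIV) S"
      unfolding S_def by (subst compactin_PiE) auto
    then show "compact S" by (simp add: euclidean_product_topology)
    show "\<exists>f\<in>A. f x \<noteq> f y" if "x \<noteq> y" for x y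
    proof -
      obtain i where "x i \<noteq> y i" using \<open>x \<noteq> y\<close> by auto
      then show ?thesis by (intro bexI[OF _ coord[of i]])
    qed
  qed (auto simp: A_def intro: continuous_on_subset continuous_on_add continuous_on_mult
      trig_poly.add trig_poly_mult trig_poly_const)
  obtain q where q: "q \<in> A" "\<And>x. x \<in> S \<Longrightarrow> \<bar>f x - q x\<bar> < \<epsilon>"
    using Stone_Weierstrass_basic[OF lipschitz_coords_continuous[OF lip] \<open>\<epsilon> > 0\<close>] by blast
  show thesis
  proof
    show "(\<lambda>x. q (fold x)) \<in> trig_poly n" using q(1) by (simp add: A_def)
    fix x
    have "\<bar>R * sin t\<bar> \<le> \<bar>R\<bar>" for t
      using mult_left_mono[OF abs_sin_le_one[of t], of "\<bar>R\<bar>"] by (simp add: abs_mult)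
    then have "fold x \<in> S"
      by (auto simp: S_def fold_def abs_le_iff) (smt (verit))+
    moreover have "f (fold x) = f (\<lambda>i. R * sin (x i / R))"
      by (rule lipschitz_coords_cong[OF lip]) (simp add: fold_def)
    ultimately show "\<bar>f (\<lambda>i. R * sin (x i / R)) - q (fold x)\<bar> < \<epsilon>"
      using q(2) by fastforce
  qed
qed

lemma integrable_mult_bounded:
  fixes Z g :: "'a \<Rightarrow> real"
  assumes "integrable M Z" "g \<in> borel_measurable M" "\<And>\<omega>. \<bar>g \<omega>\<bar> \<le> C"
  shows "integrable M (\<lambda>\<omega>. Z \<omega> * g \<omega>)"
proof (rule Bochner_Integration.integrable_bound)
  show "integrable M (\<lambda>\<omega>. C * Z \<omega>)" using assms(1) by simp
  have "\<bar>Z \<omega>\<bar> * \<bar>g \<omega>\<bar> \<le> \<bar>Z \<omega>\<bar> * \<bar>C\<bar>" for \<omega> using assms(3)[of \<omega>] by (intro mult_left_mono) auto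
  then show "AE \<omega> in M. norm (Z \<omega> * g \<omega>) \<le> norm (C * Z \<omega>)"
    by (simp add: abs_mult mult.commute)
qed (use assms in auto)

lemma trig_poly_bounded:
  assumes "p \<in> trig_poly n"
  shows "\<exists>C. \<forall>x. \<bar>p x\<bar> \<le> C"
  using assms
proof induction
  case (wave l \<theta>)
  show ?case by (intro exI[of _ 1]) auto
next
  case (add p q)
  then obtain C D where "\<And>x. \<bar>p x\<bar> \<le> C" "\<And>x. \<bar>q x\<bar> \<le> D" by blast
  then have "\<bar>p x + q x\<bar> \<le> C + D" for x by (rule abs_triangle_ineq[THEN order_trans, OF add_mono])
  then show ?case by blast
next
  case (scale p c)
  then obtain C where "\<And>x. \<bar>p x\<bar> \<le> C" by blast
  then have "\<bar>c * p x\<bar> \<le> \<bar>c\<bar> * C" for x by (simp add: abs_mult mult_left_mono)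
  then show ?case by blast
qed

lemma trig_poly_measurable:
  assumes "p \<in> trig_poly n" "\<And>i. i < n \<Longrightarrow> Y i \<in> borel_measurable M"
  shows "(\<lambda>\<omega>. p (\<lambda>i. Y i \<omega>)) \<in> borel_measurable M"
  using assms by induction auto

lemma trig_poly_integrable:
  fixes Z :: "'a \<Rightarrow> real"
  assumes "p \<in> trig_poly n" "\<And>i. i < n \<Longrightarrow> Y i \<in> borel_measurable M" "integrable M Z"
  shows "integrable M (\<lambda>\<omega>. Z \<omega> * p (\<lambda>i. Y i \<omega>))"
proof -
  obtain C where "\<And>x. \<bar>p x\<bar> \<le> C" using trig_poly_bounded[OF assms(1)] by blast
  then show ?thesis
    by (intro integrable_mult_bounded[OF assms(3) trig_poly_measurable[OF assms(1,2)]])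
qed

text \<open>The integrand is dominated by a multiple of \<open>\<bar>Z\<bar> (1 + \<Sum> \<bar>Y i\<bar>)\<close>, uniformly in the folding
  radius.\<close>

lemma integral_folded_tendsto:
  fixes Z :: "'a \<Rightarrow> real" and Y :: "nat \<Rightarrow> 'a \<Rightarrow> real"
  assumes lip: "lipschitz_coords n C f" and Z: "integrable M Z"
    and Y: "\<And>i. i < n \<Longrightarrow> Y i \<in> borel_measurable M"
    and ZY: "\<And>i. i < n \<Longrightarrow> integrable M (\<lambda>\<omega>. Z \<omega> * Y i \<omega>)"
  shows "integrable M (\<lambda>\<omega>. Z \<omega> * f (\<lambda>i. Y i \<omega>))"
    and "integrable M (\<lambda>\<omega>. Z \<omega> * f (\<lambda>i. R * sin (Y i \<omega> / R)))"
    and "(\<lambda>k. \<integral>\<omega>. Z \<omega> * f (\<lambda>i. real (Suc k) * sin (Y i \<omega> / real (Suc k))) \<partial>M)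
      \<longlonglongrightarrow> (\<integral>\<omega>. Z \<omega> * f (\<lambda>i. Y i \<omega>) \<partial>M)"
proof -
  have [measurable]: "Z \<in> borel_measurable M" using Z by auto
  define dom where "dom \<omega> = \<bar>f (\<lambda>_. 0)\<bar> * \<bar>Z \<omega>\<bar> + \<bar>C\<bar> * (\<Sum>i<n. \<bar>Z \<omega> * Y i \<omega>\<bar>)" for \<omega>
  have dom: "integrable M dom"
    unfolding dom_def using Z ZY by (intro Bochner_Integration.integrable_add integrable_mult_right
        Bochner_Integration.integrable_sum integrable_abs) auto
  have bound: "norm (Z \<omega> * f u) \<le> dom \<omega>" if u: "\<And>i. \<bar>u i\<bar> \<le> \<bar>Y i \<omega>\<bar>" for u \<omega>
  proof -
    have "\<bar>f u - f (\<lambda>_. 0)\<bar> \<le> C * (\<Sum>i<n. \<bar>u i\<bar>)"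
      using lip[unfolded lipschitz_coords_def, rule_format, of u "\<lambda>_. 0"] by simp
    also have "\<dots> \<le> \<bar>C\<bar> * (\<Sum>i<n. \<bar>u i\<bar>)" by (intro mult_right_mono sum_nonneg) auto
    also have "\<dots> \<le> \<bar>C\<bar> * (\<Sum>i<n. \<bar>Y i \<omega>\<bar>)" using u by (intro mult_left_mono sum_mono) auto
    finally have "\<bar>f u\<bar> \<le> \<bar>f (\<lambda>_. 0)\<bar> + \<bar>C\<bar> * (\<Sum>i<n. \<bar>Y i \<omega>\<bar>)" by linarith
    then have "\<bar>Z \<omega>\<bar> * \<bar>f u\<bar> \<le> \<bar>Z \<omega>\<bar> * (\<bar>f (\<lambda>_. 0)\<bar> + \<bar>C\<bar> * (\<Sum>i<n. \<bar>Y i \<omega>\<bar>))"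
      by (intro mult_left_mono) auto
    then show ?thesis
      by (simp add: dom_def abs_mult algebra_simps sum_distrib_left)
  qed
  have sin_le: "\<bar>R * sin (t / R)\<bar> \<le> \<bar>t\<bar>" for R t :: real
    using mult_left_mono[OF abs_sin_x_le_abs_x[of "t / R"], of "\<bar>R\<bar>"]
    by (cases "R = 0") (auto simp: abs_mult)
  have meas: "(\<lambda>\<omega>. f (\<lambda>i. R * sin (Y i \<omega> / R))) \<in> borel_measurable M" for R
    using Y by (intro lipschitz_coords_measurable[OF lip]) auto
  have meas': "(\<lambda>\<omega>. f (\<lambda>i. Y i \<omega>)) \<in> borel_measurable M"
    by (rule lipschitz_coords_measurable[OF lip Y])
  have bound': "norm (Z \<omega> * f (\<lambda>i. R * sin (Y i \<omega> / R))) \<le> dom \<omega>" for \<omega> R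
    by (rule bound) (rule sin_le)
  have bound'': "norm (Z \<omega> * f (\<lambda>i. Y i \<omega>)) \<le> dom \<omega>" for \<omega>
    by (rule bound) simp
  have dom0: "dom \<omega> = \<bar>dom \<omega>\<bar>" for \<omega>
    using bound''[of \<omega>] by (smt (verit) norm_ge_zero)
  show "integrable M (\<lambda>\<omega>. Z \<omega> * f (\<lambda>i. Y i \<omega>))"
    using bound'' meas' dom0 by (intro Bochner_Integration.integrable_bound[OF dom]) auto
  show "integrable M (\<lambda>\<omega>. Z \<omega> * f (\<lambda>i. R * sin (Y i \<omega> / R)))"
    using bound' meas dom0 by (intro Bochner_Integration.integrable_bound[OF dom]) (auto intro!: AE_I2)
  have sin_lim: "(\<lambda>k. real (Suc k) * sin (t / real (Suc k))) \<longlonglongrightarrow> t" for t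
  proof -
    have inf: "filterlim (\<lambda>k. real (Suc k)) at_top sequentially"
      using filterlim_compose[OF filterlim_real_sequentially filterlim_Suc] .
    have "((\<lambda>R. R * sin (t / R)) \<longlongrightarrow> t) at_top" by real_asymp
    from filterlim_compose[OF this inf] show ?thesis .
  qed
  show "(\<lambda>k. \<integral>\<omega>. Z \<omega> * f (\<lambda>i. real (Suc k) * sin (Y i \<omega> / real (Suc k))) \<partial>M)
      \<longlonglongrightarrow> (\<integral>\<omega>. Z \<omega> * f (\<lambda>i. Y i \<omega>) \<partial>M)"
  proof (rule integral_dominated_convergence[OF _ _ dom])
    show "AE \<omega> in M. (\<lambda>k. Z \<omega> * f (\<lambda>i. real (Suc k) * sin (Y i \<omega> / real (Suc k))))
        \<longlonglongrightarrow> Z \<omega> * f (\<lambda>i. Y i \<omega>)"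
      by (intro AE_I2 tendsto_intros lipschitz_coords_tendsto[OF lip] sin_lim)
    show "AE \<omega> in M. norm (Z \<omega> * f (\<lambda>i. real (Suc k) * sin (Y i \<omega> / real (Suc k)))) \<le> dom \<omega>" for k
      by (intro AE_I2 bound')
  qed (use meas meas' in auto)
qed

text \<open>Waves are to weighted laws what characteristic functions are to laws: equality for waves
  passes to their linear combinations, from there to folded functions by uniform approximation,
  and to all Lipschitz functions by unfolding.\<close>

theorem weighted_law_eqI:
  fixes Z1 Z2 :: "'a \<Rightarrow> real" and Y1 Y2 :: "nat \<Rightarrow> 'a \<Rightarrow> real"
  assumes lip: "lipschitz_coords n C f"
    and Z1: "integrable M Z1" and Z2: "integrable M Z2"
    and Y1: "\<And>i. i < n \<Longrightarrow> Y1 i \<in> borel_measurable M" and Y2: "\<And>i. i < n \<Longrightarrow> Y2 i \<in> borel_measurable M"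
    and ZY1: "\<And>i. i < n \<Longrightarrow> integrable M (\<lambda>\<omega>. Z1 \<omega> * Y1 i \<omega>)"
    and ZY2: "\<And>i. i < n \<Longrightarrow> integrable M (\<lambda>\<omega>. Z2 \<omega> * Y2 i \<omega>)"
    and wave: "\<And>l \<theta>. (\<integral>\<omega>. Z1 \<omega> * cos ((\<Sum>i<n. l i * Y1 i \<omega>) + \<theta>) \<partial>M) =
      (\<integral>\<omega>. Z2 \<omega> * cos ((\<Sum>i<n. l i * Y2 i \<omega>) + \<theta>) \<partial>M)"
  shows "(\<integral>\<omega>. Z1 \<omega> * f (\<lambda>i. Y1 i \<omega>) \<partial>M) = (\<integral>\<omega>. Z2 \<omega> * f (\<lambda>i. Y2 i \<omega>) \<partial>M)"
proof -
  note trig_int1 = trig_poly_integrable[where Y = Y1, OF _ Y1 Z1]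
    and trig_int2 = trig_poly_integrable[where Y = Y2, OF _ Y2 Z2]
  note folded1 = integral_folded_tendsto[where Y = Y1, OF lip Z1 Y1 ZY1]
  note folded2 = integral_folded_tendsto[where Y = Y2, OF lip Z2 Y2 ZY2]
  have trig: "(\<integral>\<omega>. Z1 \<omega> * p (\<lambda>i. Y1 i \<omega>) \<partial>M) = (\<integral>\<omega>. Z2 \<omega> * p (\<lambda>i. Y2 i \<omega>) \<partial>M)"
    if "p \<in> trig_poly n" for p
    using that
  proof induction
    case (wave l \<theta>)
    show ?case by (rule assms(8))
  next
    case (add p q)
    then show ?case using trig_int1[of p] trig_int1[of q] trig_int2[of p] trig_int2[of q]
      by (simp add: distrib_left)
  next
    case (scale p c)
    then show ?case by (simp add: mult.left_commute)
  qed
  have eq: "(\<integral>\<omega>. Z1 \<omega> * f (\<lambda>i. R * sin (Y1 i \<omega> / R)) \<partial>M) =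
      (\<integral>\<omega>. Z2 \<omega> * f (\<lambda>i. R * sin (Y2 i \<omega> / R)) \<partial>M)" (is "?a = ?b") for R
  proof -
    define K where "K = (\<integral>\<omega>. \<bar>Z1 \<omega>\<bar> \<partial>M) + (\<integral>\<omega>. \<bar>Z2 \<omega>\<bar> \<partial>M)"
    have close: "\<bar>(\<integral>\<omega>. Z \<omega> * f (\<lambda>i. R * sin (Y i \<omega> / R)) \<partial>M) - (\<integral>\<omega>. Z \<omega> * p (\<lambda>i. Y i \<omega>) \<partial>M)\<bar>
        \<le> \<epsilon> * (\<integral>\<omega>. \<bar>Z \<omega>\<bar> \<partial>M)"
      if "integrable M Z" "integrable M (\<lambda>\<omega>. Z \<omega> * f (\<lambda>i. R * sin (Y i \<omega> / R)))"
        "integrable M (\<lambda>\<omega>. Z \<omega> * p (\<lambda>i. Y i \<omega>))"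
        "\<And>x. \<bar>f (\<lambda>i. R * sin (x i / R)) - p x\<bar> < \<epsilon>"
      for p \<epsilon> and Z :: "'a \<Rightarrow> real" and Y :: "nat \<Rightarrow> 'a \<Rightarrow> real"
    proof -
      have "\<bar>\<integral>\<omega>. Z \<omega> * f (\<lambda>i. R * sin (Y i \<omega> / R)) - Z \<omega> * p (\<lambda>i. Y i \<omega>) \<partial>M\<bar> \<le> (\<integral>\<omega>. \<epsilon> * \<bar>Z \<omega>\<bar> \<partial>M)"
      proof (rule order_trans[OF integral_abs_bound], rule integral_mono)
        fix \<omega>
        have "\<bar>Z \<omega>\<bar> * \<bar>f (\<lambda>i. R * sin (Y i \<omega> / R)) - p (\<lambda>i. Y i \<omega>)\<bar> \<le> \<bar>Z \<omega>\<bar> * \<epsilon>"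
          by (rule mult_left_mono[OF less_imp_le[OF that(4)]]) simp
        then show "\<bar>Z \<omega> * f (\<lambda>i. R * sin (Y i \<omega> / R)) - Z \<omega> * p (\<lambda>i. Y i \<omega>)\<bar> \<le> \<epsilon> * \<bar>Z \<omega>\<bar>"
          by (simp add: abs_mult right_diff_distrib[symmetric] mult.commute)
      qed (use that in auto)
      then show ?thesis using that by simp
    qed
    have "\<bar>?a - ?b\<bar> \<le> \<epsilon> * K" if pos: "\<epsilon> > 0" for \<epsilon>
    proof -
      obtain p where p: "p \<in> trig_poly n" "\<And>x. \<bar>f (\<lambda>i. R * sin (x i / R)) - p x\<bar> < \<epsilon>"
        using trig_poly_approximates_folded[OF lip pos] by blast
      show ?thesis
        using close[OF Z1 folded1(2) trig_int1[OF p(1)] p(2)] close[OF Z2 folded2(2) trig_int2[OF p(1)] p(2)]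
          trig[OF p(1)] by (simp add: K_def distrib_left)
    qed
    moreover have "K \<ge> 0" by (simp add: K_def)
    ultimately have "\<bar>?a - ?b\<bar> \<le> 0 + \<epsilon>" if "\<epsilon> > 0" for \<epsilon>
    proof -
      have "\<bar>?a - ?b\<bar> \<le> \<epsilon> / (K + 1) * K" using \<open>K \<ge> 0\<close> that
        by (intro \<open>\<And>\<epsilon>. \<epsilon> > 0 \<Longrightarrow> \<bar>?a - ?b\<bar> \<le> \<epsilon> * K\<close>) simp
      also have "\<dots> \<le> \<epsilon>" using \<open>K \<ge> 0\<close> that by (simp add: field_simps)
      finally show ?thesis by simp
    qed
    then have "\<bar>?a - ?b\<bar> \<le> 0" by (rule field_le_epsilon)
    then show ?thesis by simp
  qed
  show ?thesis
    by (rule LIMSEQ_unique[OF folded1(3) folded2(3)[folded eq]])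
qed

section \<open>The covariance kernel of fractional Brownian motion\<close>

definition signed_powr :: "real \<Rightarrow> real \<Rightarrow> real" where
  "signed_powr a x = sgn x * \<bar>x\<bar> powr a"

definition fbm_cov :: "real \<Rightarrow> real \<Rightarrow> real \<Rightarrow> real" where
  "fbm_cov H s t = (\<bar>s\<bar> powr (2 * H) + \<bar>t\<bar> powr (2 * H) - \<bar>s - t\<bar> powr (2 * H)) / 2"

text \<open>The derivative of \<open>fbm_cov H u r\<close> in \<open>u\<close>, which is also \<open>H (2 H - 1)\<close> times the integral of
  \<open>\<bar>u - v\<bar>\<^bsup>2H-2\<^esup>\<close> over \<open>v \<in> (0, r]\<close>. Working with it avoids the singularity of that kernel, since it is
  continuous for \<open>H > 1/2\<close>.\<close>

definition cov_kernel :: "real \<Rightarrow> real \<Rightarrow> real \<Rightarrow> real" where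
  "cov_kernel H r u = H * (signed_powr (2 * H - 1) u + signed_powr (2 * H - 1) (r - u))"

lemma signed_powr_minus: "signed_powr a (- x) = - signed_powr a x"
  by (simp add: signed_powr_def sgn_minus)

lemma DERIV_signed_powr:
  assumes "x \<noteq> 0"
  shows "(signed_powr a has_real_derivative a * \<bar>x\<bar> powr (a - 1)) (at x)"
proof (cases "x > 0")
  case True
  have "((\<lambda>x. x powr a) has_real_derivative a * \<bar>x\<bar> powr (a - 1)) (at x)"
    using has_real_derivative_powr[OF True, of a] True by simp
  then show ?thesis
    by (rule has_field_derivative_transform_within_open[OF _ open_greaterThan[of 0]])
       (use True in \<open>auto simp: signed_powr_def\<close>)
next
  case False
  then have "x < 0" using assms by simp
  have "((\<lambda>x. - ((- x) powr a)) has_real_derivative - (a * (- x) powr (a - 1) * (-1))) (at x)"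
    using \<open>x < 0\<close> by (auto intro!: derivative_eq_intros)
  then have "((\<lambda>x. - ((- x) powr a)) has_real_derivative a * \<bar>x\<bar> powr (a - 1)) (at x)"
    using \<open>x < 0\<close> by simp
  then show ?thesis
    by (rule has_field_derivative_transform_within_open[OF _ open_lessThan[of 0]])
       (use \<open>x < 0\<close> in \<open>auto simp: signed_powr_def\<close>)
qed

lemma isCont_signed_powr:
  assumes "a > 0"
  shows "isCont (signed_powr a) x"
proof (cases "x = 0")
  case True
  have "((\<lambda>x. \<bar>x\<bar> powr a) \<longlongrightarrow> 0) (at (0::real))"
    using assms by (intro tendsto_zero_powrI[of _ _ _ a]) (auto intro!: tendsto_eq_intros)
  then have "((\<lambda>x. norm (signed_powr a x)) \<longlongrightarrow> 0) (at 0)"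
    by (rule Lim_transform_within[OF _ zero_less_one]) (auto simp: signed_powr_def abs_mult abs_sgn_eq)
  then have "(signed_powr a \<longlongrightarrow> 0) (at 0)" by (simp only: tendsto_norm_zero_iff)
  then show ?thesis
    using True by (simp add: isCont_def signed_powr_def[of a 0])
next
  case False
  then show ?thesis using DERIV_isCont[OF DERIV_signed_powr] by blast
qed

lemma continuous_on_signed_powr [continuous_intros]:
  assumes "a > 0" "continuous_on S f"
  shows "continuous_on S (\<lambda>x. signed_powr a (f x))"
  by (rule continuous_on_compose2[OF continuous_at_imp_continuous_on assms(2)])
     (use isCont_signed_powr[OF assms(1)] in auto)

lemma signed_powr_mono:
  assumes "a > 0" "x \<le> y"
  shows "signed_powr a x \<le> signed_powr a y"
proof -
  consider "0 \<le> x" | "x < 0" "0 \<le> y" | "y < 0" using assms by linarith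
  then show ?thesis
  proof cases
    case 1
    then show ?thesis using assms by (auto simp: signed_powr_def sgn_if intro: powr_mono2)
  next
    case 2
    have "signed_powr a x \<le> 0" "0 \<le> signed_powr a y" using 2 by (auto simp: signed_powr_def sgn_if)
    then show ?thesis by simp
  next
    case 3
    then show ?thesis using assms by (auto simp: signed_powr_def sgn_if intro: powr_mono2)
  qed
qed

lemma abs_signed_powr_le:
  assumes "a > 0" "\<bar>x\<bar> \<le> b"
  shows "\<bar>signed_powr a x\<bar> \<le> b powr a"
  using assms by (auto simp: signed_powr_def abs_mult abs_sgn_eq intro: powr_mono2)

lemma DERIV_abs_powr:
  assumes "p > 1"
  shows "((\<lambda>x. \<bar>x\<bar> powr p) has_real_derivative p * signed_powr (p - 1) x) (at x)"
proof (cases "x = 0")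
  case True
  have "((\<lambda>h. \<bar>h\<bar> powr (p - 1)) \<longlongrightarrow> 0) (at (0::real))"
    using assms by (intro tendsto_zero_powrI[of _ _ _ "p - 1"]) (auto intro!: tendsto_eq_intros)
  then have "((\<lambda>h. norm ((\<bar>0 + h\<bar> powr p - \<bar>0\<bar> powr p) / h)) \<longlongrightarrow> 0) (at (0::real))"
  proof (rule Lim_transform_within[OF _ zero_less_one])
    fix h :: real assume "0 < dist h 0"
    then have "\<bar>h\<bar> > 0" by simp
    then show "\<bar>h\<bar> powr (p - 1) = norm ((\<bar>0 + h\<bar> powr p - \<bar>0\<bar> powr p) / h)"
      by (simp add: powr_diff abs_divide)
  qed
  then have "((\<lambda>h. (\<bar>0 + h\<bar> powr p - \<bar>0\<bar> powr p) / h) \<longlongrightarrow> 0) (at (0::real))"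
    by (simp only: tendsto_norm_zero_iff)
  then show ?thesis using True by (simp add: DERIV_def signed_powr_def)
next
  case False
  have "((\<lambda>x. x * signed_powr (p - 1) x) has_real_derivative
      1 * signed_powr (p - 1) x + (p - 1) * \<bar>x\<bar> powr (p - 1 - 1) * x) (at x)"
    by (rule DERIV_mult[OF DERIV_ident DERIV_signed_powr[OF False]])
  moreover have "\<bar>x\<bar> powr (p - 1 - 1) * x = signed_powr (p - 1) x"
    using False by (simp add: signed_powr_def powr_diff sgn_if power2_eq_square)
  moreover have "x * signed_powr (p - 1) x = \<bar>x\<bar> powr p" for x :: real
    by (cases "x = 0") (auto simp: signed_powr_def powr_diff sgn_if)
  ultimately show ?thesis by (simp add: algebra_simps)
qed

lemma fbm_cov_commute: "fbm_cov H s t = fbm_cov H t s"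
  by (simp add: fbm_cov_def abs_minus_commute)

lemma fbm_cov_0 [simp]: "fbm_cov H 0 t = 0" "fbm_cov H s 0 = 0"
  by (auto simp: fbm_cov_def)

lemma fbm_cov_same: "t \<ge> 0 \<Longrightarrow> fbm_cov H t t = t powr (2 * H)"
  by (simp add: fbm_cov_def)

context
  fixes H :: real
  assumes H: "1/2 < H"
begin

lemma continuous_on_cov_kernel [continuous_intros]:
  "continuous_on S f \<Longrightarrow> continuous_on S (\<lambda>x. cov_kernel H r (f x))"
  unfolding cov_kernel_def using H by (intro continuous_intros) auto

lemma cov_kernel_measurable: "cov_kernel H r \<in> borel_measurable borel"
  using borel_measurable_continuous_onI[OF continuous_on_cov_kernel[OF continuous_on_id]] by simp

lemma DERIV_fbm_cov: "((\<lambda>s. fbm_cov H s r) has_real_derivative cov_kernel H r s) (at s)"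
proof -
  have d: "((\<lambda>x. \<bar>x\<bar> powr (2 * H)) has_real_derivative 2 * H * signed_powr (2 * H - 1) x) (at x)" for x
    by (rule DERIV_abs_powr) (use H in auto)
  have "((\<lambda>s. \<bar>s - r\<bar> powr (2 * H)) has_real_derivative 2 * H * signed_powr (2 * H - 1) (s - r) * 1) (at s)"
    by (rule DERIV_chain2[where f = "\<lambda>x. \<bar>x\<bar> powr (2 * H)", OF d]) (auto intro!: derivative_eq_intros)
  from DERIV_cdivide[OF DERIV_diff[OF DERIV_add[OF d[of s] DERIV_const[of "\<bar>r\<bar> powr (2 * H)"]] this], of 2]
  have "((\<lambda>s. fbm_cov H s r) has_real_derivative
      (2 * H * signed_powr (2 * H - 1) s + 0 - 2 * H * signed_powr (2 * H - 1) (s - r) * 1) / 2) (at s)"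
    by (simp add: fbm_cov_def)
  moreover have "signed_powr (2 * H - 1) (r - s) = - signed_powr (2 * H - 1) (s - r)"
    using signed_powr_minus[of "2 * H - 1" "s - r"] by simp
  ultimately show ?thesis by (simp add: cov_kernel_def algebra_simps diff_divide_distrib)
qed

lemma abs_cov_kernel_le:
  assumes "r \<in> {0..T}" "u \<in> {0..T}"
  shows "\<bar>cov_kernel H r u\<bar> \<le> 2 * H * T powr (2 * H - 1)"
proof -
  have "\<bar>signed_powr (2 * H - 1) u\<bar> \<le> T powr (2 * H - 1)" "\<bar>signed_powr (2 * H - 1) (r - u)\<bar> \<le> T powr (2 * H - 1)"
    using H assms by (auto intro!: abs_signed_powr_le)
  then have "\<bar>signed_powr (2 * H - 1) u + signed_powr (2 * H - 1) (r - u)\<bar> \<le> 2 * T powr (2 * H - 1)"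
    by linarith
  then show ?thesis using H by (simp add: cov_kernel_def abs_mult)
qed

lemma fbm_cov_lipschitz:
  assumes "r \<in> {0..T}" "s \<in> {0..T}" "t \<in> {0..T}"
  shows "\<bar>fbm_cov H s r - fbm_cov H t r\<bar> \<le> 2 * H * T powr (2 * H - 1) * \<bar>s - t\<bar>"
proof -
  have "norm (fbm_cov H s r - fbm_cov H t r) \<le> 2 * H * T powr (2 * H - 1) * norm (s - t)"
    by (rule field_differentiable_bound[of "{0..T}" _ "cov_kernel H r"])
       (use assms abs_cov_kernel_le in \<open>auto intro: has_field_derivative_at_within DERIV_fbm_cov\<close>)
  then show ?thesis by simp
qed

text \<open>Increments over two intervals are positively correlated since \<open>H > 1/2\<close> makes \<open>cov_kernel H r u\<close>
  increasing in \<open>r\<close>.\<close>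

lemma fbm_cov_increments_nonneg:
  assumes "a \<le> b" "c \<le> d"
  shows "fbm_cov H b d - fbm_cov H b c - fbm_cov H a d + fbm_cov H a c \<ge> 0"
proof -
  have "fbm_cov H a d - fbm_cov H a c \<le> fbm_cov H b d - fbm_cov H b c"
  proof (rule DERIV_nonneg_imp_nondecreasing[OF assms(1)])
    fix x
    have "cov_kernel H c x \<le> cov_kernel H d x"
      unfolding cov_kernel_def using H assms(2)
      by (intro mult_left_mono add_mono signed_powr_mono) auto
    then show "\<exists>y. ((\<lambda>x. fbm_cov H x d - fbm_cov H x c) has_real_derivative y) (at x) \<and> y \<ge> 0"
      by (intro exI[of _ "cov_kernel H d x - cov_kernel H c x"]) (auto intro: DERIV_diff DERIV_fbm_cov)
  qed
  then show ?thesis by simp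
qed

lemma lborel_integral_singular_kernel:
  assumes "0 \<le> r"
  shows "(\<integral>v. indicator {0<..r} v * \<bar>u - v\<bar> powr (2 * H - 2) \<partial>lborel) =
    (signed_powr (2 * H - 1) u + signed_powr (2 * H - 1) (r - u)) / (2 * H - 1)" (is "_ = ?I")
proof -
  define F where "F v = signed_powr (2 * H - 1) (v - u) / (2 * H - 1)" for v
  have "((\<lambda>v. \<bar>u - v\<bar> powr (2 * H - 2)) has_integral (F r - F 0)) {0..r}"
  proof (rule fundamental_theorem_of_calculus_interior_strong[of "{u}"])
    show "continuous_on {0..r} F"
      unfolding F_def using H by (intro continuous_intros) auto
    fix v assume "v \<in> {0<..<r} - {u}"
    then have "v - u \<noteq> 0" by simp
    have "((\<lambda>v. signed_powr (2 * H - 1) (v - u)) has_real_derivative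
        (2 * H - 1) * \<bar>v - u\<bar> powr (2 * H - 1 - 1) * 1) (at v)"
      by (rule DERIV_chain2[where f = "signed_powr (2 * H - 1)" and g = "\<lambda>v. v - u", OF DERIV_signed_powr[OF \<open>v - u \<noteq> 0\<close>]])
         (auto intro!: derivative_eq_intros)
    from DERIV_cdivide[OF this, of "2 * H - 1"]
    have "(F has_real_derivative \<bar>u - v\<bar> powr (2 * H - 2)) (at v)"
      using H by (simp add: F_def[abs_def] abs_minus_commute)
    then show "(F has_vector_derivative \<bar>u - v\<bar> powr (2 * H - 2)) (at v)"
      by (simp add: has_real_derivative_iff_has_vector_derivative)
  qed (use assms in auto)
  moreover have "F r - F 0 = ?I"
    using signed_powr_minus[of "2 * H - 1" u] by (simp add: F_def add_divide_distrib)
  ultimately have "((\<lambda>v. if v \<in> {0..r} then \<bar>u - v\<bar> powr (2 * H - 2) else 0) has_integral ?I) UNIV"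
    by (simp only: has_integral_restrict_UNIV)
  then have hi: "((\<lambda>v. indicator {0..r} v * \<bar>u - v\<bar> powr (2 * H - 2)) has_integral ?I) UNIV"
    by (rule has_integral_eq[rotated]) (auto simp: indicator_def)
  have "(\<integral>v. indicator {0<..r} v * \<bar>u - v\<bar> powr (2 * H - 2) \<partial>lborel) =
      (\<integral>v. indicator {0..r} v * \<bar>u - v\<bar> powr (2 * H - 2) \<partial>lborel)"
    by (rule integral_cong_AE) (use AE_lborel_singleton[of 0] in \<open>auto elim!: eventually_mono simp: indicator_def\<close>)
  also have "\<dots> = enn2real (\<integral>\<^sup>+v. ennreal (indicator {0..r} v * \<bar>u - v\<bar> powr (2 * H - 2)) \<partial>lborel)"
    by (rule integral_eq_nn_integral) auto
  also have "(\<integral>\<^sup>+v. ennreal (indicator {0..r} v * \<bar>u - v\<bar> powr (2 * H - 2)) \<partial>lborel) = ennreal ?I"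
    by (rule nn_integral_has_integral_lborel[OF _ _ hi]) auto
  also have "enn2real (ennreal ?I) = ?I"
    by (rule enn2real_ennreal) (rule has_integral_nonneg[OF hi], auto)
  finally show ?thesis .
qed

lemma U_inner_indicator:
  assumes "r \<in> {0..T}"
  shows "U_inner H T \<phi> (indicator {0<..r}) = (\<integral>u. indicator {0..T} u * (\<phi> u * cov_kernel H r u) \<partial>lborel)"
proof -
  have "(LINT v:{0..T}|lborel. \<phi> u * indicator {0<..r} v * \<bar>u - v\<bar> powr (2 * H - 2)) =
      \<phi> u * cov_kernel H r u / (H * (2 * H - 1))" for u
  proof -
    have "(LINT v:{0..T}|lborel. \<phi> u * indicator {0<..r} v * \<bar>u - v\<bar> powr (2 * H - 2)) =
        (\<integral>v. \<phi> u * (indicator {0<..r} v * \<bar>u - v\<bar> powr (2 * H - 2)) \<partial>lborel)"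
      unfolding set_lebesgue_integral_def
      using assms by (intro Bochner_Integration.integral_cong) (auto simp: indicator_def)
    also have "\<dots> = \<phi> u * (\<integral>v. indicator {0<..r} v * \<bar>u - v\<bar> powr (2 * H - 2) \<partial>lborel)"
      by (rule integral_mult_right_zero)
    finally show ?thesis
      using H assms lborel_integral_singular_kernel[of r u] by (simp add: cov_kernel_def)
  qed
  then have "U_inner H T \<phi> (indicator {0<..r}) =
      H * (2 * H - 1) * (\<integral>u. indicator {0..T} u * (\<phi> u * cov_kernel H r u) / (H * (2 * H - 1)) \<partial>lborel)"
    unfolding U_inner_def set_lebesgue_integral_def by simp
  also have "\<dots> = (\<integral>u. indicator {0..T} u * (\<phi> u * cov_kernel H r u) \<partial>lborel)"
    using H by (subst integral_divide_zero) simp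
  finally show ?thesis .
qed

lemma integral_cov_kernel:
  assumes "a \<le> b"
  shows "(\<integral>u. indicator {a<..b} u * cov_kernel H r u \<partial>lborel) = fbm_cov H b r - fbm_cov H a r"
proof -
  have "(\<integral>u. indicator {a<..b} u * cov_kernel H r u \<partial>lborel) =
      (\<integral>u. cov_kernel H r u * indicator {a..b} u \<partial>lborel)"
    by (rule integral_cong_AE)
       (use AE_lborel_singleton[of a] cov_kernel_measurable in \<open>auto elim!: eventually_mono simp: indicator_def\<close>)
  also have "\<dots> = fbm_cov H b r - fbm_cov H a r"
    by (rule integral_FTC_Icc_real[OF assms DERIV_fbm_cov])
       (use continuous_on_eq_continuous_at[of UNIV "cov_kernel H r"] continuous_on_cov_kernel[OF continuous_on_id, of UNIV r] in auto)
  finally show ?thesis .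
qed

lemma U_inner_indicators:
  assumes "s \<in> {0..T}" "r \<in> {0..T}"
  shows "U_inner H T (indicator {0<..s}) (indicator {0<..r}) = fbm_cov H s r"
proof -
  have "U_inner H T (indicator {0<..s}) (indicator {0<..r}) =
      (\<integral>u. indicator {0<..s} u * cov_kernel H r u \<partial>lborel)"
    unfolding U_inner_indicator[OF assms(2)]
    using assms by (intro Bochner_Integration.integral_cong) (auto simp: indicator_def)
  also have "\<dots> = fbm_cov H s r" using assms by (subst integral_cov_kernel) auto
  finally show ?thesis .
qed

end

section \<open>Gaussian random variables\<close>

lemma normal_density_mult_exp:
  assumes "\<sigma> > 0"
  shows "normal_density \<mu> \<sigma> x * exp x = exp (\<mu> + \<sigma>\<^sup>2 / 2) * normal_density (\<mu> + \<sigma>\<^sup>2) \<sigma> x"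
proof -
  have "- (x - \<mu>)\<^sup>2 / (2 * \<sigma>\<^sup>2) + x = (\<mu> + \<sigma>\<^sup>2 / 2) + - (x - (\<mu> + \<sigma>\<^sup>2))\<^sup>2 / (2 * \<sigma>\<^sup>2)"
    using assms by (simp add: field_simps power2_eq_square)
  then have "exp (- (x - \<mu>)\<^sup>2 / (2 * \<sigma>\<^sup>2)) * exp x =
      exp (\<mu> + \<sigma>\<^sup>2 / 2) * exp (- (x - (\<mu> + \<sigma>\<^sup>2))\<^sup>2 / (2 * \<sigma>\<^sup>2))"
    by (simp only: exp_add[symmetric])
  then show ?thesis by (simp add: normal_density_def)
qed

lemma
  assumes "prob_space M" "gaussian_rv M Y"
  shows gaussian_rv_L2: "L2_rv M Y"
    and gaussian_rv_integrable_exp: "integrable M (\<lambda>\<omega>. exp (Y \<omega>))"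
    and gaussian_rv_expectation_exp:
      "(\<integral>\<omega>. Y \<omega> \<partial>M) = 0 \<Longrightarrow> (\<integral>\<omega>. exp (Y \<omega>) \<partial>M) = exp ((\<integral>\<omega>. (Y \<omega>)\<^sup>2 \<partial>M) / 2)"
proof -
  interpret prob_space M by fact
  have [measurable]: "Y \<in> borel_measurable M" using assms(2) by (simp add: gaussian_rv_def)
  have "L2_rv M Y \<and> integrable M (\<lambda>\<omega>. exp (Y \<omega>)) \<and>
    (expectation Y = 0 \<longrightarrow> (\<integral>\<omega>. exp (Y \<omega>) \<partial>M) = exp ((\<integral>\<omega>. (Y \<omega>)\<^sup>2 \<partial>M) / 2))"
    using assms(2) unfolding gaussian_rv_def
  proof (elim conjE disjE exE)
    fix \<mu> \<sigma> :: real assume \<sigma>: "0 < \<sigma>" and D: "distributed M lborel Y (\<lambda>x. ennreal (normal_density \<mu> \<sigma> x))"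
    have "integrable lborel (\<lambda>x. normal_density \<mu> \<sigma> x * (x - \<mu>)\<^sup>2 + 2 * \<mu> * (normal_density \<mu> \<sigma> x * x)
        - \<mu>\<^sup>2 * normal_density \<mu> \<sigma> x)"
      using \<sigma> by (intro Bochner_Integration.integrable_add Bochner_Integration.integrable_diff
          integrable_mult_right integrable_normal_moment integrable_normal_moment_nz_1 integrable_normal_density)
    then have "integrable lborel (\<lambda>x. normal_density \<mu> \<sigma> x * x\<^sup>2)"
      by (rule Bochner_Integration.integrable_cong[THEN iffD1, rotated 2])
         (auto simp: power2_eq_square algebra_simps)
    then have sq: "integrable M (\<lambda>\<omega>. (Y \<omega>)\<^sup>2)"
      by (subst (asm) distributed_integrable[OF D]) auto
    have "integrable lborel (\<lambda>x. normal_density \<mu> \<sigma> x * exp x)"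
      unfolding normal_density_mult_exp[OF \<sigma>] using \<sigma> by simp
    then have ex: "integrable M (\<lambda>\<omega>. exp (Y \<omega>))"
      by (subst (asm) distributed_integrable[OF D]) auto
    have "(\<integral>\<omega>. exp (Y \<omega>) \<partial>M) = (\<integral>x. normal_density \<mu> \<sigma> x * exp x \<partial>lborel)"
      by (rule distributed_integral[OF D, symmetric]) auto
    then have E: "(\<integral>\<omega>. exp (Y \<omega>) \<partial>M) = exp (\<mu> + \<sigma>\<^sup>2 / 2)"
      unfolding normal_density_mult_exp[OF \<sigma>] using \<sigma> by simp
    have "expectation Y = \<mu>" by (rule normal_distributed_expectation[OF \<sigma> D])
    moreover have "variance Y = \<sigma>\<^sup>2" by (rule normal_distributed_variance[OF \<sigma> D])
    ultimately have "(\<integral>\<omega>. exp (Y \<omega>) \<partial>M) = exp ((\<integral>\<omega>. (Y \<omega>)\<^sup>2 \<partial>M) / 2)" if "expectation Y = 0"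
      using E that by simp
    with sq ex show ?thesis by (auto simp: L2_rv_def)
  next
    fix \<mu> assume ae: "AE \<omega> in M. Y \<omega> = \<mu>"
    have L2: "L2_rv M Y"
      by (rule L2_rv_cong_AE[OF L2_rv_const[OF finite_measure_axioms, of \<mu>]])
         (use ae in \<open>auto elim!: eventually_mono\<close>)
    have int: "integrable M (\<lambda>\<omega>. exp (Y \<omega>))"
      by (rule integrable_cong_AE_imp[of M "\<lambda>_. exp \<mu>"]) (use ae in \<open>auto elim!: eventually_mono\<close>)
    have "expectation Y = expectation (\<lambda>_. \<mu>)"
      by (rule integral_cong_AE) (use ae in auto)
    then have "expectation Y = \<mu>" by (simp add: prob_space)
    moreover have "(\<integral>\<omega>. exp (Y \<omega>) \<partial>M) = (\<integral>\<omega>. exp \<mu> \<partial>M)" "(\<integral>\<omega>. (Y \<omega>)\<^sup>2 \<partial>M) = (\<integral>\<omega>. \<mu>\<^sup>2 \<partial>M)"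
      by (rule integral_cong_AE; use ae in \<open>auto elim!: eventually_mono\<close>)+
    ultimately show ?thesis using L2 int by (simp add: prob_space)
  qed
  then show "L2_rv M Y" "integrable M (\<lambda>\<omega>. exp (Y \<omega>))"
    "(\<integral>\<omega>. Y \<omega> \<partial>M) = 0 \<Longrightarrow> (\<integral>\<omega>. exp (Y \<omega>) \<partial>M) = exp ((\<integral>\<omega>. (Y \<omega>)\<^sup>2 \<partial>M) / 2)"
    by auto
qed

lemma exp_partial_sum_le:
  fixes z :: complex
  shows "norm (\<Sum>k<n. z ^ k / fact k) \<le> exp (norm z)"
proof -
  have "norm (\<Sum>k<n. z ^ k / fact k) \<le> (\<Sum>k<n. norm z ^ k / fact k)"
    by (rule order_trans[OF norm_sum]) (simp add: norm_divide norm_power)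
  also have "\<dots> \<le> (\<Sum>k. norm z ^ k / fact k)"
    using summable_exp[of "norm z"] by (intro sum_le_suminf) (auto simp: field_simps)
  also have "\<dots> = exp (norm z)" by (simp add: exp_def field_simps)
  finally show ?thesis .
qed

text \<open>The function \<open>z \<mapsto> E (e\<^bsup>zX\<^esup> e\<^bsup>Z\<^esup>)\<close> is entire, being the sum of a power series, so its values
  on the real line determine it at \<open>\<i>\<close>. This gives the mixed trigonometric and exponential
  moments of jointly Gaussian variables from the laws of their linear combinations alone.\<close>

lemma expectation_cos_exp:
  fixes X Z :: "'a \<Rightarrow> real"
  assumes [measurable]: "X \<in> borel_measurable M" "Z \<in> borel_measurable M"
    and int: "\<And>x. integrable M (\<lambda>\<omega>. exp (x * X \<omega> + Z \<omega>))"
    and mgf: "\<And>x. (\<integral>\<omega>. exp (x * X \<omega> + Z \<omega>) \<partial>M) = exp (a * x\<^sup>2 + b * x + c)"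
  shows "(\<integral>\<omega>. cos (X \<omega> + \<theta>) * exp (Z \<omega>) \<partial>M) = exp (c - a) * cos (b + \<theta>)"
proof -
  define \<Phi> :: "complex \<Rightarrow> complex" where
    "\<Phi> z = (\<integral>\<omega>. exp (z * of_real (X \<omega>)) * of_real (exp (Z \<omega>)) \<partial>M)" for z
  define t :: "complex \<Rightarrow> nat \<Rightarrow> 'a \<Rightarrow> complex" where
    "t z k \<omega> = (z * of_real (X \<omega>)) ^ k / fact k * of_real (exp (Z \<omega>))" for z k \<omega>
  define p :: "nat \<Rightarrow> complex" where "p k = (\<integral>\<omega>. t 1 k \<omega> \<partial>M)" for k
  have [measurable]: "t z k \<in> borel_measurable M" for z k
    unfolding t_def by measurable
  have dom: "integrable M (\<lambda>\<omega>. exp (r * X \<omega> + Z \<omega>) + exp (- r * X \<omega> + Z \<omega>))" for r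
    by (intro Bochner_Integration.integrable_add int)
  have dom_le: "exp (norm z * \<bar>X \<omega>\<bar>) * exp (Z \<omega>) \<le>
      exp (norm z * X \<omega> + Z \<omega>) + exp (- norm z * X \<omega> + Z \<omega>)" for z :: complex and \<omega>
    by (cases "X \<omega> \<ge> 0") (auto simp: exp_add[symmetric])
  have norm_sum_le: "norm (\<Sum>k<n. t z k \<omega>) \<le> exp (norm z * X \<omega> + Z \<omega>) + exp (- norm z * X \<omega> + Z \<omega>)" for z n \<omega>
  proof -
    have "norm (\<Sum>k<n. t z k \<omega>) = norm (\<Sum>k<n. (z * of_real (X \<omega>)) ^ k / fact k) * exp (Z \<omega>)"
      unfolding t_def sum_distrib_right[symmetric] by (simp add: norm_mult)
    also have "\<dots> \<le> exp (norm (z * of_real (X \<omega>))) * exp (Z \<omega>)"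
      by (intro mult_right_mono exp_partial_sum_le) auto
    also have "\<dots> \<le> exp (norm z * X \<omega> + Z \<omega>) + exp (- norm z * X \<omega> + Z \<omega>)"
      using dom_le[of z \<omega>] by (simp add: norm_mult)
    finally show ?thesis .
  qed
  have conv: "(\<lambda>n. \<Sum>k<n. t z k \<omega>) \<longlonglongrightarrow> exp (z * of_real (X \<omega>)) * of_real (exp (Z \<omega>))" for z \<omega>
  proof -
    have "(\<lambda>k. (z * of_real (X \<omega>)) ^ k / fact k) sums exp (z * of_real (X \<omega>))"
      using exp_converges[of "z * of_real (X \<omega>)"] by (simp add: scaleR_conv_of_real divide_inverse mult.commute)
    from sums_mult2[OF this] show ?thesis by (simp add: sums_def t_def)
  qed
  have int_sum: "integrable M (\<lambda>\<omega>. \<Sum>k<n. t z k \<omega>)" for z n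
    by (rule Bochner_Integration.integrable_bound[OF dom[of "norm z"]])
       (use norm_sum_le in \<open>auto intro!: AE_I2 intro: order_trans[OF norm_sum_le] simp: add_nonneg_nonneg\<close>)
  have int_t: "integrable M (t z k)" for z k
    using Bochner_Integration.integrable_diff[OF int_sum[of z "Suc k"] int_sum[of z k]] by simp
  have int_exp: "integrable M (\<lambda>\<omega>. exp (z * of_real (X \<omega>)) * of_real (exp (Z \<omega>)))" for z :: complex
  proof (rule Bochner_Integration.integrable_bound[OF dom[of "norm z"]])
    have "norm (exp (z * of_real (X \<omega>)) * of_real (exp (Z \<omega>))) \<le> exp (norm z * \<bar>X \<omega>\<bar>) * exp (Z \<omega>)" for \<omega>
      using norm_exp[of "z * of_real (X \<omega>)"] by (simp add: norm_mult)
    from order_trans[OF this dom_le]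
    show "AE \<omega> in M. norm (exp (z * of_real (X \<omega>)) * of_real (exp (Z \<omega>))) \<le>
        norm (exp (norm z * X \<omega> + Z \<omega>) + exp (- norm z * X \<omega> + Z \<omega>))"
      by (auto intro!: AE_I2 simp: add_nonneg_nonneg)
  qed measurable
  have series: "(\<lambda>k. p k * z ^ k) sums \<Phi> z" for z
  proof -
    have "(\<lambda>n. \<integral>\<omega>. (\<Sum>k<n. t z k \<omega>) \<partial>M) \<longlonglongrightarrow> \<Phi> z"
      unfolding \<Phi>_def
      by (rule integral_dominated_convergence[OF _ _ dom[of "norm z"]])
         (use conv norm_sum_le in \<open>auto intro!: AE_I2\<close>)
    moreover have "(\<integral>\<omega>. (\<Sum>k<n. t z k \<omega>) \<partial>M) = (\<Sum>k<n. p k * z ^ k)" for n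
    proof -
      have "t z k \<omega> = t 1 k \<omega> * z ^ k" for k \<omega> by (simp add: t_def power_mult_distrib)
      then have "(\<integral>\<omega>. t z k \<omega> \<partial>M) = p k * z ^ k" for k by (simp add: p_def)
      then show ?thesis using int_t by simp
    qed
    ultimately show ?thesis by (simp add: sums_def)
  qed
  have hol: "\<Phi> holomorphic_on ball 0 2"
    by (rule power_series_holomorphic[where a = p]) (use series in simp)
  have real: "\<Phi> (of_real x) = exp (of_real a * (of_real x)\<^sup>2 + of_real b * of_real x + of_real c)" for x
  proof -
    have "\<Phi> (of_real x) = (\<integral>\<omega>. complex_of_real (exp (x * X \<omega> + Z \<omega>)) \<partial>M)"
      unfolding \<Phi>_def by (intro Bochner_Integration.integral_cong)
        (auto simp: exp_add exp_of_real of_real_mult[symmetric] simp del: of_real_mult)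
    also have "\<dots> = complex_of_real (exp (a * x\<^sup>2 + b * x + c))" by (simp add: mgf)
    finally show ?thesis by (simp add: exp_of_real[symmetric])
  qed
  \<comment> \<open>The radius \<open>2\<close> only has to exceed \<open>\<bar>\<i>\<bar> = 1\<close>.\<close>
  have islim: "(0::complex) islimpt (of_real ` {-2<..<2})"
    unfolding islimpt_approachable
  proof (intro allI impI)
    fix e :: real assume "e > 0"
    then show "\<exists>x'\<in>complex_of_real ` {-2<..<2}. x' \<noteq> 0 \<and> dist x' 0 < e"
      by (intro bexI[of _ "of_real (min 1 (e / 2))"]) (auto simp: norm_of_real simp del: of_real_divide)
  qed
  have "\<Phi> \<i> - exp (of_real a * \<i>\<^sup>2 + of_real b * \<i> + of_real c) = 0"
  proof (rule analytic_continuation[of "\<lambda>z. \<Phi> z - exp (of_real a * z\<^sup>2 + of_real b * z + of_real c)" "ball 0 2"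
        "of_real ` {-2<..<2}" 0])
    show "(\<lambda>z. \<Phi> z - exp (of_real a * z\<^sup>2 + of_real b * z + of_real c)) holomorphic_on ball 0 2"
      by (intro holomorphic_intros hol)
  qed (use islim real in auto)
  then have val: "\<Phi> \<i> = exp (of_real (c - a) + \<i> * of_real b)" by (simp add: algebra_simps)
  have "exp (\<i> * of_real \<theta>) * \<Phi> \<i> =
      (\<integral>\<omega>. exp (\<i> * of_real \<theta>) * (exp (\<i> * of_real (X \<omega>)) * of_real (exp (Z \<omega>))) \<partial>M)"
    unfolding \<Phi>_def by (rule integral_mult_right_zero[symmetric])
  also have "Re \<dots> = (\<integral>\<omega>. Re (exp (\<i> * of_real \<theta>) * (exp (\<i> * of_real (X \<omega>)) * of_real (exp (Z \<omega>)))) \<partial>M)"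
    using int_exp by (subst integral_Re) (auto intro: integrable_mult_right)
  also have "\<dots> = (\<integral>\<omega>. cos (X \<omega> + \<theta>) * exp (Z \<omega>) \<partial>M)"
    by (intro Bochner_Integration.integral_cong) (auto simp: Re_exp Im_exp cos_add algebra_simps)
  finally have "(\<integral>\<omega>. cos (X \<omega> + \<theta>) * exp (Z \<omega>) \<partial>M) = Re (exp (\<i> * of_real \<theta>) * \<Phi> \<i>)" by simp
  also have "\<dots> = exp (c - a) * cos (b + \<theta>)"
    unfolding val by (simp add: Re_exp Im_exp cos_add algebra_simps)
  finally show ?thesis .
qed

section \<open>Elementary integrands\<close>

locale fbm_space = prob_space M for M :: "'a measure" +
  fixes H T :: real and B :: "real \<Rightarrow> 'a \<Rightarrow> real"
    and e :: "real \<Rightarrow> 'u::{real_inner,banach,second_countable_topology}"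
  assumes H: "1/2 < H" and T: "0 < T"
    and fbm: "fractional_brownian_motion M H B"
    and completion: "U_completion H T e"
begin

text \<open>A linear combination of indicators, in three guises: as an element of \<open>\<U>\<close>, as the derivative
  \<open>k\<close> of its inner product with \<open>1\<^bsub>(0,u]\<^esub>\<close>, and as its Wiener integral. A single predicate keeps the
  three in step.\<close>

definition elementary :: "'u \<Rightarrow> (real \<Rightarrow> real) \<Rightarrow> ('a \<Rightarrow> real) \<Rightarrow> bool" where
  "elementary w k W \<longleftrightarrow> (\<exists>S c. finite S \<and> S \<subseteq> {0..T} \<and> w = (\<Sum>r\<in>S. c r *\<^sub>R e r) \<and>
     k = (\<lambda>u. \<Sum>r\<in>S. c r * cov_kernel H r u) \<and> W = (\<lambda>\<omega>. \<Sum>r\<in>S. c r * B r \<omega>))"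

definition geometric_fbm :: "real \<Rightarrow> 'a \<Rightarrow> real" where
  "geometric_fbm t \<omega> = exp (B t \<omega> - t powr (2 * H) / 2)"

lemma inner_e: "s \<in> {0..T} \<Longrightarrow> t \<in> {0..T} \<Longrightarrow> e s \<bullet> e t = fbm_cov H s t"
  using completion U_inner_indicators[OF H] by (simp add: U_completion_def)

lemma e_0: "e 0 = 0"
  using inner_e[of 0 0] T by simp

lemma norm_e: "t \<in> {0..T} \<Longrightarrow> (norm (e t))\<^sup>2 = t powr (2 * H)"
  using inner_e[of t t] by (simp add: power2_norm_eq_inner fbm_cov_same)

lemma gaussian_combination:
  "finite S \<Longrightarrow> S \<subseteq> {0..} \<Longrightarrow> gaussian_rv M (\<lambda>\<omega>. \<Sum>t\<in>S. c t * B t \<omega>)"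
  using fbm by (auto simp: fractional_brownian_motion_def gaussian_process_def)

lemma B_L2: "t \<ge> 0 \<Longrightarrow> L2_rv M (B t)"
  using gaussian_rv_L2[OF prob_space_axioms gaussian_combination[of "{t}" "\<lambda>_. 1"]] by simp

lemma B_measurable [measurable]: "t \<ge> 0 \<Longrightarrow> B t \<in> borel_measurable M"
  using B_L2 by (rule L2_rvD)

lemma expectation_B: "t \<ge> 0 \<Longrightarrow> (\<integral>\<omega>. B t \<omega> \<partial>M) = 0"
  using fbm by (auto simp: fractional_brownian_motion_def)

lemma expectation_B_mult: "s \<ge> 0 \<Longrightarrow> t \<ge> 0 \<Longrightarrow> (\<integral>\<omega>. B s \<omega> * B t \<omega> \<partial>M) = fbm_cov H s t"
  using fbm by (auto simp: fractional_brownian_motion_def fbm_cov_def)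

lemma elementary_e: "t \<in> {0..T} \<Longrightarrow> elementary (e t) (cov_kernel H t) (B t)"
  unfolding elementary_def by (intro exI[of _ "{t}"] exI[of _ "\<lambda>_. 1"]) auto

lemma elementary_zero: "elementary 0 (\<lambda>_. 0) (\<lambda>_. 0)"
  unfolding elementary_def by (intro exI[of _ "{}"]) auto

lemma elementary_scale:
  assumes "elementary w k W"
  shows "elementary (a *\<^sub>R w) (\<lambda>u. a * k u) (\<lambda>\<omega>. a * W \<omega>)"
proof -
  obtain S c where "finite S" "S \<subseteq> {0..T}" "w = (\<Sum>r\<in>S. c r *\<^sub>R e r)"
    "k = (\<lambda>u. \<Sum>r\<in>S. c r * cov_kernel H r u)" "W = (\<lambda>\<omega>. \<Sum>r\<in>S. c r * B r \<omega>)"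
    using assms by (auto simp: elementary_def)
  then show ?thesis
    unfolding elementary_def
    by (intro exI[of _ S] exI[of _ "\<lambda>r. a * c r"])
       (auto simp: scaleR_sum_right sum_distrib_left mult.assoc)
qed

lemma elementary_add:
  assumes "elementary w k W" "elementary w' k' W'"
  shows "elementary (w + w') (\<lambda>u. k u + k' u) (\<lambda>\<omega>. W \<omega> + W' \<omega>)"
proof -
  obtain S c where S: "finite S" "S \<subseteq> {0..T}" "w = (\<Sum>r\<in>S. c r *\<^sub>R e r)"
    "k = (\<lambda>u. \<Sum>r\<in>S. c r * cov_kernel H r u)" "W = (\<lambda>\<omega>. \<Sum>r\<in>S. c r * B r \<omega>)"
    using assms(1) by (auto simp: elementary_def)
  obtain S' c' where S': "finite S'" "S' \<subseteq> {0..T}" "w' = (\<Sum>r\<in>S'. c' r *\<^sub>R e r)"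
    "k' = (\<lambda>u. \<Sum>r\<in>S'. c' r * cov_kernel H r u)" "W' = (\<lambda>\<omega>. \<Sum>r\<in>S'. c' r * B r \<omega>)"
    using assms(2) by (auto simp: elementary_def)
  define d where "d r = (if r \<in> S then c r else 0) + (if r \<in> S' then c' r else 0)" for r
  have sum_real: "(\<Sum>r\<in>S \<union> S'. d r * g r) = (\<Sum>r\<in>S. c r * g r) + (\<Sum>r\<in>S'. c' r * g r)" for g :: "real \<Rightarrow> real"
  proof -
    have "(\<Sum>r\<in>S \<union> S'. d r * g r) = (\<Sum>r\<in>S \<union> S'. (if r \<in> S then c r * g r else 0)) +
        (\<Sum>r\<in>S \<union> S'. (if r \<in> S' then c' r * g r else 0))"
      unfolding sum.distrib[symmetric] by (intro sum.cong) (auto simp: d_def distrib_right)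
    also have "(\<Sum>r\<in>S \<union> S'. (if r \<in> S then c r * g r else 0)) = (\<Sum>r\<in>S. c r * g r)"
      using S(1) S'(1) by (intro sum.mono_neutral_cong_right) auto
    also have "(\<Sum>r\<in>S \<union> S'. (if r \<in> S' then c' r * g r else 0)) = (\<Sum>r\<in>S'. c' r * g r)"
      using S(1) S'(1) by (intro sum.mono_neutral_cong_right) auto
    finally show ?thesis .
  qed
  have "(\<Sum>r\<in>S \<union> S'. d r *\<^sub>R e r) = (\<Sum>r\<in>S \<union> S'. (if r \<in> S then c r *\<^sub>R e r else 0)) +
        (\<Sum>r\<in>S \<union> S'. (if r \<in> S' then c' r *\<^sub>R e r else 0))"
    unfolding sum.distrib[symmetric] by (intro sum.cong) (auto simp: d_def scaleR_add_left)
  also have "(\<Sum>r\<in>S \<union> S'. (if r \<in> S then c r *\<^sub>R e r else 0)) = (\<Sum>r\<in>S. c r *\<^sub>R e r)"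
    using S(1) S'(1) by (intro sum.mono_neutral_cong_right) auto
  also have "(\<Sum>r\<in>S \<union> S'. (if r \<in> S' then c' r *\<^sub>R e r else 0)) = (\<Sum>r\<in>S'. c' r *\<^sub>R e r)"
    using S(1) S'(1) by (intro sum.mono_neutral_cong_right) auto
  finally have sum_e: "(\<Sum>r\<in>S \<union> S'. d r *\<^sub>R e r) = (\<Sum>r\<in>S. c r *\<^sub>R e r) + (\<Sum>r\<in>S'. c' r *\<^sub>R e r)" .
  show ?thesis
    unfolding elementary_def
    by (intro exI[of _ "S \<union> S'"] exI[of _ d]) (use S S' in \<open>auto simp: sum_real sum_e\<close>)
qed

lemma elementary_sum:
  fixes n :: nat
  assumes "\<And>i. i < n \<Longrightarrow> elementary (w i) (k i) (W i)"
  shows "elementary (\<Sum>i<n. l i *\<^sub>R w i) (\<lambda>u. \<Sum>i<n. l i * k i u) (\<lambda>\<omega>. \<Sum>i<n. l i * W i \<omega>)"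
  using assms
proof (induction n)
  case 0
  then show ?case using elementary_zero by simp
next
  case (Suc n)
  then show ?case using elementary_add[OF Suc.IH elementary_scale[of "w n" "k n" "W n" "l n"]] by simp
qed

lemma elementary_gaussian:
  assumes "elementary w k W"
  shows "gaussian_rv M W" "(\<integral>\<omega>. W \<omega> \<partial>M) = 0" "(\<integral>\<omega>. (W \<omega>)\<^sup>2 \<partial>M) = (norm w)\<^sup>2"
proof -
  obtain S c where S: "finite S" "S \<subseteq> {0..T}" "w = (\<Sum>r\<in>S. c r *\<^sub>R e r)" "W = (\<lambda>\<omega>. \<Sum>r\<in>S. c r * B r \<omega>)"
    using assms by (auto simp: elementary_def)
  have pos: "r \<ge> 0" if "r \<in> S" for r using S(2) that by auto
  show "gaussian_rv M W" unfolding S(4) using S(1) pos by (intro gaussian_combination) auto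
  show "(\<integral>\<omega>. W \<omega> \<partial>M) = 0"
    unfolding S(4) using pos L2_integrable[OF finite_measure_axioms B_L2]
    by (subst Bochner_Integration.integral_sum) (auto simp: expectation_B)
  have int: "integrable M (\<lambda>\<omega>. B r \<omega> * B s \<omega>)" if "r \<in> S" "s \<in> S" for r s
    using that pos by (intro L2_integrable_mult B_L2) auto
  have "(\<integral>\<omega>. (W \<omega>)\<^sup>2 \<partial>M) = (\<integral>\<omega>. (\<Sum>r\<in>S. \<Sum>s\<in>S. c r * c s * (B r \<omega> * B s \<omega>)) \<partial>M)"
    unfolding S(4) power2_eq_square sum_product by (simp add: mult_ac)
  also have "\<dots> = (\<Sum>r\<in>S. \<Sum>s\<in>S. c r * c s * (\<integral>\<omega>. B r \<omega> * B s \<omega> \<partial>M))"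
    using int by (simp add: Bochner_Integration.integral_sum Bochner_Integration.integrable_sum)
  also have "\<dots> = (\<Sum>r\<in>S. \<Sum>s\<in>S. c r * c s * (e r \<bullet> e s))"
    using pos S(2) by (intro sum.cong refl) (auto simp: expectation_B_mult inner_e subset_iff)
  also have "\<dots> = w \<bullet> w"
    unfolding S(3) by (simp add: inner_sum_left inner_sum_right sum_distrib_left mult_ac inner_commute)
  finally show "(\<integral>\<omega>. (W \<omega>)\<^sup>2 \<partial>M) = (norm w)\<^sup>2" by (simp add: power2_norm_eq_inner)
qed

lemma elementary_L2: "elementary w k W \<Longrightarrow> L2_rv M W"
  using gaussian_rv_L2[OF prob_space_axioms elementary_gaussian(1)] .

lemma elementary_measurable: "elementary w k W \<Longrightarrow> W \<in> borel_measurable M"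
  using L2_rvD(1)[OF elementary_L2] .

lemma elementary_exp:
  assumes "elementary w k W"
  shows "integrable M (\<lambda>\<omega>. exp (W \<omega>))" "(\<integral>\<omega>. exp (W \<omega>) \<partial>M) = exp ((norm w)\<^sup>2 / 2)"
  using gaussian_rv_integrable_exp[OF prob_space_axioms elementary_gaussian(1)[OF assms]]
    gaussian_rv_expectation_exp[OF prob_space_axioms elementary_gaussian(1,2)[OF assms]]
    elementary_gaussian(3)[OF assms] by auto

lemma elementary_cos_exp:
  assumes w: "elementary w k W" and v: "elementary v k' V"
  shows "(\<integral>\<omega>. cos (W \<omega> + \<theta>) * exp (V \<omega>) \<partial>M) = exp ((norm v)\<^sup>2 / 2 - (norm w)\<^sup>2 / 2) * cos (w \<bullet> v + \<theta>)"
proof (rule expectation_cos_exp)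
  have comb: "elementary (x *\<^sub>R w + v) (\<lambda>u. x * k u + k' u) (\<lambda>\<omega>. x * W \<omega> + V \<omega>)" for x
    by (intro elementary_add elementary_scale w v)
  show "integrable M (\<lambda>\<omega>. exp (x * W \<omega> + V \<omega>))" for x by (rule elementary_exp[OF comb])
  have "(norm (x *\<^sub>R w + v))\<^sup>2 / 2 = (norm w)\<^sup>2 / 2 * x\<^sup>2 + (w \<bullet> v) * x + (norm v)\<^sup>2 / 2" for x
    unfolding power2_norm_eq_inner
    by (simp add: inner_add_left inner_add_right inner_commute power2_eq_square add_divide_distrib)
  then show "(\<integral>\<omega>. exp (x * W \<omega> + V \<omega>) \<partial>M) = exp ((norm w)\<^sup>2 / 2 * x\<^sup>2 + (w \<bullet> v) * x + (norm v)\<^sup>2 / 2)" for x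
    using elementary_exp(2)[OF comb] by simp
qed (use elementary_measurable w v in auto)

lemma elementary_kernel_continuous: "elementary w k W \<Longrightarrow> continuous_on A k"
  unfolding elementary_def using H by (auto intro!: continuous_intros)

lemma elementary_kernel_measurable: "elementary w k W \<Longrightarrow> k \<in> borel_measurable borel"
  using elementary_kernel_continuous[of w k W UNIV] by (rule borel_measurable_continuous_onI)

lemma elementary_kernel_bounded:
  assumes "elementary w k W"
  obtains K where "K > 0" "\<And>u. u \<in> {0..T} \<Longrightarrow> \<bar>k u\<bar> \<le> K"
proof -
  have "bounded (k ` {0..T})"
    by (intro compact_imp_bounded compact_continuous_image elementary_kernel_continuous[OF assms]) auto
  then show thesis using that by (auto simp: bounded_pos)
qed

lemma elementary_inner_derivative:
  assumes "elementary w k W" "s \<in> {0..T}"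
  shows "((\<lambda>s. w \<bullet> e s) has_real_derivative k s) (at s within {0..T})"
proof -
  obtain S c where S: "finite S" "S \<subseteq> {0..T}" "w = (\<Sum>r\<in>S. c r *\<^sub>R e r)"
    "k = (\<lambda>u. \<Sum>r\<in>S. c r * cov_kernel H r u)"
    using assms by (auto simp: elementary_def)
  have "((\<lambda>s. \<Sum>r\<in>S. c r * fbm_cov H s r) has_real_derivative k s) (at s within {0..T})"
    unfolding S(4) by (intro DERIV_sum DERIV_cmult has_field_derivative_at_within[OF DERIV_fbm_cov[OF H]])
  moreover have "w \<bullet> e s = (\<Sum>r\<in>S. c r * fbm_cov H s r)" if "s \<in> {0..T}" for s
    unfolding S(3) using S(2) that by (auto simp: inner_sum_left inner_e fbm_cov_commute[of H s] intro!: sum.cong)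
  ultimately show ?thesis
    using assms(2) by (auto intro: has_field_derivative_transform_within[where d = 1])
qed

lemma geometric_fbm_alt:
  "t \<in> {0..T} \<Longrightarrow> geometric_fbm t \<omega> = exp (- (norm (e t))\<^sup>2 / 2) * exp (B t \<omega>)"
  by (simp add: geometric_fbm_def norm_e exp_add[symmetric])

lemma geometric_fbm_measurable: "t \<in> {0..T} \<Longrightarrow> geometric_fbm t \<in> borel_measurable M"
  unfolding geometric_fbm_def by measurable auto

lemma geometric_fbm_mult:
  assumes "s \<in> {0..T}" "t \<in> {0..T}"
  shows "integrable M (\<lambda>\<omega>. geometric_fbm s \<omega> * geometric_fbm t \<omega>)"
    and "(\<integral>\<omega>. geometric_fbm s \<omega> * geometric_fbm t \<omega> \<partial>M) = exp (fbm_cov H s t)"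
proof -
  have el: "elementary (e s + e t) (\<lambda>u. cov_kernel H s u + cov_kernel H t u) (\<lambda>\<omega>. B s \<omega> + B t \<omega>)"
    using assms by (intro elementary_add elementary_e)
  have eq: "geometric_fbm s \<omega> * geometric_fbm t \<omega> =
      exp (- (norm (e s))\<^sup>2 / 2 - (norm (e t))\<^sup>2 / 2) * exp (B s \<omega> + B t \<omega>)" for \<omega>
    using assms by (simp add: geometric_fbm_alt exp_add[symmetric])
  show "integrable M (\<lambda>\<omega>. geometric_fbm s \<omega> * geometric_fbm t \<omega>)"
    unfolding eq using elementary_exp(1)[OF el] by simp
  have "(\<integral>\<omega>. geometric_fbm s \<omega> * geometric_fbm t \<omega> \<partial>M) =
      exp (- (norm (e s))\<^sup>2 / 2 - (norm (e t))\<^sup>2 / 2) * exp ((norm (e s + e t))\<^sup>2 / 2)"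
    unfolding eq using elementary_exp(2)[OF el] by simp
  also have "(norm (e s + e t))\<^sup>2 / 2 = (norm (e s))\<^sup>2 / 2 + (norm (e t))\<^sup>2 / 2 + e s \<bullet> e t"
    by (simp add: power2_norm_eq_inner inner_add_left inner_add_right inner_commute add_divide_distrib)
  finally show "(\<integral>\<omega>. geometric_fbm s \<omega> * geometric_fbm t \<omega> \<partial>M) = exp (fbm_cov H s t)"
    using assms by (simp add: exp_add[symmetric] inner_e)
qed

lemma geometric_fbm_L2: "t \<in> {0..T} \<Longrightarrow> L2_rv M (geometric_fbm t)"
  using geometric_fbm_mult(1)[of t t] geometric_fbm_measurable by (simp add: L2_rv_def power2_eq_square)

text \<open>Under the weight, the wave moments of \<open>Y\<close> are those of \<open>Y\<close> shifted by its covariance with \<open>B s\<close>,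
  as completing the square in the exponent shows; waves determine the rest.\<close>

lemma cameron_martin:
  assumes lip: "lipschitz_coords n C f" and s: "s \<in> {0..T}"
    and el: "\<And>i. i < n \<Longrightarrow> elementary (\<phi> i) (k i) (Y i)"
  shows "(\<integral>\<omega>. geometric_fbm s \<omega> * f (\<lambda>i. Y i \<omega>) \<partial>M) = (\<integral>\<omega>. f (\<lambda>i. Y i \<omega> + \<phi> i \<bullet> e s) \<partial>M)"
proof -
  have L2: "i < n \<Longrightarrow> L2_rv M (\<lambda>\<omega>. Y i \<omega> + \<phi> i \<bullet> e s)" for i
    using elementary_L2[OF el] by (intro L2_rv_add L2_rv_const finite_measure_axioms)
  have "(\<integral>\<omega>. geometric_fbm s \<omega> * f (\<lambda>i. Y i \<omega>) \<partial>M) = (\<integral>\<omega>. 1 * f (\<lambda>i. Y i \<omega> + \<phi> i \<bullet> e s) \<partial>M)"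
  proof (rule weighted_law_eqI[OF lip, where ?Y1.0 = Y and ?Y2.0 = "\<lambda>i \<omega>. Y i \<omega> + \<phi> i \<bullet> e s"])
    show "integrable M (geometric_fbm s)"
      by (rule L2_integrable[OF finite_measure_axioms geometric_fbm_L2[OF s]])
    show "integrable M (\<lambda>\<omega>. geometric_fbm s \<omega> * Y i \<omega>)" if "i < n" for i
      by (intro L2_integrable_mult geometric_fbm_L2 s elementary_L2[OF el] that)
    show "integrable M (\<lambda>\<omega>. 1 * (Y i \<omega> + \<phi> i \<bullet> e s))" if "i < n" for i
      using L2_integrable[OF finite_measure_axioms L2[OF that]] by simp
    fix l :: "nat \<Rightarrow> real" and \<theta> :: real
    define w W where "w = (\<Sum>i<n. l i *\<^sub>R \<phi> i)" and "W = (\<lambda>\<omega>. \<Sum>i<n. l i * Y i \<omega>)"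
    have W: "elementary w (\<lambda>u. \<Sum>i<n. l i * k i u) W"
      unfolding w_def W_def by (rule elementary_sum[OF el])
    have "(\<integral>\<omega>. geometric_fbm s \<omega> * cos (W \<omega> + \<theta>) \<partial>M) =
        exp (- (norm (e s))\<^sup>2 / 2) * (\<integral>\<omega>. cos (W \<omega> + \<theta>) * exp (B s \<omega>) \<partial>M)"
      unfolding geometric_fbm_alt[OF s] integral_mult_right_zero[symmetric] by (simp only: mult_ac)
    also have "\<dots> = exp (- (norm w)\<^sup>2 / 2) * cos (w \<bullet> e s + \<theta>)"
      unfolding elementary_cos_exp[OF W elementary_e[OF s]]
      by (simp add: mult.assoc[symmetric] exp_add[symmetric])
    also have "\<dots> = (\<integral>\<omega>. cos (W \<omega> + (w \<bullet> e s + \<theta>)) \<partial>M)"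
      using elementary_cos_exp[OF W elementary_zero, of "w \<bullet> e s + \<theta>"] by simp
    finally have "(\<integral>\<omega>. geometric_fbm s \<omega> * cos (W \<omega> + \<theta>) \<partial>M) = (\<integral>\<omega>. cos (W \<omega> + (w \<bullet> e s + \<theta>)) \<partial>M)" .
    moreover have "(\<Sum>i<n. l i * (Y i \<omega> + \<phi> i \<bullet> e s)) + \<theta> = W \<omega> + (w \<bullet> e s + \<theta>)" for \<omega>
      by (simp add: w_def W_def inner_sum_left distrib_left sum.distrib)
    ultimately show "(\<integral>\<omega>. geometric_fbm s \<omega> * cos ((\<Sum>i<n. l i * Y i \<omega>) + \<theta>) \<partial>M) =
        (\<integral>\<omega>. 1 * cos ((\<Sum>i<n. l i * (Y i \<omega> + \<phi> i \<bullet> e s)) + \<theta>) \<partial>M)"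
      by (simp add: W_def add.assoc)
  qed (use elementary_measurable[OF el] L2 in \<open>auto simp: L2_rv_def\<close>)
  then show ?thesis by simp
qed

section \<open>Processes as random elements of the completion\<close>

lemma restricts_to_pathwise:
  assumes el: "elementary w k W"
    and int: "integrable (lborel \<Otimes>\<^sub>M M) (\<lambda>(u, \<omega>). X' u \<omega> * indicator {0<..t} u)"
    and inner: "AE \<omega> in M. \<forall>r\<in>{0..T}. h \<omega> \<bullet> e r =
       U_inner H T (\<lambda>u. X' u \<omega> * indicator {0<..t} u) (indicator {0<..r})"
  shows "AE \<omega> in M. w \<bullet> h \<omega> = (\<integral>u. indicator {0..T} u * (X' u \<omega> * indicator {0<..t} u * k u) \<partial>lborel)"
proof -
  interpret P: pair_sigma_finite lborel M ..
  obtain S c where S: "finite S" "S \<subseteq> {0..T}" "w = (\<Sum>r\<in>S. c r *\<^sub>R e r)"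
    "k = (\<lambda>u. \<Sum>r\<in>S. c r * cov_kernel H r u)"
    using el by (auto simp: elementary_def)
  show ?thesis
    using inner P.AE_integrable_snd[OF int]
  proof eventually_elim
    case (elim \<omega>)
    let ?g = "\<lambda>u. X' u \<omega> * indicator {0<..t} u"
    have int_r: "integrable lborel (\<lambda>u. indicator {0..T} u * (?g u * cov_kernel H r u))" if "r \<in> S" for r
    proof -
      obtain K where K: "\<And>u. u \<in> {0..T} \<Longrightarrow> \<bar>cov_kernel H r u\<bar> \<le> K"
        using elementary_kernel_bounded[OF elementary_e] \<open>r \<in> S\<close> S(2) by blast
      have "integrable lborel (\<lambda>u. ?g u * (indicator {0..T} u * cov_kernel H r u))"
      proof (rule integrable_mult_bounded[OF elim(2)])
        show "\<bar>indicator {0..T} u * cov_kernel H r u\<bar> \<le> \<bar>K\<bar>" for u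
          using K[of u] by (auto simp: indicator_def)
      qed (use cov_kernel_measurable[OF H] in auto)
      then show ?thesis by (simp add: mult_ac)
    qed
    have "w \<bullet> h \<omega> = (\<Sum>r\<in>S. c r * (h \<omega> \<bullet> e r))"
      unfolding S(3) inner_sum_left by (simp add: inner_commute)
    also have "\<dots> = (\<Sum>r\<in>S. c r * (\<integral>u. indicator {0..T} u * (?g u * cov_kernel H r u) \<partial>lborel))"
      using elim(1) S(2) by (intro sum.cong refl) (auto simp: U_inner_indicator[OF H] subset_iff)
    also have "\<dots> = (\<integral>u. (\<Sum>r\<in>S. c r * (indicator {0..T} u * (?g u * cov_kernel H r u))) \<partial>lborel)"
      using int_r by (subst Bochner_Integration.integral_sum) auto
    also have "\<dots> = (\<integral>u. indicator {0..T} u * (?g u * k u) \<partial>lborel)"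
      by (intro Bochner_Integration.integral_cong) (auto simp: S(4) sum_distrib_left mult_ac)
    finally show ?case .
  qed
qed

text \<open>By Fubini, pairing \<open>X 1\<^bsub>(0,t]\<^esub>\<close> with an elementary integrand inside an expectation is integration
  against its kernel. The Henstock-Kurzweil integral does not see the null set on which the
  measurable version differs from \<open>X\<close>.\<close>

lemma restricts_to_has_integral:
  assumes res: "restricts_to M H T e X t h" and t: "t \<in> {0..T}" and el: "elementary w k W"
    and \<xi>: "\<xi> \<in> borel_measurable M" "\<And>\<omega>. \<bar>\<xi> \<omega>\<bar> \<le> C"
    and X: "\<And>u. u \<in> {0..T} \<Longrightarrow> X u \<in> borel_measurable M"
  shows "((\<lambda>u. (\<integral>\<omega>. \<xi> \<omega> * X u \<omega> \<partial>M) * k u) has_integral (\<integral>\<omega>. \<xi> \<omega> * (w \<bullet> h \<omega>) \<partial>M)) {0..t}"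
proof -
  interpret P: pair_sigma_finite lborel M ..
  obtain X' where ver: "AE u in lborel. u \<in> {0<..t} \<longrightarrow> (AE \<omega> in M. X' u \<omega> = X u \<omega>)"
    and int: "integrable (lborel \<Otimes>\<^sub>M M) (\<lambda>(u, \<omega>). X' u \<omega> * indicator {0<..t} u)"
    and inner: "AE \<omega> in M. \<forall>r\<in>{0..T}. h \<omega> \<bullet> e r =
       U_inner H T (\<lambda>u. X' u \<omega> * indicator {0<..t} u) (indicator {0<..r})"
    using res by (auto simp: restricts_to_def)
  have h: "h \<in> borel_measurable M" using res by (simp add: restricts_to_def L2_rv_def)
  note [measurable] = \<xi>(1) elementary_kernel_measurable[OF el] h
  define G where "G u \<omega> = \<xi> \<omega> * (indicator {0..T} u * (X' u \<omega> * indicator {0<..t} u * k u))" for u \<omega>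
  obtain K where K: "K > 0" "\<And>u. u \<in> {0..T} \<Longrightarrow> \<bar>k u\<bar> \<le> K"
    using elementary_kernel_bounded[OF el] by blast
  have C: "C \<ge> 0" using \<xi>(2)[of undefined] by simp
  have "integrable (lborel \<Otimes>\<^sub>M M) (\<lambda>x. (case x of (u, \<omega>) \<Rightarrow> X' u \<omega> * indicator {0<..t} u) *
      (case x of (u, \<omega>) \<Rightarrow> \<xi> \<omega> * (indicator {0..T} u * k u)))"
  proof (rule integrable_mult_bounded[OF int, where C = "C * K"])
    show "\<bar>case x of (u, \<omega>) \<Rightarrow> \<xi> \<omega> * (indicator {0..T} u * k u)\<bar> \<le> C * K" for x
      using K \<xi>(2) C by (auto simp: abs_mult indicator_def split: prod.splits intro!: mult_mono)
  qed measurable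
  then have G: "integrable (lborel \<Otimes>\<^sub>M M) (case_prod G)"
    by (simp add: G_def case_prod_beta' mult_ac)
  have "(\<integral>\<omega>. \<xi> \<omega> * (w \<bullet> h \<omega>) \<partial>M) = (\<integral>\<omega>. (\<integral>u. G u \<omega> \<partial>lborel) \<partial>M)"
  proof (rule integral_cong_AE)
    show "(\<lambda>\<omega>. \<integral>u. G u \<omega> \<partial>lborel) \<in> borel_measurable M"
      using P.integrable_snd[OF G] by auto
    show "AE \<omega> in M. \<xi> \<omega> * (w \<bullet> h \<omega>) = (\<integral>u. G u \<omega> \<partial>lborel)"
      using restricts_to_pathwise[OF el int inner] by eventually_elim (simp add: G_def)
  qed measurable
  also have "\<dots> = (\<integral>u. (\<integral>\<omega>. G u \<omega> \<partial>M) \<partial>lborel)"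
    using P.integral_fst[OF G] P.integral_snd[OF G] by simp
  finally have "((\<lambda>u. \<integral>\<omega>. G u \<omega> \<partial>M) has_integral (\<integral>\<omega>. \<xi> \<omega> * (w \<bullet> h \<omega>) \<partial>M)) UNIV"
    using has_integral_integral_real[OF P.integrable_fst[OF G]] by simp
  moreover have "AE u in lborel. u \<in> UNIV \<longrightarrow>
      (\<integral>\<omega>. G u \<omega> \<partial>M) = (if u \<in> {0..t} then (\<integral>\<omega>. \<xi> \<omega> * X u \<omega> \<partial>M) * k u else 0)"
    using ver AE_lborel_singleton[of 0] P.AE_integrable_fst[OF int]
  proof eventually_elim
    case (elim u)
    show ?case
    proof (cases "u \<in> {0<..t}")
      case True
      then have u: "u \<in> {0..T}" using t by auto
      have [measurable]: "X' u \<in> borel_measurable M" using elim(3) True by auto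
      have "(\<integral>\<omega>. G u \<omega> \<partial>M) = (\<integral>\<omega>. \<xi> \<omega> * X' u \<omega> * k u \<partial>M)"
        using True u by (simp add: G_def mult.assoc)
      also have "\<dots> = (\<integral>\<omega>. \<xi> \<omega> * X' u \<omega> \<partial>M) * k u" by simp
      also have "(\<integral>\<omega>. \<xi> \<omega> * X' u \<omega> \<partial>M) = (\<integral>\<omega>. \<xi> \<omega> * X u \<omega> \<partial>M)"
        using X[OF u] elim(1) True by (intro integral_cong_AE) auto
      finally show ?thesis using True by simp
    qed (use elim(2) in \<open>auto simp: G_def\<close>)
  qed
  ultimately have "((\<lambda>u. if u \<in> {0..t} then (\<integral>\<omega>. \<xi> \<omega> * X u \<omega> \<partial>M) * k u else 0) has_integral
      (\<integral>\<omega>. \<xi> \<omega> * (w \<bullet> h \<omega>) \<partial>M)) UNIV"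
    by (subst (asm) has_integral_AE) auto
  then show ?thesis by (simp only: has_integral_restrict_UNIV)
qed

end

section \<open>Duality between the derivative and the geometric process\<close>

lemma lipschitz_L2:
  fixes Y :: "nat \<Rightarrow> 'a \<Rightarrow> real"
  assumes "finite_measure M" "lipschitz_coords n C f" "\<And>i. i < n \<Longrightarrow> L2_rv M (Y i)"
  shows "L2_rv M (\<lambda>\<omega>. f (\<lambda>i. Y i \<omega>))"
proof -
  define D where "D \<omega> = \<bar>f (\<lambda>_. 0)\<bar> + C * (\<Sum>i<n. \<bar>Y i \<omega>\<bar>)" for \<omega>
  have abs: "L2_rv M (\<lambda>\<omega>. \<bar>Y i \<omega>\<bar>)" if "i < n" for i
    using assms(3)[OF that] by (auto simp: L2_rv_def)
  have D: "L2_rv M D"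
    unfolding D_def by (intro L2_rv_add L2_rv_const L2_rv_cmult L2_rv_sum assms(1) abs) auto
  have "\<bar>f (\<lambda>i. Y i \<omega>)\<bar> \<le> D \<omega>" for \<omega>
    using assms(2)[unfolded lipschitz_coords_def, rule_format, of "\<lambda>i. Y i \<omega>" "\<lambda>_. 0"]
    by (simp add: D_def)
  then have "(norm (f (\<lambda>i. Y i \<omega>)))\<^sup>2 \<le> (norm (D \<omega>))\<^sup>2" for \<omega>
    by (intro power_mono) (auto intro: order_trans[OF _ abs_ge_self])
  then show ?thesis
    by (intro L2_rv_dominated[OF lipschitz_coords_measurable[OF assms(2)] L2_rvD(2)[OF D]])
       (use assms(3) in \<open>auto simp: L2_rv_def\<close>)
qed

lemma lipschitz_L2_tendsto:
  fixes Y :: "nat \<Rightarrow> 'a \<Rightarrow> real"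
  assumes "finite_measure M" and lip: "lipschitz_coords n C f"
    and conv: "\<And>i. i < n \<Longrightarrow> L2_tendsto M (\<lambda>k. Yk k i) (Y i)"
  shows "L2_tendsto M (\<lambda>k \<omega>. f (\<lambda>i. Yk k i \<omega>)) (\<lambda>\<omega>. f (\<lambda>i. Y i \<omega>))"
proof -
  have Yk: "L2_rv M (Yk k i)" and Y: "L2_rv M (Y i)" if "i < n" for k i
    using conv[OF that] by (auto simp: L2_tendsto_def)
  have fYk: "L2_rv M (\<lambda>\<omega>. f (\<lambda>i. Yk k i \<omega>))" for k by (rule lipschitz_L2[OF assms(1) lip Yk])
  have fY: "L2_rv M (\<lambda>\<omega>. f (\<lambda>i. Y i \<omega>))" by (rule lipschitz_L2[OF assms(1) lip Y])
  have bound: "(f x - f y)\<^sup>2 \<le> C\<^sup>2 * n * (\<Sum>i<n. (x i - y i)\<^sup>2)" for x y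
  proof -
    have "\<bar>f x - f y\<bar>\<^sup>2 \<le> (C * (\<Sum>i<n. \<bar>x i - y i\<bar>))\<^sup>2"
      using lip by (intro power_mono) (auto simp: lipschitz_coords_def)
    also have "\<dots> \<le> C\<^sup>2 * ((\<Sum>i<n. \<bar>x i - y i\<bar>\<^sup>2) * card {..<n})"
      unfolding power_mult_distrib by (intro mult_left_mono sum_squared_le_sum_of_squares) auto
    finally show ?thesis by (simp add: mult_ac)
  qed
  have sq: "integrable M (\<lambda>\<omega>. (Yk k i \<omega> - Y i \<omega>)\<^sup>2)" if "i < n" for k i
    using L2_rvD(2)[OF L2_rv_diff[OF Yk[OF that] Y[OF that]]] by simp
  have "(\<lambda>k. \<integral>\<omega>. (norm (f (\<lambda>i. Yk k i \<omega>) - f (\<lambda>i. Y i \<omega>)))\<^sup>2 \<partial>M) \<longlonglongrightarrow> 0"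
  proof (rule Lim_null_comparison)
    have "(\<lambda>k. C\<^sup>2 * n * (\<Sum>i<n. \<integral>\<omega>. (norm (Yk k i \<omega> - Y i \<omega>))\<^sup>2 \<partial>M)) \<longlonglongrightarrow> C\<^sup>2 * n * (\<Sum>i<n. 0)"
      using conv by (intro tendsto_intros) (auto simp: L2_tendsto_def)
    then show "(\<lambda>k. C\<^sup>2 * n * (\<Sum>i<n. \<integral>\<omega>. (norm (Yk k i \<omega> - Y i \<omega>))\<^sup>2 \<partial>M)) \<longlonglongrightarrow> 0" by simp
    have "(\<integral>\<omega>. (norm (f (\<lambda>i. Yk k i \<omega>) - f (\<lambda>i. Y i \<omega>)))\<^sup>2 \<partial>M) \<le>
        (\<integral>\<omega>. C\<^sup>2 * n * (\<Sum>i<n. (Yk k i \<omega> - Y i \<omega>)\<^sup>2) \<partial>M)" for k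
      using L2_rvD(2)[OF L2_rv_diff[OF fYk fY], of k] sq bound
      by (intro integral_mono) auto
    also have "(\<integral>\<omega>. C\<^sup>2 * n * (\<Sum>i<n. (Yk k i \<omega> - Y i \<omega>)\<^sup>2) \<partial>M) =
        C\<^sup>2 * n * (\<Sum>i<n. \<integral>\<omega>. (norm (Yk k i \<omega> - Y i \<omega>))\<^sup>2 \<partial>M)" for k
      using sq by (simp add: Bochner_Integration.integral_sum)
    finally show "\<forall>\<^sub>F k in sequentially. norm (\<integral>\<omega>. (norm (f (\<lambda>i. Yk k i \<omega>) - f (\<lambda>i. Y i \<omega>)))\<^sup>2 \<partial>M) \<le>
        C\<^sup>2 * n * (\<Sum>i<n. \<integral>\<omega>. (norm (Yk k i \<omega> - Y i \<omega>))\<^sup>2 \<partial>M)"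
      by (intro always_eventually allI) simp
  qed
  then show ?thesis using fYk fY by (simp add: L2_tendsto_def)
qed

lemma DERIV_zero_of_quadratic_bound:
  fixes \<rho> :: "real \<Rightarrow> real"
  assumes "s \<in> A" "\<And>s'. s' \<in> A \<Longrightarrow> \<bar>\<rho> s'\<bar> \<le> K * (s' - s)\<^sup>2"
  shows "(\<rho> has_real_derivative 0) (at s within A)"
proof -
  have \<rho>0: "\<rho> s = 0" using assms(2)[OF assms(1)] by simp
  have "((\<lambda>s'. K * \<bar>s' - s\<bar>) \<longlongrightarrow> K * \<bar>s - s\<bar>) (at s within A)" by (intro tendsto_intros)
  then have lim: "((\<lambda>s'. K * \<bar>s' - s\<bar>) \<longlongrightarrow> 0) (at s within A)" by simp
  have "((\<lambda>s'. (\<rho> s' - \<rho> s) / (s' - s)) \<longlongrightarrow> 0) (at s within A)"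
  proof (rule Lim_null_comparison[OF _ lim])
    show "\<forall>\<^sub>F s' in at s within A. norm ((\<rho> s' - \<rho> s) / (s' - s)) \<le> K * \<bar>s' - s\<bar>"
      unfolding eventually_at_filter
    proof (intro always_eventually allI impI)
      fix s' assume s': "s' \<noteq> s" "s' \<in> A"
      have "\<bar>\<rho> s'\<bar> / \<bar>s' - s\<bar> \<le> K * (s' - s)\<^sup>2 / \<bar>s' - s\<bar>"
        using assms(2)[OF s'(2)] by (intro divide_right_mono) auto
      also have "\<dots> = K * \<bar>s' - s\<bar>"
        using s'(1) by (simp add: power2_eq_square abs_mult_self[of "s' - s", symmetric] del: abs_mult_self)
      finally show "norm ((\<rho> s' - \<rho> s) / (s' - s)) \<le> K * \<bar>s' - s\<bar>" by (simp add: \<rho>0)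
    qed
  qed
  then show ?thesis by (simp add: has_field_derivative_iff)
qed

context fbm_space
begin

lemma elementary_inner_lipschitz:
  assumes "elementary w k W"
  obtains K where "K > 0"
    "\<And>s s'. s \<in> {0..T} \<Longrightarrow> s' \<in> {0..T} \<Longrightarrow> \<bar>w \<bullet> e s' - w \<bullet> e s\<bar> \<le> K * \<bar>s' - s\<bar>"
proof -
  obtain K where K: "K > 0" "\<And>u. u \<in> {0..T} \<Longrightarrow> \<bar>k u\<bar> \<le> K"
    using elementary_kernel_bounded[OF assms] by blast
  have "norm (w \<bullet> e s' - w \<bullet> e s) \<le> K * norm (s' - s)" if "s \<in> {0..T}" "s' \<in> {0..T}" for s s'
    by (rule field_differentiable_bound[OF _ elementary_inner_derivative[OF assms]])
       (use K that in auto)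
  then show thesis using that[OF K(1)] by simp
qed

text \<open>The derivative in \<open>s\<close> of \<open>E (f (Y + c(s)))\<close>, where \<open>c(s)\<close> is the Cameron-Martin shift: the
  second order Taylor remainder is quadratic in \<open>s' - s\<close> uniformly in \<open>\<omega>\<close>, so the derivative may be
  taken inside the expectation. Shifting back gives the weight \<open>geometric_fbm s\<close>.\<close>

lemma expectation_shift_derivative:
  assumes f: "smooth_bounded_partials n f" and s: "s \<in> {0..T}"
    and el: "\<And>i. i < n \<Longrightarrow> elementary (\<phi> i) (k i) (Y i)"
  shows "((\<lambda>s. \<integral>\<omega>. f (\<lambda>i. Y i \<omega> + \<phi> i \<bullet> e s) \<partial>M) has_real_derivative
    (\<Sum>i<n. (\<integral>\<omega>. partial_deriv i f (\<lambda>i. Y i \<omega>) * geometric_fbm s \<omega> \<partial>M) * k i s)) (at s within {0..T})"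
proof -
  obtain C where C: "C \<ge> 0" "lipschitz_coords n C f"
    "\<And>i. i < n \<Longrightarrow> lipschitz_coords n C (partial_deriv i f)"
    "\<And>i x. i < n \<Longrightarrow> \<bar>partial_deriv i f x\<bar> \<le> C"
    "\<And>x y. \<bar>f y - f x - (\<Sum>i<n. partial_deriv i f x * (y i - x i))\<bar> \<le> C * (\<Sum>i<n. \<bar>y i - x i\<bar>)\<^sup>2"
    by (rule smooth_bounded_partialsD[OF f]) (rule that)
  have "\<exists>L>0. \<forall>s\<in>{0..T}. \<forall>s'\<in>{0..T}. \<bar>\<phi> i \<bullet> e s' - \<phi> i \<bullet> e s\<bar> \<le> L * \<bar>s' - s\<bar>" if "i < n" for i
    using elementary_inner_lipschitz[OF el[OF that]] by metis
  then obtain L where L: "\<And>i. i < n \<Longrightarrow> L i > 0"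
    "\<And>i s s'. i < n \<Longrightarrow> s \<in> {0..T} \<Longrightarrow> s' \<in> {0..T} \<Longrightarrow> \<bar>\<phi> i \<bullet> e s' - \<phi> i \<bullet> e s\<bar> \<le> L i * \<bar>s' - s\<bar>"
    by metis
  define Z where "Z s i \<omega> = Y i \<omega> + \<phi> i \<bullet> e s" for s i \<omega>
  have Z: "L2_rv M (Z s i)" if "i < n" for s i
    unfolding Z_def by (intro L2_rv_add L2_rv_const finite_measure_axioms elementary_L2[OF el[OF that]])
  define a where "a i = (\<integral>\<omega>. partial_deriv i f (\<lambda>i. Z s i \<omega>) \<partial>M)" for i
  define \<Phi> where "\<Phi> s = (\<integral>\<omega>. f (\<lambda>i. Z s i \<omega>) \<partial>M)" for s
  define \<rho> where "\<rho> s' = \<Phi> s' - \<Phi> s - (\<Sum>i<n. a i * (\<phi> i \<bullet> e s' - \<phi> i \<bullet> e s))" for s'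
  have int_f: "integrable M (\<lambda>\<omega>. f (\<lambda>i. Z s i \<omega>))" for s
    by (rule L2_integrable[OF finite_measure_axioms lipschitz_L2[OF finite_measure_axioms C(2) Z]])
  have int_p: "integrable M (\<lambda>\<omega>. partial_deriv i f (\<lambda>i. Z s i \<omega>))" if "i < n" for i s
    by (rule L2_integrable[OF finite_measure_axioms lipschitz_L2[OF finite_measure_axioms C(3)[OF that] Z]])
  have "(\<rho> has_real_derivative 0) (at s within {0..T})"
  proof (rule DERIV_zero_of_quadratic_bound[OF s])
    fix s' assume s': "s' \<in> {0..T}"
    have Zdiff: "Z s' i \<omega> - Z s i \<omega> = \<phi> i \<bullet> e s' - \<phi> i \<bullet> e s" for i \<omega> by (simp add: Z_def)
    have int_pZ: "integrable M (\<lambda>\<omega>. partial_deriv i f (\<lambda>i. Z s i \<omega>) * (Z s' i \<omega> - Z s i \<omega>))" if "i < n" for i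
      unfolding Zdiff by (intro integrable_mult_left int_p that)
    have "(\<integral>\<omega>. f (\<lambda>i. Z s' i \<omega>) - f (\<lambda>i. Z s i \<omega>) -
        (\<Sum>i<n. partial_deriv i f (\<lambda>i. Z s i \<omega>) * (Z s' i \<omega> - Z s i \<omega>)) \<partial>M) =
        \<Phi> s' - \<Phi> s - (\<integral>\<omega>. (\<Sum>i<n. partial_deriv i f (\<lambda>i. Z s i \<omega>) * (Z s' i \<omega> - Z s i \<omega>)) \<partial>M)"
      unfolding \<Phi>_def using int_pZ int_f
      by (subst Bochner_Integration.integral_diff) auto
    also have "(\<integral>\<omega>. (\<Sum>i<n. partial_deriv i f (\<lambda>i. Z s i \<omega>) * (Z s' i \<omega> - Z s i \<omega>)) \<partial>M) =
        (\<Sum>i<n. \<integral>\<omega>. partial_deriv i f (\<lambda>i. Z s i \<omega>) * (Z s' i \<omega> - Z s i \<omega>) \<partial>M)"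
      by (rule Bochner_Integration.integral_sum) (use int_pZ in auto)
    also have "\<dots> = (\<Sum>i<n. a i * (\<phi> i \<bullet> e s' - \<phi> i \<bullet> e s))"
      unfolding Zdiff a_def by simp
    finally have "\<rho> s' = (\<integral>\<omega>. f (\<lambda>i. Z s' i \<omega>) - f (\<lambda>i. Z s i \<omega>) -
        (\<Sum>i<n. partial_deriv i f (\<lambda>i. Z s i \<omega>) * (Z s' i \<omega> - Z s i \<omega>)) \<partial>M)"
      by (simp add: \<rho>_def)
    also have "\<bar>\<dots>\<bar> \<le> (\<integral>\<omega>. C * (\<Sum>i<n. L i)\<^sup>2 * (s' - s)\<^sup>2 \<partial>M)"
    proof (rule order_trans[OF integral_abs_bound], rule integral_mono)
      fix \<omega>
      have "\<bar>f (\<lambda>i. Z s' i \<omega>) - f (\<lambda>i. Z s i \<omega>) -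
          (\<Sum>i<n. partial_deriv i f (\<lambda>i. Z s i \<omega>) * (Z s' i \<omega> - Z s i \<omega>))\<bar> \<le>
          C * (\<Sum>i<n. \<bar>Z s' i \<omega> - Z s i \<omega>\<bar>)\<^sup>2"
        by (rule C(5))
      also have "\<dots> \<le> C * (\<Sum>i<n. L i * \<bar>s' - s\<bar>)\<^sup>2"
        using L(2)[OF _ s s'] C(1) by (intro mult_left_mono power_mono sum_mono sum_nonneg) (auto simp: Z_def)
      also have "\<dots> = C * (\<Sum>i<n. L i)\<^sup>2 * (s' - s)\<^sup>2"
        by (simp add: sum_distrib_right[symmetric] power_mult_distrib)
      finally show "\<bar>f (\<lambda>i. Z s' i \<omega>) - f (\<lambda>i. Z s i \<omega>) -
          (\<Sum>i<n. partial_deriv i f (\<lambda>i. Z s i \<omega>) * (Z s' i \<omega> - Z s i \<omega>))\<bar> \<le> C * (\<Sum>i<n. L i)\<^sup>2 * (s' - s)\<^sup>2" .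
    qed (auto intro!: integrable_abs Bochner_Integration.integrable_diff
        Bochner_Integration.integrable_sum int_f int_pZ)
    finally show "\<bar>\<rho> s'\<bar> \<le> C * (\<Sum>i<n. L i)\<^sup>2 * (s' - s)\<^sup>2" by (simp add: prob_space)
  qed
  moreover have "((\<lambda>s'. \<Phi> s + (\<Sum>i<n. a i * (\<phi> i \<bullet> e s' - \<phi> i \<bullet> e s))) has_real_derivative
      0 + (\<Sum>i<n. a i * (k i s - 0))) (at s within {0..T})"
    by (intro DERIV_add DERIV_const DERIV_sum DERIV_cmult DERIV_diff elementary_inner_derivative[OF el s]) auto
  ultimately have "((\<lambda>s'. (\<Phi> s + (\<Sum>i<n. a i * (\<phi> i \<bullet> e s' - \<phi> i \<bullet> e s))) + \<rho> s') has_real_derivative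
      (0 + (\<Sum>i<n. a i * (k i s - 0))) + 0) (at s within {0..T})"
    by (rule DERIV_add[rotated])
  then have "(\<Phi> has_real_derivative (\<Sum>i<n. a i * k i s)) (at s within {0..T})"
    by (simp add: \<rho>_def)
  moreover have "a i = (\<integral>\<omega>. partial_deriv i f (\<lambda>i. Y i \<omega>) * geometric_fbm s \<omega> \<partial>M)" if "i < n" for i
    using cameron_martin[OF C(3)[OF that] s el] by (simp add: a_def Z_def mult.commute)
  ultimately show ?thesis by (simp add: \<Phi>_def[abs_def] Z_def)
qed

text \<open>Both sides are the integral of the derivative computed above over \<open>[0, t]\<close>: once by the
  fundamental theorem of calculus and once by pairing \<open>X 1\<^bsub>(0,t]\<^esub>\<close> with each \<open>\<phi> i\<close>.\<close>

lemma elementary_duality: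
  assumes f: "smooth_bounded_partials n f" and t: "t \<in> {0..T}"
    and el: "\<And>i. i < n \<Longrightarrow> elementary (\<phi> i) (k i) (Y i)"
    and h: "restricts_to M H T e geometric_fbm t h"
  shows "(\<integral>\<omega>. f (\<lambda>i. Y i \<omega>) * (geometric_fbm t \<omega> - 1) \<partial>M) =
    (\<Sum>i<n. \<integral>\<omega>. partial_deriv i f (\<lambda>i. Y i \<omega>) * (\<phi> i \<bullet> h \<omega>) \<partial>M)"
proof -
  obtain C where C: "lipschitz_coords n C f" "\<And>i. i < n \<Longrightarrow> lipschitz_coords n C (partial_deriv i f)"
    "\<And>i x. i < n \<Longrightarrow> \<bar>partial_deriv i f x\<bar> \<le> C"
    by (rule smooth_bounded_partialsD[OF f]) (rule that)
  define \<Phi> where "\<Phi> s = (\<integral>\<omega>. f (\<lambda>i. Y i \<omega> + \<phi> i \<bullet> e s) \<partial>M)" for s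
  define \<Phi>' where "\<Phi>' s = (\<Sum>i<n. (\<integral>\<omega>. partial_deriv i f (\<lambda>i. Y i \<omega>) * geometric_fbm s \<omega> \<partial>M) * k i s)" for s
  have "(\<Phi>' has_integral (\<Phi> t - \<Phi> 0)) {0..t}"
  proof (rule fundamental_theorem_of_calculus)
    fix s assume "s \<in> {0..t}"
    then have "s \<in> {0..T}" using t by auto
    from expectation_shift_derivative[where \<phi> = \<phi> and k = k and Y = Y, OF f this el]
    have "(\<Phi> has_real_derivative \<Phi>' s) (at s within {0..T})" by (simp add: \<Phi>_def[abs_def] \<Phi>'_def)
    then have "(\<Phi> has_real_derivative \<Phi>' s) (at s within {0..t})"
      by (rule DERIV_subset) (use t in auto)
    then show "(\<Phi> has_vector_derivative \<Phi>' s) (at s within {0..t})"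
      by (simp add: has_real_derivative_iff_has_vector_derivative)
  qed (use t in auto)
  moreover have "(\<Phi>' has_integral (\<Sum>i<n. \<integral>\<omega>. partial_deriv i f (\<lambda>i. Y i \<omega>) * (\<phi> i \<bullet> h \<omega>) \<partial>M)) {0..t}"
    unfolding \<Phi>'_def
  proof (intro has_integral_sum)
    fix i assume "i \<in> {..<n}"
    then have i: "i < n" by simp
    show "((\<lambda>s. (\<integral>\<omega>. partial_deriv i f (\<lambda>i. Y i \<omega>) * geometric_fbm s \<omega> \<partial>M) * k i s) has_integral
        (\<integral>\<omega>. partial_deriv i f (\<lambda>i. Y i \<omega>) * (\<phi> i \<bullet> h \<omega>) \<partial>M)) {0..t}"
      by (rule restricts_to_has_integral[OF h t el[OF i] _ C(3)[OF i] geometric_fbm_measurable])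
         (rule lipschitz_coords_measurable[OF C(2)[OF i] elementary_measurable[OF el]])
  qed simp
  ultimately have "\<Phi> t - \<Phi> 0 = (\<Sum>i<n. \<integral>\<omega>. partial_deriv i f (\<lambda>i. Y i \<omega>) * (\<phi> i \<bullet> h \<omega>) \<partial>M)"
    by (rule has_integral_unique)
  moreover have "\<Phi> t = (\<integral>\<omega>. geometric_fbm t \<omega> * f (\<lambda>i. Y i \<omega>) \<partial>M)"
    unfolding \<Phi>_def by (rule cameron_martin[OF C(1) t el, symmetric])
  moreover have "\<Phi> 0 = (\<integral>\<omega>. f (\<lambda>i. Y i \<omega>) \<partial>M)" by (simp add: \<Phi>_def e_0)
  moreover have fY: "L2_rv M (\<lambda>\<omega>. f (\<lambda>i. Y i \<omega>))"
    by (rule lipschitz_L2[OF finite_measure_axioms C(1) elementary_L2[OF el]])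
  moreover have "(\<integral>\<omega>. f (\<lambda>i. Y i \<omega>) * (geometric_fbm t \<omega> - 1) \<partial>M) =
      (\<integral>\<omega>. geometric_fbm t \<omega> * f (\<lambda>i. Y i \<omega>) \<partial>M) - (\<integral>\<omega>. f (\<lambda>i. Y i \<omega>) \<partial>M)"
    using L2_integrable_mult[OF geometric_fbm_L2[OF t] fY] L2_integrable[OF finite_measure_axioms fY]
    by (simp add: right_diff_distrib mult.commute)
  ultimately show ?thesis by simp
qed

lemma wiener_integral_approx:
  assumes "is_wiener_integral M B T e \<phi> Y"
  obtains w k W where "\<And>j. elementary (w j) (k j) (W j)" "w \<longlonglongrightarrow> \<phi>" "L2_tendsto M W Y"
proof -
  obtain S c where S: "\<And>j :: nat. finite (S j) \<and> S j \<subseteq> {0..T}"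
    "(\<lambda>j. \<Sum>t\<in>S j. c j t *\<^sub>R e t) \<longlonglongrightarrow> \<phi>"
    "L2_tendsto M (\<lambda>j \<omega>. \<Sum>t\<in>S j. c j t * B t \<omega>) Y"
    using assms by (auto simp: is_wiener_integral_def)
  have "elementary (\<Sum>t\<in>S j. c j t *\<^sub>R e t) (\<lambda>u. \<Sum>r\<in>S j. c j r * cov_kernel H r u)
      (\<lambda>\<omega>. \<Sum>t\<in>S j. c j t * B t \<omega>)" for j
    using S(1)[of j] unfolding elementary_def by blast
  from that[OF this S(2,3)] show thesis .
qed

lemma wiener_integral_elementary:
  assumes "elementary w k W"
  shows "is_wiener_integral M B T e w W"
proof -
  obtain S c where "finite S" "S \<subseteq> {0..T}" "w = (\<Sum>r\<in>S. c r *\<^sub>R e r)" "W = (\<lambda>\<omega>. \<Sum>r\<in>S. c r * B r \<omega>)"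
    using assms by (auto simp: elementary_def)
  then show ?thesis
    unfolding is_wiener_integral_def using elementary_L2[OF assms]
    by (intro exI[of _ "\<lambda>_. S"] exI[of _ "\<lambda>_. c"]) (auto simp: L2_tendsto_def)
qed

lemma smooth_malliavin_cases:
  assumes "smooth_malliavin M B T e F G"
  obtains n f \<phi> Y w k W where "smooth_bounded_partials n f"
    "\<And>i j. i < n \<Longrightarrow> elementary (w j i) (k j i) (W j i)"
    "\<And>i. i < n \<Longrightarrow> (\<lambda>j. w j i) \<longlonglongrightarrow> \<phi> i"
    "\<And>i. i < n \<Longrightarrow> L2_tendsto M (\<lambda>j. W j i) (Y i)"
    "F = (\<lambda>\<omega>. f (\<lambda>i. Y i \<omega>))" "G = (\<lambda>\<omega>. \<Sum>i<n. partial_deriv i f (\<lambda>j. Y j \<omega>) *\<^sub>R \<phi> i)"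
proof -
  obtain n f \<phi> Y where f: "smooth_bounded_partials n f"
    "\<And>i. i < n \<Longrightarrow> is_wiener_integral M B T e (\<phi> i) (Y i)"
    "F = (\<lambda>\<omega>. f (\<lambda>i. Y i \<omega>))" "G = (\<lambda>\<omega>. \<Sum>i<n. partial_deriv i f (\<lambda>j. Y j \<omega>) *\<^sub>R \<phi> i)"
    using assms by (auto simp: smooth_malliavin_def)
  have "\<exists>w k W. (\<forall>j. elementary (w j) (k j) (W j)) \<and> w \<longlonglongrightarrow> \<phi> i \<and> L2_tendsto M W (Y i)" if "i < n" for i
    using wiener_integral_approx[OF f(2)[OF that]] by metis
  then obtain w k W where "\<And>i. i < n \<Longrightarrow> (\<forall>j. elementary (w i j) (k i j) (W i j)) \<and> w i \<longlonglongrightarrow> \<phi> i \<and> L2_tendsto M (W i) (Y i)"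
    by metis
  then show thesis
    using that[of n f "\<lambda>j i. w i j" "\<lambda>j i. k i j" "\<lambda>j i. W i j" \<phi> Y] f by simp
qed

text \<open>Both sides of the duality are continuous under approximation of the Wiener integrals, so it
  extends from elementary integrands to all of \<open>\<U>\<close>.\<close>

lemma smooth_duality:
  assumes "smooth_malliavin M B T e F G" and t: "t \<in> {0..T}"
    and res: "restricts_to M H T e geometric_fbm t h"
  shows "(\<integral>\<omega>. F \<omega> * (geometric_fbm t \<omega> - 1) \<partial>M) = (\<integral>\<omega>. G \<omega> \<bullet> h \<omega> \<partial>M)"
proof -
  obtain n f \<phi> Y w k W where f: "smooth_bounded_partials n f"
    and el: "\<And>i j. i < n \<Longrightarrow> elementary (w j i) (k j i) (W j i)"
    and w: "\<And>i. i < n \<Longrightarrow> (\<lambda>j. w j i) \<longlonglongrightarrow> \<phi> i"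
    and W: "\<And>i. i < n \<Longrightarrow> L2_tendsto M (\<lambda>j. W j i) (Y i)"
    and FG: "F = (\<lambda>\<omega>. f (\<lambda>i. Y i \<omega>))" "G = (\<lambda>\<omega>. \<Sum>i<n. partial_deriv i f (\<lambda>j. Y j \<omega>) *\<^sub>R \<phi> i)"
    by (rule smooth_malliavin_cases[OF assms(1)]) (rule that)
  obtain C where C: "C \<ge> 0" "lipschitz_coords n C f" "\<And>i. i < n \<Longrightarrow> lipschitz_coords n C (partial_deriv i f)"
    "\<And>i x. i < n \<Longrightarrow> \<bar>partial_deriv i f x\<bar> \<le> C"
    by (rule smooth_bounded_partialsD[OF f]) (rule that)
  have h: "L2_rv M h" using res by (simp add: restricts_to_def)
  have hn: "integrable M (\<lambda>\<omega>. norm (h \<omega>))" by (intro integrable_norm L2_integrable finite_measure_axioms h)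
  have inner_h: "L2_rv M (\<lambda>\<omega>. v \<bullet> h \<omega>)" for v
  proof (rule L2_rv_dominated)
    show "integrable M (\<lambda>\<omega>. (norm v)\<^sup>2 * (norm (h \<omega>))\<^sup>2)" using L2_rvD(2)[OF h] by simp
    have "\<bar>v \<bullet> h \<omega>\<bar>\<^sup>2 \<le> (norm v * norm (h \<omega>))\<^sup>2" for \<omega> by (intro power_mono Cauchy_Schwarz_ineq2) auto
    then show "AE \<omega> in M. (norm (v \<bullet> h \<omega>))\<^sup>2 \<le> (norm v)\<^sup>2 * (norm (h \<omega>))\<^sup>2"
      by (simp add: power_mult_distrib)
  qed (use L2_rvD(1)[OF h] in auto)
  have Y: "i < n \<Longrightarrow> L2_rv M (Y i)" for i using W by (auto simp: L2_tendsto_def)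
  have geo: "L2_rv M (\<lambda>\<omega>. geometric_fbm t \<omega> - 1)"
    by (intro L2_rv_diff L2_rv_const geometric_fbm_L2 t finite_measure_axioms)
  have lim1: "(\<lambda>j. \<integral>\<omega>. f (\<lambda>i. W j i \<omega>) * (geometric_fbm t \<omega> - 1) \<partial>M) \<longlonglongrightarrow>
      (\<integral>\<omega>. F \<omega> * (geometric_fbm t \<omega> - 1) \<partial>M)"
    unfolding FG(1) by (rule L2_tendsto_mult[OF lipschitz_L2_tendsto[OF finite_measure_axioms C(2) W] geo])
  have pW: "(\<lambda>\<omega>. partial_deriv i f (\<lambda>i. W j i \<omega>)) \<in> borel_measurable M" if "i < n" for i j
    by (rule lipschitz_coords_measurable[OF C(3)[OF that] elementary_measurable[OF el]])
  have int: "integrable M (\<lambda>\<omega>. partial_deriv i f (\<lambda>i. Z i \<omega>) * (v \<bullet> h \<omega>))"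
    if "i < n" "(\<lambda>\<omega>. partial_deriv i f (\<lambda>i. Z i \<omega>)) \<in> borel_measurable M" for i v Z
    by (rule L2_integrable_mult[OF L2_rv_bounded[OF finite_measure_axioms that(2)] inner_h])
       (use C(4) that in auto)
  have lim2: "(\<lambda>j. \<integral>\<omega>. partial_deriv i f (\<lambda>i. W j i \<omega>) * (w j i \<bullet> h \<omega>) \<partial>M) \<longlonglongrightarrow>
      (\<integral>\<omega>. partial_deriv i f (\<lambda>i. Y i \<omega>) * (\<phi> i \<bullet> h \<omega>) \<partial>M)" if i: "i < n" for i
  proof -
    have "(\<lambda>j. \<integral>\<omega>. partial_deriv i f (\<lambda>i. W j i \<omega>) * (\<phi> i \<bullet> h \<omega>) \<partial>M) \<longlonglongrightarrow>
        (\<integral>\<omega>. partial_deriv i f (\<lambda>i. Y i \<omega>) * (\<phi> i \<bullet> h \<omega>) \<partial>M)"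
      by (rule L2_tendsto_mult[OF lipschitz_L2_tendsto[OF finite_measure_axioms C(3)[OF i] W] inner_h])
    moreover have "(\<lambda>j. \<integral>\<omega>. partial_deriv i f (\<lambda>i. W j i \<omega>) * ((w j i - \<phi> i) \<bullet> h \<omega>) \<partial>M) \<longlonglongrightarrow> 0"
    proof (rule Lim_null_comparison)
      have "(\<lambda>j. C * (norm (w j i - \<phi> i) * (\<integral>\<omega>. norm (h \<omega>) \<partial>M))) \<longlonglongrightarrow> C * (norm (\<phi> i - \<phi> i) * (\<integral>\<omega>. norm (h \<omega>) \<partial>M))"
        by (intro tendsto_intros w i)
      then show "(\<lambda>j. C * (norm (w j i - \<phi> i) * (\<integral>\<omega>. norm (h \<omega>) \<partial>M))) \<longlonglongrightarrow> 0" by simp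
      have "\<bar>\<integral>\<omega>. partial_deriv i f (\<lambda>i. W j i \<omega>) * ((w j i - \<phi> i) \<bullet> h \<omega>) \<partial>M\<bar> \<le>
          (\<integral>\<omega>. C * (norm (w j i - \<phi> i) * norm (h \<omega>)) \<partial>M)" for j
      proof (rule order_trans[OF integral_abs_bound], rule integral_mono)
        show "\<bar>partial_deriv i f (\<lambda>i. W j i \<omega>) * ((w j i - \<phi> i) \<bullet> h \<omega>)\<bar> \<le> C * (norm (w j i - \<phi> i) * norm (h \<omega>))" for \<omega>
          unfolding abs_mult by (intro mult_mono C(4) i Cauchy_Schwarz_ineq2 C(1)) auto
      qed (use int[OF i pW[OF i]] hn in auto)
      then show "\<forall>\<^sub>F j in sequentially. norm (\<integral>\<omega>. partial_deriv i f (\<lambda>i. W j i \<omega>) * ((w j i - \<phi> i) \<bullet> h \<omega>) \<partial>M) \<le>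
          C * (norm (w j i - \<phi> i) * (\<integral>\<omega>. norm (h \<omega>) \<partial>M))"
        by (intro always_eventually allI) simp
    qed
    ultimately have "(\<lambda>j. (\<integral>\<omega>. partial_deriv i f (\<lambda>i. W j i \<omega>) * (\<phi> i \<bullet> h \<omega>) \<partial>M) +
        (\<integral>\<omega>. partial_deriv i f (\<lambda>i. W j i \<omega>) * ((w j i - \<phi> i) \<bullet> h \<omega>) \<partial>M)) \<longlonglongrightarrow>
        (\<integral>\<omega>. partial_deriv i f (\<lambda>i. Y i \<omega>) * (\<phi> i \<bullet> h \<omega>) \<partial>M) + 0"
      by (rule tendsto_add)
    moreover have "(\<integral>\<omega>. partial_deriv i f (\<lambda>i. W j i \<omega>) * (\<phi> i \<bullet> h \<omega>) \<partial>M) +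
        (\<integral>\<omega>. partial_deriv i f (\<lambda>i. W j i \<omega>) * ((w j i - \<phi> i) \<bullet> h \<omega>) \<partial>M) =
        (\<integral>\<omega>. partial_deriv i f (\<lambda>i. W j i \<omega>) * (w j i \<bullet> h \<omega>) \<partial>M)" for j
      using int[OF i pW[OF i]]
      by (subst Bochner_Integration.integral_add[symmetric]) (auto simp: inner_diff_left algebra_simps)
    ultimately show ?thesis by simp
  qed
  have "(\<lambda>j. \<Sum>i<n. \<integral>\<omega>. partial_deriv i f (\<lambda>i. W j i \<omega>) * (w j i \<bullet> h \<omega>) \<partial>M) \<longlonglongrightarrow>
      (\<Sum>i<n. \<integral>\<omega>. partial_deriv i f (\<lambda>i. Y i \<omega>) * (\<phi> i \<bullet> h \<omega>) \<partial>M)"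
    using lim2 by (intro tendsto_sum) auto
  then have "(\<lambda>j. \<integral>\<omega>. f (\<lambda>i. W j i \<omega>) * (geometric_fbm t \<omega> - 1) \<partial>M) \<longlonglongrightarrow>
      (\<Sum>i<n. \<integral>\<omega>. partial_deriv i f (\<lambda>i. Y i \<omega>) * (\<phi> i \<bullet> h \<omega>) \<partial>M)"
    by (simp only: elementary_duality[OF f t el res])
  from LIMSEQ_unique[OF lim1 this]
  have "(\<integral>\<omega>. F \<omega> * (geometric_fbm t \<omega> - 1) \<partial>M) =
      (\<Sum>i<n. \<integral>\<omega>. partial_deriv i f (\<lambda>i. Y i \<omega>) * (\<phi> i \<bullet> h \<omega>) \<partial>M)" .
  also have "\<dots> = (\<integral>\<omega>. G \<omega> \<bullet> h \<omega> \<partial>M)"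
    unfolding FG(2) inner_sum_left inner_scaleR_left
    using int lipschitz_coords_measurable[OF C(3) L2_rvD(1)[OF Y]]
    by (subst Bochner_Integration.integral_sum) auto
  finally show ?thesis .
qed

lemma malliavin_duality:
  assumes "malliavin M B T e F G" "t \<in> {0..T}" "restricts_to M H T e geometric_fbm t h"
  shows "(\<integral>\<omega>. F \<omega> * (geometric_fbm t \<omega> - 1) \<partial>M) = (\<integral>\<omega>. G \<omega> \<bullet> h \<omega> \<partial>M)"
proof -
  obtain F' G' where FG: "\<And>k. smooth_malliavin M B T e (F' k) (G' k)" "L2_tendsto M F' F" "L2_tendsto M G' G"
    using assms(1) by (auto simp: malliavin_def)
  have "L2_rv M h" using assms(3) by (simp add: restricts_to_def)
  from L2_tendsto_inner[OF FG(3) this]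
  have "(\<lambda>k. \<integral>\<omega>. F' k \<omega> * (geometric_fbm t \<omega> - 1) \<partial>M) \<longlonglongrightarrow> (\<integral>\<omega>. G \<omega> \<bullet> h \<omega> \<partial>M)"
    by (simp only: smooth_duality[OF FG(1) assms(2,3)])
  moreover have "(\<lambda>k. \<integral>\<omega>. F' k \<omega> * (geometric_fbm t \<omega> - 1) \<partial>M) \<longlonglongrightarrow> (\<integral>\<omega>. F \<omega> * (geometric_fbm t \<omega> - 1) \<partial>M)"
    by (intro L2_tendsto_mult[OF FG(2)] L2_rv_diff L2_rv_const geometric_fbm_L2 assms(2) finite_measure_axioms)
  ultimately show ?thesis using LIMSEQ_unique by blast
qed

end

section \<open>Stochastic step integrands\<close>

lemma norm_sum_nonneg_correlated:
  fixes d :: "'i \<Rightarrow> 'b::real_inner"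
  assumes "\<And>i j. i \<in> I \<Longrightarrow> j \<in> I \<Longrightarrow> d i \<bullet> d j \<ge> 0"
  shows "(norm (\<Sum>i\<in>I. a i *\<^sub>R d i))\<^sup>2 \<le> (\<Sum>i\<in>I. (a i)\<^sup>2 * (d i \<bullet> (\<Sum>j\<in>I. d j)))"
proof -
  have "(norm (\<Sum>i\<in>I. a i *\<^sub>R d i))\<^sup>2 = (\<Sum>i\<in>I. \<Sum>j\<in>I. a i * a j * (d i \<bullet> d j))"
    unfolding power2_norm_eq_inner inner_sum_left inner_sum_right
    by (subst sum.swap) (simp add: mult.assoc inner_commute)
  also have "\<dots> \<le> (\<Sum>i\<in>I. \<Sum>j\<in>I. ((a i)\<^sup>2 / 2 + (a j)\<^sup>2 / 2) * (d i \<bullet> d j))"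
  proof (intro sum_mono mult_right_mono assms)
    show "a i * a j \<le> (a i)\<^sup>2 / 2 + (a j)\<^sup>2 / 2" for i j
      using sum_squares_bound[of "a i" "a j"] by simp
  qed
  also have "\<dots> = (\<Sum>i\<in>I. \<Sum>j\<in>I. (a i)\<^sup>2 / 2 * (d i \<bullet> d j)) + (\<Sum>i\<in>I. \<Sum>j\<in>I. (a j)\<^sup>2 / 2 * (d i \<bullet> d j))"
    by (simp add: distrib_right sum.distrib)
  also have "(\<Sum>i\<in>I. \<Sum>j\<in>I. (a j)\<^sup>2 / 2 * (d i \<bullet> d j)) = (\<Sum>i\<in>I. \<Sum>j\<in>I. (a i)\<^sup>2 / 2 * (d i \<bullet> d j))"
    by (subst sum.swap) (simp add: inner_commute)
  also have "(\<Sum>i\<in>I. \<Sum>j\<in>I. (a i)\<^sup>2 / 2 * (d i \<bullet> d j)) + (\<Sum>i\<in>I. \<Sum>j\<in>I. (a i)\<^sup>2 / 2 * (d i \<bullet> d j)) =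
      (\<Sum>i\<in>I. (a i)\<^sup>2 * (d i \<bullet> (\<Sum>j\<in>I. d j)))"
    by (simp add: inner_sum_right sum_distrib_left sum.distrib[symmetric] mult.commute)
  finally show ?thesis .
qed

text \<open>Random coefficients destroy the isometry of the Wiener integral. Positive correlation of the
  increments \<open>d i\<close> still bounds the second moment, as if the coefficients were constants.\<close>

lemma L2_norm_random_sum:
  fixes d :: "'i \<Rightarrow> 'b::{real_inner,second_countable_topology}" and A :: "'i \<Rightarrow> 'a \<Rightarrow> real"
  assumes "\<And>i j. i \<in> I \<Longrightarrow> j \<in> I \<Longrightarrow> d i \<bullet> d j \<ge> 0"
    and A: "\<And>i. i \<in> I \<Longrightarrow> L2_rv M (A i)"
    and \<kappa>: "\<And>i. i \<in> I \<Longrightarrow> (\<integral>\<omega>. (A i \<omega>)\<^sup>2 \<partial>M) \<le> \<kappa>"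
  shows "L2_rv M (\<lambda>\<omega>. \<Sum>i\<in>I. A i \<omega> *\<^sub>R d i)"
    and "(\<integral>\<omega>. (norm (\<Sum>i\<in>I. A i \<omega> *\<^sub>R d i))\<^sup>2 \<partial>M) \<le> \<kappa> * (norm (\<Sum>i\<in>I. d i))\<^sup>2"
proof -
  have "L2_rv M (\<lambda>\<omega>. A i \<omega> *\<^sub>R d i)" if "i \<in> I" for i
    using A[OF that] by (auto simp: L2_rv_def power_mult_distrib)
  then show L2: "L2_rv M (\<lambda>\<omega>. \<Sum>i\<in>I. A i \<omega> *\<^sub>R d i)" by (rule L2_rv_sum)
  have A2: "integrable M (\<lambda>\<omega>. (A i \<omega>)\<^sup>2)" if "i \<in> I" for i using L2_rvD(2)[OF A[OF that]] by simp
  have "(\<integral>\<omega>. (norm (\<Sum>i\<in>I. A i \<omega> *\<^sub>R d i))\<^sup>2 \<partial>M) \<le> (\<integral>\<omega>. (\<Sum>i\<in>I. (A i \<omega>)\<^sup>2 * (d i \<bullet> (\<Sum>j\<in>I. d j))) \<partial>M)"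
    by (intro integral_mono L2_rvD(2)[OF L2] norm_sum_nonneg_correlated assms(1)
        Bochner_Integration.integrable_sum integrable_mult_left A2) auto
  also have "\<dots> = (\<Sum>i\<in>I. (\<integral>\<omega>. (A i \<omega>)\<^sup>2 \<partial>M) * (d i \<bullet> (\<Sum>j\<in>I. d j)))"
    using A2 by (subst Bochner_Integration.integral_sum) (auto intro: integrable_mult_left)
  also have "\<dots> \<le> (\<Sum>i\<in>I. \<kappa> * (d i \<bullet> (\<Sum>j\<in>I. d j)))"
    using \<kappa> assms(1) by (intro sum_mono mult_right_mono) (auto simp: inner_sum_right intro: sum_nonneg)
  also have "\<dots> = \<kappa> * (norm (\<Sum>i\<in>I. d i))\<^sup>2"
    by (simp add: power2_norm_eq_inner inner_sum_left sum_distrib_left[symmetric])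
  finally show "(\<integral>\<omega>. (norm (\<Sum>i\<in>I. A i \<omega> *\<^sub>R d i))\<^sup>2 \<partial>M) \<le> \<kappa> * (norm (\<Sum>i\<in>I. d i))\<^sup>2" .
qed

lemma sum_lessThan_double:
  fixes g :: "nat \<Rightarrow> 'b::comm_monoid_add"
  shows "(\<Sum>j<2 * n. g j) = (\<Sum>i<n. g (2 * i) + g (2 * i + 1))"
  by (induction n) (auto simp: algebra_simps)

lemma convergent_of_summable_differences:
  fixes x :: "nat \<Rightarrow> 'b::banach"
  assumes "summable (\<lambda>n. norm (x (Suc n) - x n))"
  shows "x \<longlonglongrightarrow> lim x"
proof -
  have "summable (\<lambda>n. x (Suc n) - x n)" using assms by (rule summable_norm_cancel)
  then have "(\<lambda>n. \<Sum>k<n. x (Suc k) - x k) \<longlonglongrightarrow> (\<Sum>k. x (Suc k) - x k)" by (rule summable_LIMSEQ)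
  then have "(\<lambda>n. (x n - x 0) + x 0) \<longlonglongrightarrow> (\<Sum>k. x (Suc k) - x k) + x 0"
    by (intro tendsto_add tendsto_const) (simp add: sum_lessThan_telescope)
  then have "convergent x" by (auto simp: convergent_def)
  then show ?thesis by (simp add: convergent_LIMSEQ_iff)
qed

lemma (in prob_space) L2_rv_Fatou:
  fixes x :: "nat \<Rightarrow> 'a \<Rightarrow> 'b::{real_normed_vector,second_countable_topology}"
  assumes x: "\<And>n. L2_rv M (x n)" "\<And>n. (\<integral>\<omega>. (norm (x n \<omega>))\<^sup>2 \<partial>M) \<le> \<kappa>"
    and y: "y \<in> borel_measurable M" "AE \<omega> in M. (\<lambda>n. x n \<omega>) \<longlonglongrightarrow> y \<omega>"
  shows "L2_rv M y"
proof -
  have [measurable]: "x n \<in> borel_measurable M" for n using L2_rvD(1)[OF x(1)] .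
  note [measurable] = y(1)
  have "(\<integral>\<^sup>+\<omega>. ennreal ((norm (y \<omega>))\<^sup>2) \<partial>M) = (\<integral>\<^sup>+\<omega>. liminf (\<lambda>n. ennreal ((norm (x n \<omega>))\<^sup>2)) \<partial>M)"
  proof (rule nn_integral_cong_AE)
    show "AE \<omega> in M. ennreal ((norm (y \<omega>))\<^sup>2) = liminf (\<lambda>n. ennreal ((norm (x n \<omega>))\<^sup>2))"
      using y(2)
    proof eventually_elim
      case (elim \<omega>)
      then have "(\<lambda>n. ennreal ((norm (x n \<omega>))\<^sup>2)) \<longlonglongrightarrow> ennreal ((norm (y \<omega>))\<^sup>2)"
        by (intro tendsto_intros tendsto_ennrealI)
      then show ?case using lim_imp_Liminf[OF sequentially_bot] by metis
    qed
  qed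
  also have "\<dots> \<le> liminf (\<lambda>n. \<integral>\<^sup>+\<omega>. ennreal ((norm (x n \<omega>))\<^sup>2) \<partial>M)"
    by (rule nn_integral_liminf) measurable
  also have "\<dots> \<le> limsup (\<lambda>n. \<integral>\<^sup>+\<omega>. ennreal ((norm (x n \<omega>))\<^sup>2) \<partial>M)"
    by (rule Liminf_le_Limsup) simp
  also have "\<dots> \<le> ennreal \<kappa>"
  proof (rule Limsup_bounded, rule always_eventually, rule allI)
    fix n show "(\<integral>\<^sup>+\<omega>. ennreal ((norm (x n \<omega>))\<^sup>2) \<partial>M) \<le> ennreal \<kappa>"
      using L2_rvD(2)[OF x(1)] x(2) by (subst nn_integral_eq_integral) (auto intro: ennreal_leI)
  qed
  finally have "(\<integral>\<^sup>+\<omega>. ennreal ((norm (y \<omega>))\<^sup>2) \<partial>M) < \<infinity>"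
    by (rule le_less_trans) simp
  then show ?thesis
    unfolding L2_rv_def by (intro conjI y(1) integrableI_bounded) auto
qed

lemma (in prob_space) integrable_strip:
  fixes f :: "real \<Rightarrow> 'a \<Rightarrow> real"
  assumes meas: "case_prod f \<in> borel_measurable (lborel \<Otimes>\<^sub>M M)"
    and out: "\<And>u \<omega>. u \<notin> {0<..t} \<Longrightarrow> f u \<omega> = 0"
    and sec: "\<And>u. u \<in> {0<..t} \<Longrightarrow> integrable M (f u)" "\<And>u. u \<in> {0<..t} \<Longrightarrow> (\<integral>\<omega>. \<bar>f u \<omega>\<bar> \<partial>M) \<le> c"
    and c: "c \<ge> 0" and t: "t \<ge> 0"
  shows "integrable (lborel \<Otimes>\<^sub>M M) (case_prod f)"
    and "(\<integral>\<omega>. (\<integral>u. \<bar>f u \<omega>\<bar> \<partial>lborel) \<partial>M) \<le> c * t"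
proof -
  interpret P: pair_sigma_finite lborel M ..
  note [measurable] = meas
  have sec0: "integrable M (f u)" "(\<integral>\<omega>. \<bar>f u \<omega>\<bar> \<partial>M) \<le> c * indicator {0<..t} u" for u
  proof -
    have "f u = (\<lambda>_. 0)" if "u \<notin> {0<..t}" using out[OF that] by auto
    then show "integrable M (f u)" "(\<integral>\<omega>. \<bar>f u \<omega>\<bar> \<partial>M) \<le> c * indicator {0<..t} u"
      using sec[of u] by (cases "u \<in> {0<..t}", auto)+
  qed
  have "(\<integral>\<^sup>+x. ennreal (norm (case_prod f x)) \<partial>(lborel \<Otimes>\<^sub>M M)) = (\<integral>\<^sup>+u. (\<integral>\<^sup>+\<omega>. ennreal \<bar>f u \<omega>\<bar> \<partial>M) \<partial>lborel)"
    by (subst nn_integral_fst[symmetric]) auto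
  also have "\<dots> \<le> (\<integral>\<^sup>+u. ennreal c * indicator {0<..t} u \<partial>lborel)"
  proof (rule nn_integral_mono)
    fix u
    have "(\<integral>\<^sup>+\<omega>. ennreal \<bar>f u \<omega>\<bar> \<partial>M) = ennreal (\<integral>\<omega>. \<bar>f u \<omega>\<bar> \<partial>M)"
      using sec0(1)[of u] by (intro nn_integral_eq_integral) auto
    also have "\<dots> \<le> ennreal (c * indicator {0<..t} u)" by (rule ennreal_leI[OF sec0(2)])
    also have "\<dots> = ennreal c * indicator {0<..t} u" by (simp add: indicator_def)
    finally show "(\<integral>\<^sup>+\<omega>. ennreal \<bar>f u \<omega>\<bar> \<partial>M) \<le> ennreal c * indicator {0<..t} u" .
  qed
  also have "\<dots> = ennreal (c * t)"
    using t c by (simp add: nn_integral_cmult ennreal_mult)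
  also have "\<dots> < \<infinity>" by simp
  finally show int: "integrable (lborel \<Otimes>\<^sub>M M) (case_prod f)"
    by (intro integrableI_bounded) auto
  then have int': "integrable (lborel \<Otimes>\<^sub>M M) (\<lambda>(u, \<omega>). \<bar>f u \<omega>\<bar>)"
    using integrable_abs[OF int] by (simp add: case_prod_beta')
  have "(\<integral>\<omega>. (\<integral>u. \<bar>f u \<omega>\<bar> \<partial>lborel) \<partial>M) = (\<integral>u. (\<integral>\<omega>. \<bar>f u \<omega>\<bar> \<partial>M) \<partial>lborel)"
    using P.integral_fst[OF int'] P.integral_snd[OF int'] by simp
  also have "\<dots> \<le> (\<integral>u. c * indicator {0<..t} u \<partial>lborel)"
    using t by (intro integral_mono P.integrable_fst[OF int'] sec0(2)
        integrable_mult_right integrable_real_indicator) auto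
  also have "\<dots> = c * t" using t by simp
  finally show "(\<integral>\<omega>. (\<integral>u. \<bar>f u \<omega>\<bar> \<partial>lborel) \<partial>M) \<le> c * t" .
qed

context fbm_space
begin

text \<open>The mixed second moments are exponentials of \<open>fbm_cov\<close>, which is Lipschitz in each time.\<close>

lemma geometric_fbm_increment:
  obtains C where "C \<ge> 0" "\<And>s u. s \<in> {0..T} \<Longrightarrow> u \<in> {0..T} \<Longrightarrow>
    (\<integral>\<omega>. (geometric_fbm s \<omega> - geometric_fbm u \<omega>)\<^sup>2 \<partial>M) \<le> C * \<bar>s - u\<bar>"
proof -
  define L where "L = 2 * H * T powr (2 * H - 1)"
  define E where "E = exp (T powr (2 * H))"
  have one_sided: "exp (fbm_cov H s s) - exp (fbm_cov H s u) \<le> E * L * \<bar>s - u\<bar>"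
    if "s \<in> {0..T}" "u \<in> {0..T}" for s u
  proof -
    define a b where "a = fbm_cov H s s" and "b = fbm_cov H s u"
    have lip: "\<bar>a - b\<bar> \<le> L * \<bar>s - u\<bar>"
      using fbm_cov_lipschitz[OF H, of s T s u] that by (simp add: a_def b_def L_def fbm_cov_commute[of H s u])
    have "a \<le> T powr (2 * H)" using that H by (auto simp: a_def fbm_cov_same intro: powr_mono2)
    then have "exp a \<le> E" by (simp add: E_def)
    have "exp a - exp b = exp a * (1 - exp (b - a))" by (simp add: algebra_simps exp_add[symmetric])
    also have "\<dots> \<le> exp a * \<bar>a - b\<bar>"
    proof (rule mult_left_mono)
      show "1 - exp (b - a) \<le> \<bar>a - b\<bar>" using exp_ge_add_one_self[of "b - a"] by linarith
    qed simp
    also have "\<dots> \<le> E * (L * \<bar>s - u\<bar>)"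
      using \<open>exp a \<le> E\<close> lip by (intro mult_mono) (auto simp: E_def)
    finally show ?thesis by (simp add: a_def b_def mult.assoc)
  qed
  have "(\<integral>\<omega>. (geometric_fbm s \<omega> - geometric_fbm u \<omega>)\<^sup>2 \<partial>M) \<le> (2 * (E * L)) * \<bar>s - u\<bar>"
    if su: "s \<in> {0..T}" "u \<in> {0..T}" for s u
  proof -
    have "(\<integral>\<omega>. (geometric_fbm s \<omega> - geometric_fbm u \<omega>)\<^sup>2 \<partial>M) =
        (\<integral>\<omega>. geometric_fbm s \<omega> * geometric_fbm s \<omega> + geometric_fbm u \<omega> * geometric_fbm u \<omega>
           - 2 * (geometric_fbm s \<omega> * geometric_fbm u \<omega>) \<partial>M)"
      by (simp add: power2_eq_square algebra_simps)
    also have "\<dots> = (exp (fbm_cov H s s) - exp (fbm_cov H s u)) + (exp (fbm_cov H u u) - exp (fbm_cov H u s))"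
      using geometric_fbm_mult su by (simp add: fbm_cov_commute[of H u s])
    also have "\<dots> \<le> E * L * \<bar>s - u\<bar> + E * L * \<bar>u - s\<bar>"
      using one_sided su by (intro add_mono) auto
    finally show ?thesis by (simp add: abs_minus_commute)
  qed
  moreover have "2 * (E * L) \<ge> 0" using H by (simp add: E_def L_def)
  ultimately show thesis using that by blast
qed

lemma geometric_fbm_second_moment:
  assumes "s \<in> {0..T}"
  shows "(\<integral>\<omega>. (geometric_fbm s \<omega>)\<^sup>2 \<partial>M) \<le> exp (T powr (2 * H))"
  using geometric_fbm_mult(2)[OF assms assms] assms H
  by (auto simp: power2_eq_square fbm_cov_same intro: powr_mono2)

section \<open>Dyadic approximation of the geometric process\<close>

definition grid :: "real \<Rightarrow> nat \<Rightarrow> nat \<Rightarrow> real" where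
  "grid t n i = t * real i / 2 ^ n"

definition step_process :: "real \<Rightarrow> nat \<Rightarrow> real \<Rightarrow> 'a \<Rightarrow> real" where
  "step_process t n u \<omega> =
     (\<Sum>i<2 ^ n. geometric_fbm (grid t n i) \<omega> * indicator {grid t n i<..grid t n (Suc i)} u)"

definition step_element :: "real \<Rightarrow> nat \<Rightarrow> 'a \<Rightarrow> 'u" where
  "step_element t n \<omega> =
     (\<Sum>i<2 ^ n. geometric_fbm (grid t n i) \<omega> *\<^sub>R (e (grid t n (Suc i)) - e (grid t n i)))"

lemma grid_in: "t \<in> {0..T} \<Longrightarrow> i \<le> 2 ^ n \<Longrightarrow> grid t n i \<in> {0..T}"
proof -
  assume t: "t \<in> {0..T}" and i: "i \<le> 2 ^ n"
  have "real i \<le> 2 ^ n" using i by (metis of_nat_le_iff of_nat_numeral of_nat_power)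
  then have "t * real i / 2 ^ n \<le> t * 1" using t by (simp add: field_simps mult_left_mono)
  then show "grid t n i \<in> {0..T}" using t by (auto simp: grid_def)
qed

lemma grid_mono: "t \<ge> 0 \<Longrightarrow> grid t n i \<le> grid t n (Suc i)"
  by (simp add: grid_def divide_right_mono mult_left_mono)

lemma grid_0 [simp]: "grid t n 0 = 0" and grid_last [simp]: "grid t n (2 ^ n) = t"
  by (auto simp: grid_def)

lemma grid_double: "grid t (Suc n) (2 * i) = grid t n i"
  by (simp add: grid_def)

lemma grid_coarsen:
  assumes "t \<ge> 0"
  shows "\<bar>grid t (Suc n) j - grid t n (j div 2)\<bar> \<le> t * (1 / 2) ^ n"
proof -
  have eq: "grid t (Suc n) j - grid t n (j div 2) = t * (1 / 2) ^ n * (real (j mod 2) / 2)"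
  proof -
    have "real j = 2 * real (j div 2) + real (j mod 2)"
      by (metis div_mult_mod_eq mult.commute of_nat_add of_nat_mult of_nat_numeral)
    then show ?thesis by (simp add: grid_def power_one_over field_simps)
  qed
  have "\<bar>grid t (Suc n) j - grid t n (j div 2)\<bar> = t * (1 / 2) ^ n * (real (j mod 2) / 2)"
    unfolding eq using assms by simp
  also have "\<dots> \<le> t * (1 / 2) ^ n * 1"
    using assms by (intro mult_left_mono) (auto simp: odd_iff_mod_2_eq_one mod2_eq_if)
  finally show ?thesis by simp
qed

lemma grid_increments_nonneg:
  assumes "t \<in> {0..T}" "i < 2 ^ n" "j < 2 ^ n"
  shows "(e (grid t n (Suc i)) - e (grid t n i)) \<bullet> (e (grid t n (Suc j)) - e (grid t n j)) \<ge> 0"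
proof -
  have "grid t n i \<in> {0..T}" "grid t n (Suc i) \<in> {0..T}" "grid t n j \<in> {0..T}" "grid t n (Suc j) \<in> {0..T}"
    using assms by (auto intro!: grid_in simp del: atLeastAtMost_iff)
  then show ?thesis
    using fbm_cov_increments_nonneg[OF H grid_mono[of t n i] grid_mono[of t n j]] assms(1)
    by (simp add: inner_diff_left inner_diff_right inner_e algebra_simps)
qed

lemma sum_grid_increments: "(\<Sum>i<2 ^ n. e (grid t n (Suc i)) - e (grid t n i)) = e t"
  using sum_lessThan_telescope[of "\<lambda>i. e (grid t n i)" "2 ^ n"] by (simp add: e_0)

lemma
  assumes t: "t \<in> {0..T}"
  shows step_element_L2: "L2_rv M (step_element t n)"
    and step_element_norm: "(\<integral>\<omega>. (norm (step_element t n \<omega>))\<^sup>2 \<partial>M) \<le> exp (T powr (2 * H)) * (norm (e t))\<^sup>2"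
proof -
  have in_T: "grid t n i \<in> {0..T}" if "i \<in> {..<2 ^ n}" for i using grid_in[OF t, of i n] that by simp
  have rules: "L2_rv M (geometric_fbm (grid t n i))"
    "(\<integral>\<omega>. (geometric_fbm (grid t n i) \<omega>)\<^sup>2 \<partial>M) \<le> exp (T powr (2 * H))" if "i \<in> {..<2 ^ n}" for i
    by (intro geometric_fbm_L2 geometric_fbm_second_moment in_T that)+
  have nonneg: "(e (grid t n (Suc i)) - e (grid t n i)) \<bullet> (e (grid t n (Suc j)) - e (grid t n j)) \<ge> 0"
    if "i \<in> {..<2 ^ n}" "j \<in> {..<2 ^ n}" for i j
    using grid_increments_nonneg[OF t] that by simp
  note bounds = L2_norm_random_sum[where A = "\<lambda>i. geometric_fbm (grid t n i)"
      and d = "\<lambda>i. e (grid t n (Suc i)) - e (grid t n i)" and I = "{..<2 ^ n}", OF nonneg rules]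
  show "L2_rv M (step_element t n)"
    unfolding step_element_def[abs_def] by (rule bounds(1))
  have "(\<integral>\<omega>. (norm (step_element t n \<omega>))\<^sup>2 \<partial>M) \<le>
      exp (T powr (2 * H)) * (norm (\<Sum>i<2 ^ n. e (grid t n (Suc i)) - e (grid t n i)))\<^sup>2"
    unfolding step_element_def[abs_def] by (rule bounds(2))
  then show "(\<integral>\<omega>. (norm (step_element t n \<omega>))\<^sup>2 \<partial>M) \<le> exp (T powr (2 * H)) * (norm (e t))\<^sup>2"
    unfolding sum_grid_increments .
qed

text \<open>On the finer grid both step elements are sums over the same increments, with coefficients that
  are close in mean square.\<close>

lemma step_element_difference:
  assumes t: "t \<in> {0..T}"
    and C: "\<And>s u. s \<in> {0..T} \<Longrightarrow> u \<in> {0..T} \<Longrightarrow>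
      (\<integral>\<omega>. (geometric_fbm s \<omega> - geometric_fbm u \<omega>)\<^sup>2 \<partial>M) \<le> C * \<bar>s - u\<bar>" "C \<ge> 0"
  shows "(\<integral>\<omega>. (norm (step_element t (Suc n) \<omega> - step_element t n \<omega>))\<^sup>2 \<partial>M) \<le>
    C * t * (norm (e t))\<^sup>2 * (1 / 2) ^ n"
proof -
  let ?I = "{..<2 ^ Suc n :: nat}"
  let ?d = "\<lambda>j. e (grid t (Suc n) (Suc j)) - e (grid t (Suc n) j)"
  let ?A = "\<lambda>j \<omega>. geometric_fbm (grid t (Suc n) j) \<omega> - geometric_fbm (grid t n (j div 2)) \<omega>"
  have in_T: "grid t (Suc n) j \<in> {0..T}" "grid t n (j div 2) \<in> {0..T}" if "j \<in> ?I" for j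
    using grid_in[OF t, of j "Suc n"] grid_in[OF t, of "j div 2" n] that by auto
  have coarse: "step_element t n \<omega> = (\<Sum>j<2 ^ Suc n. geometric_fbm (grid t n (j div 2)) \<omega> *\<^sub>R ?d j)" for \<omega>
  proof -
    have "(\<Sum>j<2 * 2 ^ n. geometric_fbm (grid t n (j div 2)) \<omega> *\<^sub>R ?d j) =
        (\<Sum>i<2 ^ n. geometric_fbm (grid t n i) \<omega> *\<^sub>R (e (grid t n (Suc i)) - e (grid t n i)))"
      unfolding sum_lessThan_double
    proof (intro sum.cong refl)
      fix i
      have "grid t (Suc n) (Suc (2 * i + 1)) = grid t n (Suc i)" using grid_double[of t n "Suc i"] by simp
      then show "geometric_fbm (grid t n (2 * i div 2)) \<omega> *\<^sub>R ?d (2 * i) +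
          geometric_fbm (grid t n ((2 * i + 1) div 2)) \<omega> *\<^sub>R ?d (2 * i + 1) =
          geometric_fbm (grid t n i) \<omega> *\<^sub>R (e (grid t n (Suc i)) - e (grid t n i))"
        by (simp add: grid_double scaleR_add_right[symmetric])
    qed
    then show ?thesis by (simp add: step_element_def)
  qed
  have diff: "step_element t (Suc n) \<omega> - step_element t n \<omega> = (\<Sum>j\<in>?I. ?A j \<omega> *\<^sub>R ?d j)" for \<omega>
    unfolding coarse by (simp only: step_element_def sum_subtractf[symmetric] scaleR_diff_left)
  have nonneg: "?d i \<bullet> ?d j \<ge> 0" if "i \<in> ?I" "j \<in> ?I" for i j
    using grid_increments_nonneg[OF t, of i "Suc n" j] that by simp
  have A: "L2_rv M (?A j)" "(\<integral>\<omega>. (?A j \<omega>)\<^sup>2 \<partial>M) \<le> C * (t * (1 / 2) ^ n)" if "j \<in> ?I" for j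
  proof -
    show "L2_rv M (?A j)" by (intro L2_rv_diff geometric_fbm_L2 in_T that)
    have "(\<integral>\<omega>. (?A j \<omega>)\<^sup>2 \<partial>M) \<le> C * \<bar>grid t (Suc n) j - grid t n (j div 2)\<bar>" by (intro C in_T that)
    also have "\<dots> \<le> C * (t * (1 / 2) ^ n)" using t C(2) by (intro mult_left_mono grid_coarsen) auto
    finally show "(\<integral>\<omega>. (?A j \<omega>)\<^sup>2 \<partial>M) \<le> C * (t * (1 / 2) ^ n)" .
  qed
  have "(\<integral>\<omega>. (norm (\<Sum>j\<in>?I. ?A j \<omega> *\<^sub>R ?d j))\<^sup>2 \<partial>M) \<le> C * (t * (1 / 2) ^ n) * (norm (\<Sum>j\<in>?I. ?d j))\<^sup>2"
    by (rule L2_norm_random_sum(2)[OF nonneg A])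
  then show ?thesis unfolding diff sum_grid_increments by (simp add: mult_ac)
qed

lemma step_process_eq:
  assumes t: "t \<in> {0..T}" and u: "u \<in> {0<..t}"
  obtains v where "v \<in> {0..T}" "\<bar>v - u\<bar> \<le> t * (1 / 2) ^ n" "step_process t n u = geometric_fbm v"
proof -
  have tpos: "t > 0" using u by auto
  define x where "x = u * 2 ^ n / t"
  \<comment> \<open>Measured in cells, \<open>u\<close> is at \<open>x\<close>; cells are open on the left, hence the ceiling.\<close>
  define i where "i = nat (\<lceil>x\<rceil> - 1)"
  have x: "0 < x" "x \<le> 2 ^ n" using u tpos by (auto simp: x_def field_simps)
  have ceil: "1 \<le> \<lceil>x\<rceil>" "\<lceil>x\<rceil> \<le> 2 ^ n" using x by (auto simp: ceiling_le_iff less_ceiling_iff)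
  have ri: "real i = of_int \<lceil>x\<rceil> - 1" using ceil by (simp add: i_def)
  have i: "real i < x" "x \<le> real i + 1" using ri by linarith+
  have ilt: "i < 2 ^ n"
    using ceil unfolding i_def by (subst nat_less_iff) auto
  have mem: "u \<in> {grid t n j<..grid t n (Suc j)} \<longleftrightarrow> j = i" for j
  proof -
    have "u \<in> {grid t n j<..grid t n (Suc j)} \<longleftrightarrow> real j < x \<and> x \<le> real j + 1"
      using tpos by (auto simp: grid_def x_def field_simps)
    also have "\<dots> \<longleftrightarrow> j = i" using i by auto
    finally show ?thesis .
  qed
  show thesis
  proof
    show "grid t n i \<in> {0..T}" using grid_in[OF t, of i n] ilt by simp
    have "u \<in> {grid t n i<..grid t n (Suc i)}" using mem by blast
    moreover have "grid t n (Suc i) - grid t n i = t * (1 / 2) ^ n"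
      by (simp add: grid_def field_simps power_one_over)
    ultimately show "\<bar>grid t n i - u\<bar> \<le> t * (1 / 2) ^ n" by auto
    show "step_process t n u = geometric_fbm (grid t n i)"
      unfolding step_process_def indicator_def mem using ilt by (simp add: fun_eq_iff)
  qed
qed

lemma step_process_outside:
  assumes "t \<in> {0..T}" "u \<notin> {0<..t}"
  shows "step_process t n u \<omega> = 0"
proof -
  have "u \<notin> {grid t n i<..grid t n (Suc i)}" if "i < 2 ^ n" for i
  proof -
    have "0 \<le> grid t n i" using assms(1) by (simp add: grid_def)
    moreover have "grid t n (Suc i) \<le> t"
    proof -
      have "real (Suc i) \<le> 2 ^ n" using that by (metis Suc_leI of_nat_le_iff of_nat_numeral of_nat_power)
      then have "t * real (Suc i) \<le> t * 2 ^ n" using assms(1) by (intro mult_left_mono) auto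
      then show ?thesis by (simp only: grid_def pos_divide_le_eq zero_less_power zero_less_numeral)
    qed
    ultimately show ?thesis using assms(2) by auto
  qed
  then show ?thesis unfolding step_process_def by (intro sum.neutral) auto
qed

lemma step_process_measurable:
  assumes "t \<in> {0..T}"
  shows "(\<lambda>(u, \<omega>). step_process t n u \<omega>) \<in> borel_measurable (lborel \<Otimes>\<^sub>M M)"
proof -
  have [measurable]: "geometric_fbm (grid t n i) \<in> borel_measurable M" if "i \<in> {..<2 ^ n}" for i
    by (rule geometric_fbm_measurable[OF grid_in[OF assms]]) (use that in simp)
  show ?thesis unfolding step_process_def[abs_def] case_prod_beta'
    by (intro borel_measurable_sum) measurable
qed

lemma integral_step_process:
  assumes t: "t \<in> {0..T}" and r: "r \<in> {0..T}"
  shows "integrable lborel (\<lambda>u. step_process t n u \<omega> * cov_kernel H r u)"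
    and "step_element t n \<omega> \<bullet> e r = (\<integral>u. step_process t n u \<omega> * cov_kernel H r u \<partial>lborel)"
proof -
  have in_T: "grid t n i \<in> {0..T}" "grid t n (Suc i) \<in> {0..T}" if "i < 2 ^ n" for i
    using grid_in[OF t, of i n] grid_in[OF t, of "Suc i" n] that by auto
  have int: "integrable lborel (\<lambda>u. indicator {grid t n i<..grid t n (Suc i)} u * cov_kernel H r u)"
    if "i < 2 ^ n" for i
  proof -
    have "integrable lborel (\<lambda>u. indicator {grid t n i<..grid t n (Suc i)} u * (indicator {0..T} u * cov_kernel H r u))"
    proof (rule integrable_mult_bounded)
      show "integrable lborel (indicator {grid t n i<..grid t n (Suc i)} :: real \<Rightarrow> real)"
        using grid_mono[of t n i] t by (intro integrable_real_indicator) auto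
      show "\<bar>indicator {0..T} u * cov_kernel H r u\<bar> \<le> 2 * H * T powr (2 * H - 1)" for u
        using abs_cov_kernel_le[OF H r, of u] H by (auto simp: indicator_def)
    qed (use cov_kernel_measurable[OF H] in auto)
    moreover have "indicator {grid t n i<..grid t n (Suc i)} u * (indicator {0..T} u * cov_kernel H r u) =
        indicator {grid t n i<..grid t n (Suc i)} u * cov_kernel H r u" for u
      using in_T[OF that] by (auto simp: indicator_def)
    ultimately show ?thesis by simp
  qed
  have eq: "step_process t n u \<omega> * cov_kernel H r u = (\<Sum>i<2 ^ n. geometric_fbm (grid t n i) \<omega> *
      (indicator {grid t n i<..grid t n (Suc i)} u * cov_kernel H r u))" for u
    unfolding step_process_def sum_distrib_right by (simp only: mult.assoc)
  show "integrable lborel (\<lambda>u. step_process t n u \<omega> * cov_kernel H r u)"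
    unfolding eq by (intro Bochner_Integration.integrable_sum integrable_mult_right int) auto
  have "(\<integral>u. step_process t n u \<omega> * cov_kernel H r u \<partial>lborel) =
      (\<Sum>i<2 ^ n. geometric_fbm (grid t n i) \<omega> * (fbm_cov H (grid t n (Suc i)) r - fbm_cov H (grid t n i) r))"
    unfolding eq using int t
    by (subst Bochner_Integration.integral_sum) (auto simp: integral_cov_kernel[OF H grid_mono])
  also have "\<dots> = step_element t n \<omega> \<bullet> e r"
    unfolding step_element_def inner_sum_left
    using in_T r by (intro sum.cong refl) (auto simp: inner_diff_left inner_e simp del: atLeastAtMost_iff)
  finally show "step_element t n \<omega> \<bullet> e r = (\<integral>u. step_process t n u \<omega> * cov_kernel H r u \<partial>lborel)" ..
qed

text \<open>Along the dyadic grids all errors are summable: the step elements converge almost surely in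
  \<open>\<U>\<close>, the step processes converge almost surely at each time, which yields a jointly measurable
  version, and almost all of their paths converge in mean on \<open>(0, t]\<close>.\<close>

theorem geometric_fbm_restricts_to:
  assumes t: "t \<in> {0..T}"
  obtains h where "restricts_to M H T e geometric_fbm t h"
proof -
  interpret P: pair_sigma_finite lborel M ..
  obtain C where C0: "C \<ge> 0" and C: "\<And>s u. s \<in> {0..T} \<Longrightarrow> u \<in> {0..T} \<Longrightarrow>
      (\<integral>\<omega>. (geometric_fbm s \<omega> - geometric_fbm u \<omega>)\<^sup>2 \<partial>M) \<le> C * \<bar>s - u\<bar>"
    by (rule geometric_fbm_increment) (rule that)
  have t0: "t \<ge> 0" using t by simp
  define h where "h \<omega> = lim (\<lambda>n. step_element t n \<omega>)" for \<omega>
  define X' where "X' u \<omega> = lim (\<lambda>n. step_process t n u \<omega>)" for u \<omega>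
  have [measurable]: "step_element t n \<in> borel_measurable M" for n
    by (rule L2_rvD(1)[OF step_element_L2[OF t]])
  have h_meas [measurable]: "h \<in> borel_measurable M" unfolding h_def by measurable
  have h_lim: "AE \<omega> in M. (\<lambda>n. step_element t n \<omega>) \<longlonglongrightarrow> h \<omega>"
  proof -
    have "AE \<omega> in M. summable (\<lambda>n. norm (step_element t (Suc n) \<omega> - step_element t n \<omega>))"
      by (rule AE_summable_L2[where q = "1 / 2" and C = "C * t * (norm (e t))\<^sup>2"])
         (auto intro!: L2_rv_diff step_element_L2 t step_element_difference C C0 prob_space_axioms
           simp del: atLeastAtMost_iff)
    then show ?thesis unfolding h_def by eventually_elim (rule convergent_of_summable_differences)
  qed
  have h_L2: "L2_rv M h"
    by (rule L2_rv_Fatou[OF step_element_L2[OF t] step_element_norm[OF t] h_meas h_lim])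
  have step_close: "L2_rv M (step_process t n u)"
    "(\<integral>\<omega>. (step_process t n u \<omega> - geometric_fbm u \<omega>)\<^sup>2 \<partial>M) \<le> C * t * (1 / 2) ^ n"
    if u: "u \<in> {0<..t}" for u n
  proof -
    obtain v where v: "v \<in> {0..T}" "\<bar>v - u\<bar> \<le> t * (1 / 2) ^ n" "step_process t n u = geometric_fbm v"
      by (rule step_process_eq[OF t u])
    show "L2_rv M (step_process t n u)" unfolding v(3) by (rule geometric_fbm_L2[OF v(1)])
    have "(\<integral>\<omega>. (step_process t n u \<omega> - geometric_fbm u \<omega>)\<^sup>2 \<partial>M) \<le> C * \<bar>v - u\<bar>"
      unfolding v(3) using u t by (intro C v) auto
    also have "\<dots> \<le> C * (t * (1 / 2) ^ n)" by (intro mult_left_mono v C0)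
    finally show "(\<integral>\<omega>. (step_process t n u \<omega> - geometric_fbm u \<omega>)\<^sup>2 \<partial>M) \<le> C * t * (1 / 2) ^ n"
      by (simp add: mult.assoc)
  qed
  have geo_L2: "L2_rv M (geometric_fbm u)" if "u \<in> {0<..t}" for u
    using that t by (intro geometric_fbm_L2) auto
  have version: "AE \<omega> in M. X' u \<omega> = geometric_fbm u \<omega>" if u: "u \<in> {0<..t}" for u
  proof -
    have "AE \<omega> in M. summable (\<lambda>n. norm (step_process t n u \<omega> - geometric_fbm u \<omega>))"
      by (rule AE_summable_L2[where q = "1 / 2" and C = "C * t"])
         (use step_close[OF u] in \<open>auto intro!: L2_rv_diff geo_L2 u prob_space_axioms simp del: greaterThanAtMost_iff\<close>)
    then show ?thesis
    proof eventually_elim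
      case (elim \<omega>)
      then have "(\<lambda>n. step_process t n u \<omega> - geometric_fbm u \<omega>) \<longlonglongrightarrow> 0"
        by (intro tendsto_norm_zero_cancel[OF summable_LIMSEQ_zero])
      then have "(\<lambda>n. step_process t n u \<omega>) \<longlonglongrightarrow> geometric_fbm u \<omega>" by (simp add: LIM_zero_iff)
      then show ?case by (simp add: X'_def limI)
    qed
  qed
  note [measurable] = step_process_measurable[OF t]
  have X'_meas [measurable]: "(\<lambda>(u, \<omega>). X' u \<omega>) \<in> borel_measurable (lborel \<Otimes>\<^sub>M M)"
    unfolding X'_def by measurable
  have X'_sec [measurable]: "X' u \<in> borel_measurable M" for u
    using measurable_compose[OF measurable_Pair1' X'_meas, of u] by simp
  have X'_L2: "L2_rv M (X' u)" if "u \<in> {0<..t}" for u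
    using version[OF that] by (intro L2_rv_cong_AE[OF geo_L2[OF that]]) (auto elim!: eventually_mono)
  define g where "g u \<omega> = X' u \<omega> * indicator {0<..t} u" for u \<omega>
  have g_meas: "(\<lambda>(u, \<omega>). g u \<omega>) \<in> borel_measurable (lborel \<Otimes>\<^sub>M M)"
    unfolding g_def by measurable
  have g_int: "integrable (lborel \<Otimes>\<^sub>M M) (\<lambda>(u, \<omega>). g u \<omega>)"
  proof (rule integrable_strip(1)[OF g_meas])
    fix u assume u: "u \<in> {0<..t}"
    then have gu: "g u = X' u" by (auto simp: g_def)
    show "integrable M (g u)" unfolding gu by (rule L2_integrable[OF finite_measure_axioms X'_L2[OF u]])
    have "(\<integral>\<omega>. \<bar>X' u \<omega>\<bar> \<partial>M) \<le> sqrt (\<integral>\<omega>. (X' u \<omega>)\<^sup>2 \<partial>M)"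
      using L1_le_L2[OF prob_space_axioms X'_L2[OF u]] by simp
    also have "(\<integral>\<omega>. (X' u \<omega>)\<^sup>2 \<partial>M) = (\<integral>\<omega>. (geometric_fbm u \<omega>)\<^sup>2 \<partial>M)"
      using version[OF u] L2_rvD(1)[OF geo_L2[OF u]]
      by (intro integral_cong_AE) (auto elim!: eventually_mono)
    also have "sqrt \<dots> \<le> sqrt (exp (T powr (2 * H)))"
      using u t by (intro real_sqrt_le_mono geometric_fbm_second_moment) auto
    finally show "(\<integral>\<omega>. \<bar>g u \<omega>\<bar> \<partial>M) \<le> sqrt (exp (T powr (2 * H)))" by (simp add: gu)
  qed (auto simp: g_def t0)
  define G where "G n u \<omega> = step_process t n u \<omega> - g u \<omega>" for n u \<omega>
  have G: "integrable (lborel \<Otimes>\<^sub>M M) (\<lambda>(u, \<omega>). G n u \<omega>)"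
    "(\<integral>\<omega>. (\<integral>u. \<bar>G n u \<omega>\<bar> \<partial>lborel) \<partial>M) \<le> sqrt (C * t) * sqrt (1 / 2) ^ n * t" for n
  proof -
    have meas: "(\<lambda>(u, \<omega>). G n u \<omega>) \<in> borel_measurable (lborel \<Otimes>\<^sub>M M)"
      unfolding G_def g_def by measurable
    have out: "G n u \<omega> = 0" if "u \<notin> {0<..t}" for u \<omega>
      using step_process_outside[OF t that] that by (simp add: G_def g_def)
    have L2: "L2_rv M (G n u)" and bound: "(\<integral>\<omega>. \<bar>G n u \<omega>\<bar> \<partial>M) \<le> sqrt (C * t) * sqrt (1 / 2) ^ n"
      if u: "u \<in> {0<..t}" for u
    proof -
      have Gu: "G n u = (\<lambda>\<omega>. step_process t n u \<omega> - X' u \<omega>)" using u by (auto simp: G_def g_def)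
      show L2: "L2_rv M (G n u)" unfolding Gu by (intro L2_rv_diff step_close X'_L2 u)
      have "(\<integral>\<omega>. \<bar>G n u \<omega>\<bar> \<partial>M) \<le> sqrt (\<integral>\<omega>. (G n u \<omega>)\<^sup>2 \<partial>M)"
        using L1_le_L2[OF prob_space_axioms L2] by simp
      also have "(\<integral>\<omega>. (G n u \<omega>)\<^sup>2 \<partial>M) = (\<integral>\<omega>. (step_process t n u \<omega> - geometric_fbm u \<omega>)\<^sup>2 \<partial>M)"
        unfolding Gu using version[OF u] L2_rvD(1)[OF geo_L2[OF u]] L2_rvD(1)[OF step_close(1)[OF u]]
        by (intro integral_cong_AE) (auto elim!: eventually_mono)
      also have "sqrt \<dots> \<le> sqrt (C * t * (1 / 2) ^ n)" by (intro real_sqrt_le_mono step_close u)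
      finally show "(\<integral>\<omega>. \<bar>G n u \<omega>\<bar> \<partial>M) \<le> sqrt (C * t) * sqrt (1 / 2) ^ n"
        by (simp add: real_sqrt_mult real_sqrt_power)
    qed
    have nonneg: "sqrt (C * t) * sqrt (1 / 2) ^ n \<ge> 0" using C0 t0 by simp
    note strip = integrable_strip[OF meas out L2_integrable[OF finite_measure_axioms L2] bound nonneg t0]
    show "integrable (lborel \<Otimes>\<^sub>M M) (\<lambda>(u, \<omega>). G n u \<omega>)" by (rule strip(1))
    show "(\<integral>\<omega>. (\<integral>u. \<bar>G n u \<omega>\<bar> \<partial>lborel) \<partial>M) \<le> sqrt (C * t) * sqrt (1 / 2) ^ n * t" by (rule strip(2))
  qed
  have G_abs: "integrable (lborel \<Otimes>\<^sub>M M) (\<lambda>(u, \<omega>). \<bar>G n u \<omega>\<bar>)" for n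
    using integrable_abs[OF G(1)] by (simp add: case_prod_beta')
  have "AE \<omega> in M. summable (\<lambda>n. norm (\<integral>u. \<bar>G n u \<omega>\<bar> \<partial>lborel))"
  proof (rule AE_summable_norm)
    show "integrable M (\<lambda>\<omega>. \<integral>u. \<bar>G n u \<omega>\<bar> \<partial>lborel)" for n by (rule P.integrable_snd[OF G_abs])
    have "sqrt (1 / 2) < (1 :: real)" by (simp add: real_sqrt_lt_1_iff)
    then show "summable (\<lambda>n. sqrt (C * t) * sqrt (1 / 2) ^ n * t)"
      by (intro summable_mult2 summable_mult summable_geometric) auto
    show "(\<integral>\<omega>. norm (\<integral>u. \<bar>G n u \<omega>\<bar> \<partial>lborel) \<partial>M) \<le> sqrt (C * t) * sqrt (1 / 2) ^ n * t" for n
      using G(2)[of n] by simp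
  qed
  then have mean_conv: "AE \<omega> in M. (\<lambda>n. \<integral>u. \<bar>G n u \<omega>\<bar> \<partial>lborel) \<longlonglongrightarrow> 0"
  proof eventually_elim
    case (elim \<omega>)
    then show ?case by (intro tendsto_norm_zero_cancel[OF summable_LIMSEQ_zero])
  qed
  have G_sec: "AE \<omega> in M. \<forall>n. integrable lborel (\<lambda>u. G n u \<omega>)"
    unfolding AE_all_countable using P.AE_integrable_snd[OF G(1)] by blast
  have inner: "AE \<omega> in M. \<forall>r\<in>{0..T}. h \<omega> \<bullet> e r = U_inner H T (\<lambda>u. g u \<omega>) (indicator {0<..r})"
    using h_lim mean_conv G_sec
  proof eventually_elim
    case (elim \<omega>)
    show ?case
    proof
      fix r assume r: "r \<in> {0..T}"
      define K where "K = 2 * H * T powr (2 * H - 1)"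
      have kernel: "\<bar>indicator {0..T} u * cov_kernel H r u\<bar> \<le> K" for u
        using abs_cov_kernel_le[OF H r, of u] H by (auto simp: indicator_def K_def)
      have [measurable]: "cov_kernel H r \<in> borel_measurable borel" by (rule cov_kernel_measurable[OF H])
      have int_G: "integrable lborel (\<lambda>u. G n u \<omega> * (indicator {0..T} u * cov_kernel H r u))" for n
        using elim(3) kernel by (intro integrable_mult_bounded[where C = K]) auto
      have supp: "step_process t n u \<omega> * cov_kernel H r u =
          step_process t n u \<omega> * (indicator {0..T} u * cov_kernel H r u)" for n u
        using step_process_outside[OF t, of u n \<omega>] t by (cases "u \<in> {0<..t}") (auto simp: indicator_def)
      have "\<bar>step_element t n \<omega> \<bullet> e r - U_inner H T (\<lambda>u. g u \<omega>) (indicator {0<..r})\<bar> \<le>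
          K * (\<integral>u. \<bar>G n u \<omega>\<bar> \<partial>lborel)" for n
      proof -
        have "(\<integral>u. g u \<omega> * (indicator {0..T} u * cov_kernel H r u) \<partial>lborel) =
            (\<integral>u. step_process t n u \<omega> * cov_kernel H r u - G n u \<omega> * (indicator {0..T} u * cov_kernel H r u) \<partial>lborel)"
          unfolding supp by (simp add: G_def algebra_simps)
        also have "\<dots> = step_element t n \<omega> \<bullet> e r - (\<integral>u. G n u \<omega> * (indicator {0..T} u * cov_kernel H r u) \<partial>lborel)"
          using integral_step_process[OF t r] int_G by simp
        finally have "step_element t n \<omega> \<bullet> e r - U_inner H T (\<lambda>u. g u \<omega>) (indicator {0<..r}) =
            (\<integral>u. G n u \<omega> * (indicator {0..T} u * cov_kernel H r u) \<partial>lborel)"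
          by (simp add: U_inner_indicator[OF H r] mult_ac)
        also have "\<bar>\<dots>\<bar> \<le> (\<integral>u. K * \<bar>G n u \<omega>\<bar> \<partial>lborel)"
        proof (rule order_trans[OF integral_abs_bound], rule integral_mono)
          show "\<bar>G n u \<omega> * (indicator {0..T} u * cov_kernel H r u)\<bar> \<le> K * \<bar>G n u \<omega>\<bar>" for u
            unfolding abs_mult[of "G n u \<omega>"] mult.commute[of K] by (rule mult_left_mono[OF kernel]) simp
        qed (use int_G elim(3) in auto)
        finally show ?thesis by simp
      qed
      then have "\<forall>\<^sub>F n in sequentially.
          norm (step_element t n \<omega> \<bullet> e r - U_inner H T (\<lambda>u. g u \<omega>) (indicator {0<..r})) \<le>
          K * (\<integral>u. \<bar>G n u \<omega>\<bar> \<partial>lborel)" by (intro always_eventually allI) simp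
      then have "(\<lambda>n. step_element t n \<omega> \<bullet> e r - U_inner H T (\<lambda>u. g u \<omega>) (indicator {0<..r})) \<longlonglongrightarrow> 0"
        by (rule Lim_null_comparison) (rule tendsto_mult_right_zero[OF elim(2)])
      then have "(\<lambda>n. step_element t n \<omega> \<bullet> e r) \<longlonglongrightarrow> U_inner H T (\<lambda>u. g u \<omega>) (indicator {0<..r})"
        by (simp add: LIM_zero_iff)
      moreover have "(\<lambda>n. step_element t n \<omega> \<bullet> e r) \<longlonglongrightarrow> h \<omega> \<bullet> e r"
        by (intro tendsto_inner elim(1) tendsto_const)
      ultimately show "h \<omega> \<bullet> e r = U_inner H T (\<lambda>u. g u \<omega>) (indicator {0<..r})"
        using LIMSEQ_unique by blast
    qed
  qed
  have "restricts_to M H T e geometric_fbm t h"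
    unfolding restricts_to_def
  proof (intro conjI exI[of _ X'])
    show "AE u in lborel. u \<in> {0<..t} \<longrightarrow> (AE \<omega> in M. X' u \<omega> = geometric_fbm u \<omega>)"
      using version by auto
  qed (use h_L2 g_int inner in \<open>auto simp: g_def\<close>)
  then show thesis by (rule that)
qed

end

section \<open>Existence\<close>

text \<open>For \<open>\<epsilon> > 0\<close> the function \<open>1 / (exp (- x) + \<epsilon>)\<close> is a smooth cut-off of the exponential: it lies
  below \<open>exp x\<close> and increases to it as \<open>\<epsilon>\<close> decreases to \<open>0\<close>. Since \<open>s' = s - \<epsilon> s\<^sup>2\<close>, all its derivatives
  are polynomials in the bounded function \<open>s\<close> itself.\<close>

definition exp_cutoff :: "real \<Rightarrow> real \<Rightarrow> real" where
  "exp_cutoff \<epsilon> x = 1 / (exp (- x) + \<epsilon>)"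

text \<open>These polynomials in \<open>s\<close> represent the derivatives of \<open>a s - 1\<close>, the cut-off of \<open>a exp x - 1\<close>.\<close>

fun cutoff_poly :: "real \<Rightarrow> real \<Rightarrow> nat \<Rightarrow> real poly" where
  "cutoff_poly \<epsilon> a 0 = [:-1, a:]"
| "cutoff_poly \<epsilon> a (Suc k) = pderiv (cutoff_poly \<epsilon> a k) * [:0, 1, - \<epsilon>:]"

lemma exp_cutoff_bounds:
  assumes "\<epsilon> > 0"
  shows "0 < exp_cutoff \<epsilon> x" "exp_cutoff \<epsilon> x \<le> 1 / \<epsilon>" "exp_cutoff \<epsilon> x \<le> exp x"
proof -
  show "0 < exp_cutoff \<epsilon> x" using assms by (simp add: exp_cutoff_def add_pos_pos)
  show "exp_cutoff \<epsilon> x \<le> 1 / \<epsilon>"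
    unfolding exp_cutoff_def using assms by (intro divide_left_mono) (auto simp: add_pos_pos)
  have "exp_cutoff \<epsilon> x \<le> 1 / exp (- x)"
    unfolding exp_cutoff_def using assms by (intro divide_left_mono) (auto simp: add_pos_pos)
  then show "exp_cutoff \<epsilon> x \<le> exp x" by (simp add: exp_minus field_simps)
qed

lemma DERIV_exp_cutoff:
  assumes "\<epsilon> > 0"
  shows "(exp_cutoff \<epsilon> has_real_derivative exp_cutoff \<epsilon> x - \<epsilon> * (exp_cutoff \<epsilon> x)\<^sup>2) (at x)"
proof -
  have pos: "exp (- x) + \<epsilon> > 0" using assms by (simp add: add_pos_pos)
  have "((\<lambda>x. 1 / (exp (- x) + \<epsilon>)) has_real_derivative exp (- x) / (exp (- x) + \<epsilon>)\<^sup>2) (at x)"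
    using pos by (auto intro!: derivative_eq_intros simp: power2_eq_square)
  moreover have "exp (- x) / (exp (- x) + \<epsilon>)\<^sup>2 = exp_cutoff \<epsilon> x - \<epsilon> * (exp_cutoff \<epsilon> x)\<^sup>2"
  proof -
    have "exp (- x) / (exp (- x) + \<epsilon>)\<^sup>2 = ((exp (- x) + \<epsilon>) - \<epsilon>) / (exp (- x) + \<epsilon>)\<^sup>2" by simp
    also have "\<dots> = 1 / (exp (- x) + \<epsilon>) - \<epsilon> * (1 / (exp (- x) + \<epsilon>))\<^sup>2"
      using pos by (simp only: diff_divide_distrib) (simp add: power2_eq_square)
    finally show ?thesis by (simp add: exp_cutoff_def)
  qed
  ultimately show ?thesis by (simp add: exp_cutoff_def[abs_def])
qed

lemma
  assumes "\<epsilon> > 0"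
  shows DERIV_cutoff_poly: "((\<lambda>x. poly (cutoff_poly \<epsilon> a k) (exp_cutoff \<epsilon> x)) has_real_derivative
      poly (cutoff_poly \<epsilon> a (Suc k)) (exp_cutoff \<epsilon> x)) (at x)"
    and bounded_cutoff_poly: "bounded (range (\<lambda>x. poly (cutoff_poly \<epsilon> a k) (exp_cutoff \<epsilon> x)))"
proof -
  have "((\<lambda>x. poly (cutoff_poly \<epsilon> a k) (exp_cutoff \<epsilon> x)) has_real_derivative
      poly (pderiv (cutoff_poly \<epsilon> a k)) (exp_cutoff \<epsilon> x) * (exp_cutoff \<epsilon> x - \<epsilon> * (exp_cutoff \<epsilon> x)\<^sup>2)) (at x)"
    by (rule DERIV_chain2[OF poly_DERIV DERIV_exp_cutoff[OF assms]])
  then show "((\<lambda>x. poly (cutoff_poly \<epsilon> a k) (exp_cutoff \<epsilon> x)) has_real_derivative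
      poly (cutoff_poly \<epsilon> a (Suc k)) (exp_cutoff \<epsilon> x)) (at x)"
    by (simp add: power2_eq_square algebra_simps)
  have "bounded (poly (cutoff_poly \<epsilon> a k) ` {0..1 / \<epsilon>})"
    by (intro compact_imp_bounded compact_continuous_image continuous_intros) auto
  then show "bounded (range (\<lambda>x. poly (cutoff_poly \<epsilon> a k) (exp_cutoff \<epsilon> x)))"
  proof (rule bounded_subset)
    have "exp_cutoff \<epsilon> x \<in> {0..1 / \<epsilon>}" for x
      using exp_cutoff_bounds(1,2)[OF assms, of x] by simp
    then show "range (\<lambda>x. poly (cutoff_poly \<epsilon> a k) (exp_cutoff \<epsilon> x)) \<subseteq>
        poly (cutoff_poly \<epsilon> a k) ` {0..1 / \<epsilon>}" by blast
  qed
qed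

context fbm_space
begin

lemma malliavin_single:
  assumes der: "\<And>k x. (G k has_real_derivative G (Suc k) x) (at x)"
    and bd: "\<And>k. bounded (range (G (Suc k)))"
    and el: "elementary w k W"
  shows "malliavin M B T e (\<lambda>\<omega>. G 0 (W \<omega>)) (\<lambda>\<omega>. G 1 (W \<omega>) *\<^sub>R w)"
proof -
  have smooth: "smooth_bounded_partials 1 (\<lambda>x. G 0 (x 0))"
    by (rule smooth_bounded_partials_single[of G, OF der bd])
  have sm: "smooth_malliavin M B T e (\<lambda>\<omega>. G 0 (W \<omega>)) (\<lambda>\<omega>. G 1 (W \<omega>) *\<^sub>R w)"
    unfolding smooth_malliavin_def
    by (intro exI[of _ 1] conjI exI[of _ "\<lambda>x. G 0 (x 0)"] exI[of _ "\<lambda>_. w"] exI[of _ "\<lambda>_. W"])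
       (use smooth wiener_integral_elementary[OF el] partial_deriv_single[of G, OF der bd] in auto)
  obtain C where "lipschitz_coords 1 C (\<lambda>x. G 0 (x 0))"
    by (rule smooth_bounded_partialsD[OF smooth]) (rule that)
  from lipschitz_L2[OF finite_measure_axioms this, of "\<lambda>_. W"]
  have L2: "L2_rv M (\<lambda>\<omega>. G 0 (W \<omega>))" using elementary_L2[OF el] by simp
  obtain K where K: "\<And>x. \<bar>G (Suc 0) x\<bar> \<le> K" using bd[of 0] by (auto simp: bounded_iff)
  have cont: "continuous_on UNIV (G (Suc 0))"
    using der by (auto intro!: continuous_at_imp_continuous_on DERIV_isCont)
  have meas: "(\<lambda>\<omega>. G (Suc 0) (W \<omega>)) \<in> borel_measurable M"
    by (rule measurable_compose[OF elementary_measurable[OF el] borel_measurable_continuous_onI[OF cont]])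
  have L2': "L2_rv M (\<lambda>\<omega>. G 1 (W \<omega>) *\<^sub>R w)"
    using L2_rv_bounded_mult[OF meas K L2_rv_const[OF finite_measure_axioms, of w]] by simp
  show ?thesis
    unfolding malliavin_def
    by (intro exI[of _ "\<lambda>_ \<omega>. G 0 (W \<omega>)"] exI[of _ "\<lambda>_ \<omega>. G 1 (W \<omega>) *\<^sub>R w"])
       (use sm L2 L2' in \<open>auto simp: L2_tendsto_def\<close>)
qed

lemma geometric_fbm_in_closure:
  assumes t: "t \<in> {0..T}"
  shows "\<exists>F G. (\<forall>k. malliavin M B T e (F k) (G k)) \<and> L2_tendsto M F (\<lambda>\<omega>. geometric_fbm t \<omega> - 1)"
proof -
  define a where "a = exp (- (norm (e t))\<^sup>2 / 2)"
  define \<epsilon> where "\<epsilon> k = 1 / real (Suc k)" for k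
  define F where "F k \<omega> = a * exp_cutoff (\<epsilon> k) (B t \<omega>) - 1" for k \<omega>
  have \<epsilon>: "\<epsilon> k > 0" for k by (simp add: \<epsilon>_def)
  have a: "a > 0" by (simp add: a_def)
  have B [measurable]: "B t \<in> borel_measurable M" using t by auto
  have mall: "\<exists>G. malliavin M B T e (F k) G" for k
  proof -
    have "F k = (\<lambda>\<omega>. poly (cutoff_poly (\<epsilon> k) a 0) (exp_cutoff (\<epsilon> k) (B t \<omega>)))"
      by (auto simp: F_def)
    then show ?thesis
      using malliavin_single[where G = "\<lambda>j x. poly (cutoff_poly (\<epsilon> k) a j) (exp_cutoff (\<epsilon> k) x)",
          OF DERIV_cutoff_poly[OF \<epsilon>] bounded_cutoff_poly[OF \<epsilon>] elementary_e[OF t]] by auto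
  qed
  then obtain G where G: "\<And>k. malliavin M B T e (F k) (G k)" by metis
  have F_L2: "L2_rv M (F k)" for k using G[of k] by (auto simp: malliavin_def L2_tendsto_def)
  have F_meas [measurable]: "F k \<in> borel_measurable M" for k using L2_rvD(1)[OF F_L2] .
  have geo: "L2_rv M (\<lambda>\<omega>. geometric_fbm t \<omega> - 1)"
    by (intro L2_rv_diff L2_rv_const geometric_fbm_L2 t finite_measure_axioms)
  have diff: "F k \<omega> - (geometric_fbm t \<omega> - 1) = a * (exp_cutoff (\<epsilon> k) (B t \<omega>) - exp (B t \<omega>))" for k \<omega>
    by (simp add: F_def geometric_fbm_alt[OF t] a_def algebra_simps)
  have "(\<lambda>k. \<integral>\<omega>. (norm (F k \<omega> - (geometric_fbm t \<omega> - 1)))\<^sup>2 \<partial>M) \<longlonglongrightarrow> (\<integral>\<omega>. 0 \<partial>M)"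
  proof (rule integral_dominated_convergence)
    show "integrable M (\<lambda>\<omega>. (geometric_fbm t \<omega>)\<^sup>2)" using L2_rvD(2)[OF geometric_fbm_L2[OF t]] by simp
    show "AE \<omega> in M. (\<lambda>k. (norm (F k \<omega> - (geometric_fbm t \<omega> - 1)))\<^sup>2) \<longlonglongrightarrow> 0"
    proof (rule AE_I2)
      fix \<omega>
      have "\<epsilon> \<longlonglongrightarrow> 0" unfolding \<epsilon>_def using LIMSEQ_inverse_real_of_nat by (simp add: inverse_eq_divide)
      then have "(\<lambda>k. exp_cutoff (\<epsilon> k) (B t \<omega>)) \<longlonglongrightarrow> 1 / (exp (- B t \<omega>) + 0)"
        unfolding exp_cutoff_def by (intro tendsto_intros) auto
      then have "(\<lambda>k. exp_cutoff (\<epsilon> k) (B t \<omega>)) \<longlonglongrightarrow> exp (B t \<omega>)" by (simp add: exp_minus divide_inverse)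
      then have "(\<lambda>k. (norm (a * (exp_cutoff (\<epsilon> k) (B t \<omega>) - exp (B t \<omega>))))\<^sup>2) \<longlonglongrightarrow>
          (norm (a * (exp (B t \<omega>) - exp (B t \<omega>))))\<^sup>2"
        by (intro tendsto_intros)
      then show "(\<lambda>k. (norm (F k \<omega> - (geometric_fbm t \<omega> - 1)))\<^sup>2) \<longlonglongrightarrow> 0" by (simp add: diff)
    qed
    show "AE \<omega> in M. norm ((norm (F k \<omega> - (geometric_fbm t \<omega> - 1)))\<^sup>2) \<le> (geometric_fbm t \<omega>)\<^sup>2" for k
    proof (rule AE_I2)
      fix \<omega>
      have "\<bar>exp_cutoff (\<epsilon> k) (B t \<omega>) - exp (B t \<omega>)\<bar> \<le> exp (B t \<omega>)"
        using exp_cutoff_bounds[OF \<epsilon>, of k "B t \<omega>"] by linarith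
      then have "a * \<bar>exp_cutoff (\<epsilon> k) (B t \<omega>) - exp (B t \<omega>)\<bar> \<le> geometric_fbm t \<omega>"
        using a by (simp add: geometric_fbm_alt[OF t] a_def)
      then have "\<bar>F k \<omega> - (geometric_fbm t \<omega> - 1)\<bar>\<^sup>2 \<le> (geometric_fbm t \<omega>)\<^sup>2"
        unfolding diff using a by (intro power_mono) (auto simp: abs_mult)
      then show "norm ((norm (F k \<omega> - (geometric_fbm t \<omega> - 1)))\<^sup>2) \<le> (geometric_fbm t \<omega>)\<^sup>2" by simp
    qed
  qed (use L2_rvD(1)[OF geo] in auto)
  then have "L2_tendsto M F (\<lambda>\<omega>. geometric_fbm t \<omega> - 1)"
    using F_L2 geo by (simp add: L2_tendsto_def)
  then show ?thesis using G by blast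
qed

theorem geometric_fbm_is_solution: "is_solution M H B T e geometric_fbm"
  unfolding is_solution_def
proof (intro ballI conjI)
  fix t assume t: "t \<in> {0..T}"
  show "geometric_fbm t \<in> borel_measurable M" by (rule geometric_fbm_measurable[OF t])
  obtain h where h: "restricts_to M H T e geometric_fbm t h" by (rule geometric_fbm_restricts_to[OF t])
  have "has_divergence M B T e h (\<lambda>\<omega>. geometric_fbm t \<omega> - 1)"
    unfolding has_divergence_def
  proof (intro conjI allI impI)
    show "L2_rv M h" using h by (simp add: restricts_to_def)
    show "L2_rv M (\<lambda>\<omega>. geometric_fbm t \<omega> - 1)"
      by (intro L2_rv_diff L2_rv_const geometric_fbm_L2 t finite_measure_axioms)
    show "\<exists>F G. (\<forall>k. malliavin M B T e (F k) (G k)) \<and> L2_tendsto M F (\<lambda>\<omega>. geometric_fbm t \<omega> - 1)"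
      by (rule geometric_fbm_in_closure[OF t])
    show "(\<integral>\<omega>. F \<omega> * (geometric_fbm t \<omega> - 1) \<partial>M) = (\<integral>\<omega>. G \<omega> \<bullet> h \<omega> \<partial>M)"
      if "malliavin M B T e F G" for F G
      by (rule malliavin_duality[OF that t h])
  qed
  then show "\<exists>Y. has_divergence_integral M H B T e geometric_fbm t Y \<and> (AE \<omega> in M. geometric_fbm t \<omega> = 1 + Y \<omega>)"
    using h unfolding has_divergence_integral_def
    by (intro exI[of _ "\<lambda>\<omega>. geometric_fbm t \<omega> - 1"]) auto
qed

section \<open>Uniqueness\<close>

lemma solutionE:
  assumes "is_solution M H B T e X" "t \<in> {0..T}"
  obtains Y h where "restricts_to M H T e X t h" "has_divergence M B T e h Y"
    "AE \<omega> in M. X t \<omega> = 1 + Y \<omega>" "X t \<in> borel_measurable M"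
  using assms unfolding is_solution_def has_divergence_integral_def by blast

lemma solution_L2:
  assumes "is_solution M H B T e X" "t \<in> {0..T}"
  shows "L2_rv M (X t)"
proof -
  obtain Y h where Y: "has_divergence M B T e h Y" "AE \<omega> in M. X t \<omega> = 1 + Y \<omega>"
    and X: "X t \<in> borel_measurable M"
    by (rule solutionE[OF assms])
  have "L2_rv M Y" using Y(1) by (simp add: has_divergence_def)
  then have "L2_rv M (\<lambda>\<omega>. 1 + Y \<omega>)" by (intro L2_rv_add L2_rv_const finite_measure_axioms)
  then show ?thesis by (rule L2_rv_cong_AE[OF _ X]) (use Y(2) in \<open>auto elim!: eventually_mono\<close>)
qed

text \<open>Testing the equation with the waves \<open>cos (W + \<theta>)\<close>, whose Malliavin derivatives are phase-shifted
  waves times \<open>w\<close>, leads to an integral equation without stochastic integrals.\<close>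

lemma solution_wave_equation:
  assumes X: "is_solution M H B T e X" and t: "t \<in> {0..T}" and el: "elementary w k W"
  shows "((\<lambda>u. (\<integral>\<omega>. cos (W \<omega> + (\<theta> + pi / 2)) * X u \<omega> \<partial>M) * k u) has_integral
    (\<integral>\<omega>. cos (W \<omega> + \<theta>) * X t \<omega> \<partial>M) - (\<integral>\<omega>. cos (W \<omega> + \<theta>) \<partial>M)) {0..t}"
proof -
  note [measurable] = elementary_measurable[OF el]
  obtain Y h where h: "restricts_to M H T e X t h" and Y: "has_divergence M B T e h Y"
    and XY: "AE \<omega> in M. X t \<omega> = 1 + Y \<omega>" and Xt [measurable]: "X t \<in> borel_measurable M"
    by (rule solutionE[OF X t])
  have Y_L2: "L2_rv M Y" using Y by (simp add: has_divergence_def)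
  note [measurable] = L2_rvD(1)[OF Y_L2]
  define G where "G j x = cos (x + (\<theta> + real j * (pi / 2)))" for j x
  have "malliavin M B T e (\<lambda>\<omega>. G 0 (W \<omega>)) (\<lambda>\<omega>. G 1 (W \<omega>) *\<^sub>R w)"
  proof (rule malliavin_single[OF _ _ el])
    fix j x
    have "G (Suc j) x = - sin (x + (\<theta> + real j * (pi / 2)))"
      unfolding G_def using cos_add[of "x + (\<theta> + real j * (pi / 2))" "pi / 2"]
      by (simp add: algebra_simps add_divide_distrib)
    moreover have "((\<lambda>x. cos (x + (\<theta> + real j * (pi / 2)))) has_real_derivative - sin (x + (\<theta> + real j * (pi / 2)))) (at x)"
      by (auto intro!: derivative_eq_intros)
    ultimately show "(G j has_real_derivative G (Suc j) x) (at x)" by (simp add: G_def[abs_def])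
    show "bounded (range (G (Suc j)))" for j by (auto simp: bounded_iff G_def intro!: exI[of _ 1])
  qed
  then have "(\<integral>\<omega>. cos (W \<omega> + \<theta>) * Y \<omega> \<partial>M) = (\<integral>\<omega>. cos (W \<omega> + (\<theta> + pi / 2)) * (w \<bullet> h \<omega>) \<partial>M)"
    using Y by (simp add: has_divergence_def G_def)
  moreover have "(\<integral>\<omega>. cos (W \<omega> + \<theta>) * Y \<omega> \<partial>M) = (\<integral>\<omega>. cos (W \<omega> + \<theta>) * X t \<omega> \<partial>M) - (\<integral>\<omega>. cos (W \<omega> + \<theta>) \<partial>M)"
  proof -
    have cosL2: "L2_rv M (\<lambda>\<omega>. cos (W \<omega> + \<theta>))"
      by (rule L2_rv_bounded[OF finite_measure_axioms, where C = 1]) auto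
    have "(\<integral>\<omega>. cos (W \<omega> + \<theta>) * X t \<omega> \<partial>M) = (\<integral>\<omega>. cos (W \<omega> + \<theta>) * (1 + Y \<omega>) \<partial>M)"
      using XY by (intro integral_cong_AE) (auto elim!: eventually_mono)
    also have "\<dots> = (\<integral>\<omega>. cos (W \<omega> + \<theta>) \<partial>M) + (\<integral>\<omega>. cos (W \<omega> + \<theta>) * Y \<omega> \<partial>M)"
      using L2_integrable[OF finite_measure_axioms cosL2] L2_integrable_mult[OF cosL2 Y_L2]
      by (simp add: distrib_left)
    finally show ?thesis by simp
  qed
  moreover have "((\<lambda>u. (\<integral>\<omega>. cos (W \<omega> + (\<theta> + pi / 2)) * X u \<omega> \<partial>M) * k u) has_integral
      (\<integral>\<omega>. cos (W \<omega> + (\<theta> + pi / 2)) * (w \<bullet> h \<omega>) \<partial>M)) {0..t}"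
    by (rule restricts_to_has_integral[OF h t el, where C = 1])
       (use X in \<open>auto simp: is_solution_def\<close>)
  ultimately show ?thesis by simp
qed

text \<open>The difference of two solutions has no wave component: the pair formed by its cosine and sine
  coefficient starts at \<open>0\<close>, and the integral equation says that it is merely rotated as time
  passes.\<close>

lemma solution_difference_wave:
  assumes X: "is_solution M H B T e X" and Y: "is_solution M H B T e Y" and t: "t \<in> {0..T}"
    and el: "elementary w k W"
  shows "(\<integral>\<omega>. cos (W \<omega> + \<theta>) * (X t \<omega> - Y t \<omega>) \<partial>M) = 0"
proof -
  note [measurable] = elementary_measurable[OF el]
  define c where "c \<eta> t = (\<integral>\<omega>. cos (W \<omega> + \<eta>) * (X t \<omega> - Y t \<omega>) \<partial>M)" for \<eta> t
  have cosL2: "L2_rv M (\<lambda>\<omega>. cos (W \<omega> + \<eta>))" for \<eta>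
    by (rule L2_rv_bounded[OF finite_measure_axioms, where C = 1]) auto
  have c_diff: "c \<eta> t = (\<integral>\<omega>. cos (W \<omega> + \<eta>) * X t \<omega> \<partial>M) - (\<integral>\<omega>. cos (W \<omega> + \<eta>) * Y t \<omega> \<partial>M)"
    if "t \<in> {0..T}" for \<eta> t
    using L2_integrable_mult[OF cosL2 solution_L2[OF X that]] L2_integrable_mult[OF cosL2 solution_L2[OF Y that]]
    by (simp add: c_def right_diff_distrib)
  have eq: "((\<lambda>u. c (\<eta> + pi / 2) u * k u) has_integral c \<eta> t) {0..t}" if t: "t \<in> {0..T}" for \<eta> t
  proof -
    have "((\<lambda>u. (\<integral>\<omega>. cos (W \<omega> + (\<eta> + pi / 2)) * X u \<omega> \<partial>M) * k u - (\<integral>\<omega>. cos (W \<omega> + (\<eta> + pi / 2)) * Y u \<omega> \<partial>M) * k u)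
        has_integral c \<eta> t) {0..t}"
      using has_integral_diff[OF solution_wave_equation[OF X t el] solution_wave_equation[OF Y t el], of \<eta> \<eta>]
      by (simp add: c_diff[OF t])
    then show ?thesis
      by (rule has_integral_eq[rotated]) (use t in \<open>auto simp: c_diff left_diff_distrib\<close>)
  qed
  have cont: "continuous_on {0..T} (c \<eta>)" for \<eta>
  proof -
    have "continuous_on {0..T} (\<lambda>t. integral {0..t} (\<lambda>u. c (\<eta> + pi / 2) u * k u))"
      by (rule indefinite_integral_continuous_1) (use eq[of T \<eta>] T in auto)
    then show ?thesis
      by (rule continuous_on_eq) (rule integral_unique[OF eq])
  qed
  have der: "(c \<eta> has_real_derivative c (\<eta> + pi / 2) t * k t) (at t within {0..T})" if t: "t \<in> {0..T}" for \<eta> t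
  proof -
    have "((\<lambda>t. integral {0..t} (\<lambda>u. c (\<eta> + pi / 2) u * k u)) has_real_derivative c (\<eta> + pi / 2) t * k t)
        (at t within {0..T})"
      by (rule integral_has_real_derivative[OF _ t])
         (intro continuous_on_mult cont elementary_kernel_continuous[OF el])
    then show ?thesis
      by (rule has_field_derivative_transform_within[OF _ zero_less_one t]) (rule integral_unique[OF eq])
  qed
  have shift: "c (\<eta> + pi / 2 + pi / 2) t = - c \<eta> t" for \<eta> t
  proof -
    have "cos (x + (\<eta> + pi / 2 + pi / 2)) = - cos (x + \<eta>)" for x
      using cos_periodic_pi[of "x + \<eta>"] by (simp add: add.assoc)
    then show ?thesis by (simp add: c_def)
  qed
  have const: "\<exists>m. \<forall>t\<in>{0..T}. (c \<theta> t)\<^sup>2 + (c (\<theta> + pi / 2) t)\<^sup>2 = m"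
  proof (rule has_field_derivative_zero_constant)
    fix t assume t: "t \<in> {0..T}"
    have "((\<lambda>t. (c \<theta> t)\<^sup>2 + (c (\<theta> + pi / 2) t)\<^sup>2) has_real_derivative
        2 * c \<theta> t * (c (\<theta> + pi / 2) t * k t) + 2 * c (\<theta> + pi / 2) t * (c (\<theta> + pi / 2 + pi / 2) t * k t))
        (at t within {0..T})"
      by (intro DERIV_add) (auto intro!: derivative_eq_intros der t)
    then show "((\<lambda>t. (c \<theta> t)\<^sup>2 + (c (\<theta> + pi / 2) t)\<^sup>2) has_field_derivative 0) (at t within {0..T})"
      unfolding shift by (simp add: algebra_simps)
  qed simp
  have zero: "c \<eta> 0 = 0" for \<eta>
  proof -
    have "((\<lambda>u. c (\<eta> + pi / 2) u * k u) has_integral c \<eta> 0) {0}" using eq[of 0 \<eta>] T by simp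
    then show ?thesis by (rule has_integral_unique[OF _ has_integral_refl(2)])
  qed
  have "(c \<theta> t)\<^sup>2 + (c (\<theta> + pi / 2) t)\<^sup>2 = (c \<theta> 0)\<^sup>2 + (c (\<theta> + pi / 2) 0)\<^sup>2"
    using const t T by (metis atLeastAtMost_iff less_imp_le order_refl)
  then have "(c \<theta> t)\<^sup>2 + (c (\<theta> + pi / 2) t)\<^sup>2 = 0" by (simp add: zero)
  then show ?thesis by (simp add: c_def)
qed

text \<open>Without wave components, \<open>Z\<close> and the weight \<open>0\<close> give the same weighted law to every vector of
  elementary Wiener integrals; limits carry this over to smooth random variables.\<close>

lemma malliavin_orthogonal:
  assumes Z: "L2_rv M Z"
    and wave: "\<And>w k W \<theta>. elementary w k W \<Longrightarrow> (\<integral>\<omega>. cos (W \<omega> + \<theta>) * Z \<omega> \<partial>M) = 0"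
    and F: "malliavin M B T e F G"
  shows "(\<integral>\<omega>. F \<omega> * Z \<omega> \<partial>M) = 0"
proof -
  have smooth: "(\<integral>\<omega>. F \<omega> * Z \<omega> \<partial>M) = 0" if sm: "smooth_malliavin M B T e F G" for F G
  proof -
    obtain n f \<phi> Y w k W where f: "smooth_bounded_partials n f"
      and el: "\<And>i j. i < n \<Longrightarrow> elementary (w j i) (k j i) (W j i)"
      and W: "\<And>i. i < n \<Longrightarrow> L2_tendsto M (\<lambda>j. W j i) (Y i)"
      and Feq: "F = (\<lambda>\<omega>. f (\<lambda>i. Y i \<omega>))"
      by (rule smooth_malliavin_cases[OF sm]) (rule that)
    obtain C where lip: "lipschitz_coords n C f"
      by (rule smooth_bounded_partialsD[OF f]) (rule that)
    have "(\<integral>\<omega>. Z \<omega> * f (\<lambda>i. W j i \<omega>) \<partial>M) = (\<integral>\<omega>. 0 * f (\<lambda>i. W j i \<omega>) \<partial>M)" for j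
    proof (rule weighted_law_eqI[OF lip, where ?Y1.0 = "W j" and ?Y2.0 = "W j"])
      fix l :: "nat \<Rightarrow> real" and \<theta> :: real
      show "(\<integral>\<omega>. Z \<omega> * cos ((\<Sum>i<n. l i * W j i \<omega>) + \<theta>) \<partial>M) =
          (\<integral>\<omega>. 0 * cos ((\<Sum>i<n. l i * W j i \<omega>) + \<theta>) \<partial>M)"
        using wave[OF elementary_sum[where w = "w j" and k = "k j" and W = "W j" and l = l, OF el], of n \<theta>]
        by (simp add: mult.commute)
      show "integrable M Z" by (rule L2_integrable[OF finite_measure_axioms Z])
      show "integrable M (\<lambda>\<omega>. Z \<omega> * W j i \<omega>)" if "i < n" for i
        by (rule L2_integrable_mult[OF Z elementary_L2[OF el[OF that]]])
    qed (use elementary_measurable[OF el] in auto)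
    then have "(\<integral>\<omega>. f (\<lambda>i. W j i \<omega>) * Z \<omega> \<partial>M) = 0" for j by (simp add: mult.commute)
    moreover have "(\<lambda>j. \<integral>\<omega>. f (\<lambda>i. W j i \<omega>) * Z \<omega> \<partial>M) \<longlonglongrightarrow> (\<integral>\<omega>. F \<omega> * Z \<omega> \<partial>M)"
      unfolding Feq by (rule L2_tendsto_mult[OF lipschitz_L2_tendsto[OF finite_measure_axioms lip W] Z])
    ultimately show ?thesis by (simp add: LIMSEQ_const_iff)
  qed
  obtain F' G' where F': "\<And>k. smooth_malliavin M B T e (F' k) (G' k)" "L2_tendsto M F' F"
    using F by (auto simp: malliavin_def)
  show ?thesis
    using L2_tendsto_mult[OF F'(2) Z] by (simp add: smooth[OF F'(1)] LIMSEQ_const_iff)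
qed

lemma divergence_orthogonal:
  assumes Z: "L2_rv M Z"
    and wave: "\<And>w k W \<theta>. elementary w k W \<Longrightarrow> (\<integral>\<omega>. cos (W \<omega> + \<theta>) * Z \<omega> \<partial>M) = 0"
    and D: "has_divergence M B T e h D"
  shows "(\<integral>\<omega>. D \<omega> * Z \<omega> \<partial>M) = 0"
proof -
  obtain F G where F: "\<And>k. malliavin M B T e (F k) (G k)" "L2_tendsto M F D"
    using D by (auto simp: has_divergence_def)
  show ?thesis
    using L2_tendsto_mult[OF F(2) Z] by (simp add: malliavin_orthogonal[OF Z wave F(1)] LIMSEQ_const_iff)
qed

theorem solution_unique:
  assumes X: "is_solution M H B T e X" and Y: "is_solution M H B T e Y" and t: "t \<in> {0..T}"
  shows "AE \<omega> in M. X t \<omega> = Y t \<omega>"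
proof -
  obtain D h where D: "has_divergence M B T e h D" "AE \<omega> in M. X t \<omega> = 1 + D \<omega>"
    by (rule solutionE[OF X t])
  obtain D' h' where D': "has_divergence M B T e h' D'" "AE \<omega> in M. Y t \<omega> = 1 + D' \<omega>"
    by (rule solutionE[OF Y t])
  define Z where "Z \<omega> = X t \<omega> - Y t \<omega>" for \<omega>
  have Z: "L2_rv M Z" unfolding Z_def by (intro L2_rv_diff solution_L2[OF X t] solution_L2[OF Y t])
  have DL2: "L2_rv M D" "L2_rv M D'" using D(1) D'(1) by (auto simp: has_divergence_def)
  note [measurable] = L2_rvD(1)[OF Z] L2_rvD(1)[OF DL2(1)] L2_rvD(1)[OF DL2(2)]
  have wave: "(\<integral>\<omega>. cos (W \<omega> + \<theta>) * Z \<omega> \<partial>M) = 0" if "elementary w k W" for w k W \<theta>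
    unfolding Z_def by (rule solution_difference_wave[OF X Y t that])
  have "AE \<omega> in M. (Z \<omega>)\<^sup>2 = D \<omega> * Z \<omega> - D' \<omega> * Z \<omega>"
    using D(2) D'(2) by eventually_elim (simp add: Z_def power2_eq_square left_diff_distrib)
  then have "(\<integral>\<omega>. (Z \<omega>)\<^sup>2 \<partial>M) = (\<integral>\<omega>. D \<omega> * Z \<omega> - D' \<omega> * Z \<omega> \<partial>M)"
    by (intro integral_cong_AE) auto
  also have "\<dots> = 0"
    using L2_integrable_mult[OF DL2(1) Z] L2_integrable_mult[OF DL2(2) Z]
      divergence_orthogonal[OF Z wave D(1)] divergence_orthogonal[OF Z wave D'(1)] by simp
  finally have "AE \<omega> in M. (Z \<omega>)\<^sup>2 = 0"
    using L2_rvD(2)[OF Z] by (subst (asm) integral_nonneg_eq_0_iff_AE) auto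
  then show ?thesis by eventually_elim (simp add: Z_def)
qed

end

theorem theorem4p4:
  fixes M :: "'a measure" and H T :: real and B :: "real \<Rightarrow> 'a \<Rightarrow> real"
    and e :: "real \<Rightarrow> 'u::{real_inner,banach,second_countable_topology}"
  assumes "1/2 < H" and "H < 1" and "0 < T"
    and "prob_space M" and "complete_measure M"
    and "fractional_brownian_motion M H B"
    and "U_completion H T e"
  shows "is_solution M H B T e (\<lambda>t \<omega>. exp (B t \<omega> - t powr (2 * H) / 2)) \<and>
    (\<forall>X Y. is_solution M H B T e X \<longrightarrow> is_solution M H B T e Y \<longrightarrow>
       (\<forall>t\<in>{0..T}. AE \<omega> in M. X t \<omega> = Y t \<omega>))"
proof -
  interpret fbm_space M H T B e
    using assms by (intro fbm_space.intro fbm_space_axioms.intro)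
  have "geometric_fbm = (\<lambda>t \<omega>. exp (B t \<omega> - t powr (2 * H) / 2))"
    by (simp add: fun_eq_iff geometric_fbm_def)
  then show ?thesis using geometric_fbm_is_solution solution_unique by simp
qed

end
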